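(* Let $\mathbf{S}_0$ be the $2$-adic Banach space of $2^{-1/2}$-overconvergent cuspidal $2$-adic modular forms of weight $0$ and tame level $1$ over $\mathbf{Q}_2$, with its compact operator $U=U_2$. Then the ($2$-adic) Newton polygon of the characteristic power series $\det(1-XU)$ of $U$ on $\mathbf{S}_0$ is the ($2$-adic) Newton polygon of $$1+\sum_{n=1}^{\infty}X^n\prod_{j=1}^{n}\frac{2^{2j}\,(12j+2)!\,(6j)!}{(8j+2)!\,(8j-2)!\,(-12j)}.$$
   Context: Let $\Delta(\tau)=q\prod_{n\ge1}(1-q^n)^{24}$, $q=e^{2\pi i\tau}$, $f(\tau)=\Delta(2\tau)/\Delta(\tau)=q+24q^2+\cdots$ and $g=2^6f$. The space $\mathbf{M}_0$ of $2^{-1/2}$-overconvergent $2$-adic modular forms of weight $0$ and tame level $1$ is the Banach space (with supremum norm) of rigid analytic functions over $\mathbf{Q}_2$ on the affinoid $X_0(1)_{\ge 2^{-1/2}}$ of the level one modular curve obtained by removing the open disc of radius $2^{-1/2}$ (in the sense of a suitable local parameter after adding auxiliary level structure) over the supersingular point. Concretely this affinoid is the region $\{|j|\ge 2^{-6}\}$ of the $j$-line, and it is identified (preserving $q$-expansions) with the region $\{|g|\le 1\}$ of $X_0(2)$; thus $\mathbf{M}_0$ is the space of series $\sum_{n\ge0}a_ng^n$ with $a_n\in\mathbf{Q}_2$, $a_n\to0$, with norm $\max_n|a_n|$. The subspace $\mathbf{S}_0=\mathbf{S}_0(\mathrm{SL}_2(\mathbf{Z});\mathbf{Q}_2;2^{-1/2})$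 consists of the elements whose $q$-expansion has zero constant term, i.e. the series $\sum_{n\ge1}a_ng^n$ with $a_n\to 0$. The operator $U$ acts on $q$-expansions by $U(\sum a_nq^n)=\sum a_{2n}q^n$; it is a compact operator on $\mathbf{M}_0$ preserving $\mathbf{S}_0$, and $\det(1-XU)\in\mathbf{Q}_2[[X]]$ denotes its characteristic (Fredholm) power series in the sense of Serre. The Newton polygon of a power series $1+\sum_{n\ge1} c_nX^n$ is the lower convex hull of the points $(0,0)$ and $(n,v_2(c_n))$, where $v_2$ is the $2$-adic valuation with $v_2(2)=1$. *)

theory Defs
  imports
    "HOL-Analysis.Analysis"
    "HOL-Combinatorics.Permutations"
    "HOL-Computational_Algebra.Formal_Power_Series"
begin

section \<open>The field of 2-adic numbers\<close>

subsection \<open>The 2-adic absolute value on the rationals\<close>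

definition rat_abs2 :: "rat \<Rightarrow> real" where
  "rat_abs2 x = (if x = 0 then 0 else
     2 powi (int (multiplicity 2 (snd (quotient_of x))) - int (multiplicity 2 (fst (quotient_of x)))))"

lemma rat_abs2_0 [simp]: "rat_abs2 0 = 0"
  by (simp add: rat_abs2_def)

lemma rat_abs2_frac:
  fixes a b :: int
  assumes "a \<noteq> 0" "b \<noteq> 0"
  shows "rat_abs2 (of_int a / of_int b) = 2 powi (int (multiplicity 2 b) - int (multiplicity 2 a))"
proof -
  obtain p q where pq: "quotient_of (of_int a / of_int b) = (p, q)"
    by (cases "quotient_of (of_int a / of_int b)")
  then have q: "q > 0" and eq: "(of_int a / of_int b :: rat) = of_int p / of_int q"
    using quotient_of_denom_pos quotient_of_div by blast+
  have "(of_int (a * q) :: rat) = of_int (p * b)"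
    using eq assms q by (simp add: field_simps)
  then have cross: "a * q = p * b"
    by (simp only: of_int_eq_iff)
  have p: "p \<noteq> 0"
    using cross assms q by auto
  have "multiplicity 2 (a * q) = multiplicity 2 a + multiplicity 2 q"
    "multiplicity 2 (p * b) = multiplicity 2 p + multiplicity 2 b"
    using assms q p by (auto intro!: prime_elem_multiplicity_mult_distrib)
  then have "int (multiplicity 2 q) - int (multiplicity 2 p)
      = int (multiplicity 2 b) - int (multiplicity 2 a)"
    using cross by simp
  then show ?thesis
    using pq assms by (simp add: rat_abs2_def)
qed

lemma rat_as_frac:
  fixes x :: rat
  obtains a b :: int where "b \<noteq> 0" "x = of_int a / of_int b"
  by (metis of_int_rat quotient_of_div quotient_of_denom_pos surj_pair less_irrefl)

lemma rat_abs2_nonneg [simp]: "0 \<le> rat_abs2 x"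
  by (simp add: rat_abs2_def)

lemma rat_abs2_eq_0_iff [simp]: "rat_abs2 x = 0 \<longleftrightarrow> x = 0"
  by (simp add: rat_abs2_def)

lemma rat_abs2_mult: "rat_abs2 (x * y) = rat_abs2 x * rat_abs2 y"
proof (cases "x = 0 \<or> y = 0")
  case False
  obtain a b where x: "b \<noteq> 0" "x = of_int a / of_int b"
    by (rule rat_as_frac)
  obtain c d where y: "d \<noteq> 0" "y = of_int c / of_int d"
    by (rule rat_as_frac)
  have nz: "a \<noteq> 0" "c \<noteq> 0"
    using False x y by auto
  have mults: "multiplicity 2 (a * c) = multiplicity 2 a + multiplicity 2 c"
    "multiplicity 2 (b * d) = multiplicity 2 b + multiplicity 2 d"
    using nz x y by (auto intro!: prime_elem_multiplicity_mult_distrib)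
  have "x * y = of_int (a * c) / of_int (b * d)"
    using x y by simp
  then have "rat_abs2 (x * y) = 2 powi (int (multiplicity 2 (b * d)) - int (multiplicity 2 (a * c)))"
    using nz x y by (simp only: rat_abs2_frac mult_eq_0_iff simp_thms)
  also have "\<dots> = 2 powi ((int (multiplicity 2 b) - int (multiplicity 2 a))
      + (int (multiplicity 2 d) - int (multiplicity 2 c)))"
    by (simp add: mults algebra_simps)
  also have "\<dots> = rat_abs2 x * rat_abs2 y"
    using nz x y by (simp add: rat_abs2_frac power_int_add)
  finally show ?thesis .
qed auto

lemma rat_abs2_1 [simp]: "rat_abs2 1 = 1"
  using rat_abs2_frac[of 1 1] by simp

lemma rat_abs2_minus [simp]: "rat_abs2 (- x) = rat_abs2 x"
proof -
  have "rat_abs2 (-1) = 1"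
    using rat_abs2_frac[of "-1" 1] by (simp add: not_dvd_imp_multiplicity_0)
  then show ?thesis
    using rat_abs2_mult[of "-1" x] by simp
qed

lemma rat_abs2_diff_commute: "rat_abs2 (x - y) = rat_abs2 (y - x)"
  by (metis rat_abs2_minus minus_diff_eq)

lemma rat_abs2_inverse: "rat_abs2 (inverse x) = inverse (rat_abs2 x)"
proof (cases "x = 0")
  case False
  then have "rat_abs2 x * rat_abs2 (inverse x) = 1"
    by (simp flip: rat_abs2_mult)
  then show ?thesis
    by (metis inverse_unique)
qed auto

lemma rat_abs2_ultrametric: "rat_abs2 (x + y) \<le> max (rat_abs2 x) (rat_abs2 y)"
proof (cases "x = 0 \<or> y = 0 \<or> x + y = 0")
  case True
  then show ?thesis
    by (auto simp: le_max_iff_disj)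
next
  case False
  obtain a b where x: "b \<noteq> 0" "x = of_int a / of_int b"
    by (rule rat_as_frac)
  obtain c d where y: "d \<noteq> 0" "y = of_int c / of_int d"
    by (rule rat_as_frac)
  define p q r where "p = a * d" and "q = c * b" and "r = b * d"
  have r: "r \<noteq> 0" and xr: "x = of_int p / of_int r" and yr: "y = of_int q / of_int r"
    using x y by (auto simp: p_def q_def r_def)
  have sr: "x + y = of_int (p + q) / of_int r"
    by (simp add: xr yr add_divide_distrib)
  have nz: "p \<noteq> 0" "q \<noteq> 0" "p + q \<noteq> 0"
    using False xr yr sr by auto
  have "2 ^ min (multiplicity 2 p) (multiplicity 2 q) dvd p + q"
    by (intro dvd_add multiplicity_dvd') auto
  then have "min (multiplicity 2 p) (multiplicity 2 q) \<le> multiplicity 2 (p + q)"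
    using nz by (intro multiplicity_geI) auto
  then have "multiplicity 2 p \<le> multiplicity 2 (p + q) \<or> multiplicity 2 q \<le> multiplicity 2 (p + q)"
    by auto
  moreover have "rat_abs2 (x + y) = 2 powi (int (multiplicity 2 r) - int (multiplicity 2 (p + q)))"
    "rat_abs2 x = 2 powi (int (multiplicity 2 r) - int (multiplicity 2 p))"
    "rat_abs2 y = 2 powi (int (multiplicity 2 r) - int (multiplicity 2 q))"
    unfolding sr unfolding xr yr using nz r by (simp_all only: rat_abs2_frac not_False_eq_True)
  ultimately show ?thesis
    by (auto simp: le_max_iff_disj intro!: power_int_increasing)
qed

lemma rat_abs2_triangle: "rat_abs2 (x + y) \<le> rat_abs2 x + rat_abs2 y"
  using rat_abs2_ultrametric[of x y] rat_abs2_nonneg[of x] rat_abs2_nonneg[of y] by linarith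

lemma rat_abs2_triangle_diff: "\<bar>rat_abs2 x - rat_abs2 y\<bar> \<le> rat_abs2 (x - y)"
  using rat_abs2_triangle[of "x - y" y] rat_abs2_triangle[of "y - x" x]
    rat_abs2_diff_commute[of x y] by simp

subsection \<open>Cauchy sequences for the 2-adic absolute value\<close>

definition vanishes2 :: "(nat \<Rightarrow> rat) \<Rightarrow> bool" where
  "vanishes2 X \<longleftrightarrow> (\<lambda>n. rat_abs2 (X n)) \<longlonglongrightarrow> 0"

definition cauchy2 :: "(nat \<Rightarrow> rat) \<Rightarrow> bool" where
  "cauchy2 X \<longleftrightarrow> (\<forall>e>0. \<exists>k. \<forall>m\<ge>k. \<forall>n\<ge>k. rat_abs2 (X m - X n) < e)"

lemma vanishes2_const [simp]: "vanishes2 (\<lambda>n. c) \<longleftrightarrow> c = 0"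
  by (simp add: vanishes2_def LIMSEQ_const_iff)

lemma vanishes2_le:
  assumes "vanishes2 X" "vanishes2 Y"
    and "\<And>n. rat_abs2 (Z n) \<le> a * rat_abs2 (X n) + b * rat_abs2 (Y n)"
  shows "vanishes2 Z"
  unfolding vanishes2_def
proof (rule Lim_null_comparison)
  have "(\<lambda>n. a * rat_abs2 (X n) + b * rat_abs2 (Y n)) \<longlonglongrightarrow> a * 0 + b * 0"
    using assms(1,2) unfolding vanishes2_def
    by (rule tendsto_add[OF tendsto_mult_left tendsto_mult_left])
  then show "(\<lambda>n. a * rat_abs2 (X n) + b * rat_abs2 (Y n)) \<longlonglongrightarrow> 0"
    by simp
  show "eventually (\<lambda>n. norm (rat_abs2 (Z n)) \<le> a * rat_abs2 (X n) + b * rat_abs2 (Y n)) sequentially"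
    by (rule always_eventually) (simp add: assms(3))
qed

lemma vanishes2_minus: "vanishes2 X \<Longrightarrow> vanishes2 (\<lambda>n. - X n)"
  by (simp add: vanishes2_def)

lemma vanishes2_add: "vanishes2 X \<Longrightarrow> vanishes2 Y \<Longrightarrow> vanishes2 (\<lambda>n. X n + Y n)"
  by (rule vanishes2_le[where X = X and Y = Y and a = 1 and b = 1])
    (simp_all add: rat_abs2_triangle)

lemma vanishes2_diff: "vanishes2 X \<Longrightarrow> vanishes2 Y \<Longrightarrow> vanishes2 (\<lambda>n. X n - Y n)"
  using vanishes2_add[of X "\<lambda>n. - Y n"] vanishes2_minus[of Y] by simp

lemma cauchy2_const [simp]: "cauchy2 (\<lambda>n. c)"
  by (auto simp: cauchy2_def)

lemma cauchy2_bounded: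
  assumes "cauchy2 X"
  shows "\<exists>b>0. \<forall>n. rat_abs2 (X n) \<le> b"
proof -
  obtain k where k: "\<And>n. n \<ge> k \<Longrightarrow> rat_abs2 (X n - X k) < 1"
    using assms unfolding cauchy2_def by (meson order_refl zero_less_one)
  define b where "b = (\<Sum>i\<le>k. rat_abs2 (X i)) + 1"
  have le_sum: "rat_abs2 (X i) \<le> (\<Sum>i\<le>k. rat_abs2 (X i))" if "i \<le> k" for i
    by (rule member_le_sum) (use that in auto)
  have "rat_abs2 (X n) \<le> b" for n
  proof (cases "n \<le> k")
    case True
    then show ?thesis
      using le_sum[of n] unfolding b_def by linarith
  next
    case False
    have "rat_abs2 (X n) \<le> rat_abs2 (X n - X k) + rat_abs2 (X k)"
      using rat_abs2_triangle[of "X n - X k" "X k"] by (simp only: diff_add_cancel)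
    then show ?thesis
      using k[of n] False le_sum[of k] unfolding b_def by linarith
  qed
  moreover have "b > 0"
    unfolding b_def by (intro add_nonneg_pos sum_nonneg) auto
  ultimately show ?thesis by blast
qed

lemma cauchy2_le:
  assumes X: "cauchy2 X" and Y: "cauchy2 Y" and a: "a \<ge> 0" and b: "b \<ge> 0"
    and Z: "\<And>m n. m \<ge> l \<Longrightarrow> n \<ge> l \<Longrightarrow>
      rat_abs2 (Z m - Z n) \<le> a * rat_abs2 (X m - X n) + b * rat_abs2 (Y m - Y n)"
  shows "cauchy2 Z"
  unfolding cauchy2_def
proof (intro allI impI)
  fix e :: real assume e: "e > 0"
  define d where "d = e / (a + b + 1)"
  have d: "d > 0" using e a b by (simp add: d_def)
  obtain i where i: "\<And>m n. m \<ge> i \<Longrightarrow> n \<ge> i \<Longrightarrow> rat_abs2 (X m - X n) < d"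
    using X d unfolding cauchy2_def by blast
  obtain j where j: "\<And>m n. m \<ge> j \<Longrightarrow> n \<ge> j \<Longrightarrow> rat_abs2 (Y m - Y n) < d"
    using Y d unfolding cauchy2_def by blast
  have "rat_abs2 (Z m - Z n) < e" if "m \<ge> max l (max i j)" "n \<ge> max l (max i j)" for m n
  proof -
    have "rat_abs2 (Z m - Z n) \<le> a * rat_abs2 (X m - X n) + b * rat_abs2 (Y m - Y n)"
      using that by (intro Z) auto
    also have "\<dots> \<le> a * d + b * d"
      using i[of m n] j[of m n] that a b by (intro add_mono mult_left_mono) auto
    also have "\<dots> < (a + b + 1) * d"
      using d by (simp add: algebra_simps)
    also have "\<dots> = e"
      using a b by (simp add: d_def)
    finally show ?thesis .
  qed
  then show "\<exists>k. \<forall>m\<ge>k. \<forall>n\<ge>k. rat_abs2 (Z m - Z n) < e" by blast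
qed

lemma cauchy2_add:
  assumes "cauchy2 X" "cauchy2 Y" shows "cauchy2 (\<lambda>n. X n + Y n)"
proof (rule cauchy2_le[OF assms, where a = 1 and b = 1 and l = 0])
  show "rat_abs2 (X m + Y m - (X n + Y n)) \<le> 1 * rat_abs2 (X m - X n) + 1 * rat_abs2 (Y m - Y n)" for m n
    using rat_abs2_triangle[of "X m - X n" "Y m - Y n"] by (simp add: algebra_simps)
qed auto

lemma cauchy2_minus: "cauchy2 X \<Longrightarrow> cauchy2 (\<lambda>n. - X n)"
  unfolding cauchy2_def by (metis minus_diff_minus rat_abs2_minus)

lemma rat_abs2_mult_diff:
  "rat_abs2 (x * y - x' * y') \<le> rat_abs2 y * rat_abs2 (x - x') + rat_abs2 x' * rat_abs2 (y - y')"
proof -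
  have "x * y - x' * y' = y * (x - x') + x' * (y - y')"
    by (simp add: algebra_simps)
  then show ?thesis
    using rat_abs2_triangle[of "y * (x - x')" "x' * (y - y')"] by (simp only: rat_abs2_mult)
qed

lemma cauchy2_mult:
  assumes "cauchy2 X" "cauchy2 Y" shows "cauchy2 (\<lambda>n. X n * Y n)"
proof -
  obtain a where a: "a > 0" "\<And>n. rat_abs2 (X n) \<le> a"
    using cauchy2_bounded[OF assms(1)] by blast
  obtain b where b: "b > 0" "\<And>n. rat_abs2 (Y n) \<le> b"
    using cauchy2_bounded[OF assms(2)] by blast
  show ?thesis
  proof (rule cauchy2_le[OF assms, where a = b and b = a and l = 0])
    show "rat_abs2 (X m * Y m - X n * Y n) \<le> b * rat_abs2 (X m - X n) + a * rat_abs2 (Y m - Y n)" for m n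
      by (rule order_trans[OF rat_abs2_mult_diff])
        (intro add_mono mult_right_mono a b rat_abs2_nonneg)
  qed (use a b in auto)
qed

lemma vanishes2_mult_diff:
  assumes "cauchy2 X'" "cauchy2 Y" "vanishes2 (\<lambda>n. X n - X' n)" "vanishes2 (\<lambda>n. Y n - Y' n)"
  shows "vanishes2 (\<lambda>n. X n * Y n - X' n * Y' n)"
proof -
  obtain a where a: "a > 0" "\<And>n. rat_abs2 (X' n) \<le> a"
    using cauchy2_bounded[OF assms(1)] by blast
  obtain b where b: "b > 0" "\<And>n. rat_abs2 (Y n) \<le> b"
    using cauchy2_bounded[OF assms(2)] by blast
  show ?thesis
  proof (rule vanishes2_le[OF assms(3,4), where a = b and b = a])
    show "rat_abs2 (X n * Y n - X' n * Y' n) \<le> b * rat_abs2 (X n - X' n) + a * rat_abs2 (Y n - Y' n)" for n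
      by (rule order_trans[OF rat_abs2_mult_diff])
        (intro add_mono mult_right_mono a b rat_abs2_nonneg)
  qed
qed

lemma cauchy2_not_vanishes2:
  assumes "cauchy2 X" "\<not> vanishes2 X"
  obtains b k where "b > 0" "\<And>n. n \<ge> k \<Longrightarrow> b \<le> rat_abs2 (X n)"
proof -
  obtain r where r: "r > 0" and inf: "\<And>k. \<exists>n\<ge>k. r \<le> rat_abs2 (X n)"
    using assms(2) unfolding vanishes2_def LIMSEQ_iff by (auto simp: not_less)
  obtain k where k: "\<And>m n. m \<ge> k \<Longrightarrow> n \<ge> k \<Longrightarrow> rat_abs2 (X m - X n) < r / 2"
    using assms(1)[unfolded cauchy2_def, rule_format, of "r / 2"] r by auto
  obtain m where m: "m \<ge> k" "r \<le> rat_abs2 (X m)"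
    using inf by blast
  have "r / 2 \<le> rat_abs2 (X n)" if "n \<ge> k" for n
    using k[OF m(1) that] m(2) rat_abs2_triangle[of "X m - X n" "X n"] by simp
  with r that[of "r / 2" k] show thesis by simp
qed

lemma rat_abs2_inverse_diff:
  assumes "b > 0" "c > 0" "b \<le> rat_abs2 x" "c \<le> rat_abs2 y"
  shows "rat_abs2 (inverse x - inverse y) \<le> inverse b * inverse c * rat_abs2 (x - y)"
proof -
  have nz: "x \<noteq> 0" "y \<noteq> 0"
    using assms by auto
  have "rat_abs2 (inverse x - inverse y) = inverse (rat_abs2 x) * rat_abs2 (x - y) * inverse (rat_abs2 y)"
    using nz by (simp add: inverse_diff_inverse rat_abs2_mult rat_abs2_inverse)
  also have "\<dots> = inverse (rat_abs2 x) * inverse (rat_abs2 y) * rat_abs2 (x - y)"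
    by simp
  also have "\<dots> \<le> inverse b * inverse c * rat_abs2 (x - y)"
    using assms by (intro mult_right_mono mult_mono le_imp_inverse_le) auto
  finally show ?thesis .
qed

lemma cauchy2_inverse:
  assumes "cauchy2 X" "\<not> vanishes2 X" shows "cauchy2 (\<lambda>n. inverse (X n))"
proof -
  obtain b k where b: "b > 0" "\<And>n. n \<ge> k \<Longrightarrow> b \<le> rat_abs2 (X n)"
    using cauchy2_not_vanishes2[OF assms] by blast
  show ?thesis
  proof (rule cauchy2_le[OF assms(1,1), where a = "inverse b * inverse b" and b = 0 and l = k])
    show "rat_abs2 (inverse (X m) - inverse (X n))
        \<le> inverse b * inverse b * rat_abs2 (X m - X n) + 0 * rat_abs2 (X m - X n)"
      if "m \<ge> k" "n \<ge> k" for m n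
      using rat_abs2_inverse_diff[OF b(1) b(1) b(2)[OF that(1)] b(2)[OF that(2)]] by simp
  qed (use b in auto)
qed

lemma vanishes2_eventually_le:
  assumes "vanishes2 X" "\<And>n. n \<ge> k \<Longrightarrow> rat_abs2 (Z n) \<le> a * rat_abs2 (X n)"
  shows "vanishes2 Z"
  unfolding vanishes2_def
proof (rule Lim_null_comparison)
  have "(\<lambda>n. a * rat_abs2 (X n)) \<longlonglongrightarrow> a * 0"
    using assms(1) unfolding vanishes2_def by (rule tendsto_mult_left)
  then show "(\<lambda>n. a * rat_abs2 (X n)) \<longlonglongrightarrow> 0"
    by simp
  show "eventually (\<lambda>n. norm (rat_abs2 (Z n)) \<le> a * rat_abs2 (X n)) sequentially"
    by (rule eventually_sequentiallyI[of k]) (simp add: assms(2))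
qed

lemma vanishes2_diff_inverse:
  assumes "cauchy2 X" "\<not> vanishes2 X" "cauchy2 Y" "\<not> vanishes2 Y" "vanishes2 (\<lambda>n. X n - Y n)"
  shows "vanishes2 (\<lambda>n. inverse (X n) - inverse (Y n))"
proof -
  obtain b k where b: "b > 0" "\<And>n. n \<ge> k \<Longrightarrow> b \<le> rat_abs2 (X n)"
    using cauchy2_not_vanishes2[OF assms(1,2)] by blast
  obtain c l where c: "c > 0" "\<And>n. n \<ge> l \<Longrightarrow> c \<le> rat_abs2 (Y n)"
    using cauchy2_not_vanishes2[OF assms(3,4)] by blast
  show ?thesis
    by (rule vanishes2_eventually_le[OF assms(5), where k = "max k l" and a = "inverse b * inverse c"])
      (intro rat_abs2_inverse_diff b c; simp)
qed

subsection \<open>The completion\<close>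

definition qtwo_rel :: "(nat \<Rightarrow> rat) \<Rightarrow> (nat \<Rightarrow> rat) \<Rightarrow> bool" where
  "qtwo_rel X Y \<longleftrightarrow> cauchy2 X \<and> cauchy2 Y \<and> vanishes2 (\<lambda>n. X n - Y n)"

lemma qtwo_rel_refl: "cauchy2 X \<Longrightarrow> qtwo_rel X X"
  by (simp add: qtwo_rel_def)

lemma part_equivp_qtwo_rel: "part_equivp qtwo_rel"
proof (rule part_equivpI)
  show "\<exists>X. qtwo_rel X X"
    using qtwo_rel_refl[OF cauchy2_const] by blast
  show "symp qtwo_rel"
  proof (rule sympI)
    fix X Y assume "qtwo_rel X Y"
    then show "qtwo_rel Y X"
      using vanishes2_minus[of "\<lambda>n. X n - Y n"] by (simp add: qtwo_rel_def)
  qed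
  show "transp qtwo_rel"
  proof (rule transpI)
    fix X Y Z assume XY: "qtwo_rel X Y" and YZ: "qtwo_rel Y Z"
    then show "qtwo_rel X Z"
      using vanishes2_add[of "\<lambda>n. X n - Y n" "\<lambda>n. Y n - Z n"] by (simp add: qtwo_rel_def)
  qed
qed

quotient_type qtwo = "nat \<Rightarrow> rat" / partial: qtwo_rel
  morphisms rep_qtwo abs_qtwo
  by (rule part_equivp_qtwo_rel)

lemma Domainp_pcr_qtwo [transfer_domain_rule]: "Domainp pcr_qtwo = cauchy2"
  by (simp add: qtwo.domain_eq qtwo_rel_def)

lemma abs_qtwo_induct [case_names abs_qtwo, induct type: qtwo]:
  assumes "\<And>X. cauchy2 X \<Longrightarrow> P (abs_qtwo X)"
  shows "P x"
proof (induct x)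
  case (1 X)
  then show ?case
    using assms by (simp add: qtwo_rel_def)
qed

lemma pcr_qtwo_abs: "cauchy2 X \<Longrightarrow> pcr_qtwo X (abs_qtwo X)"
  unfolding qtwo.pcr_cr_eq cr_qtwo_def by (simp add: qtwo_rel_refl)

lemma eq_abs_qtwo:
  "cauchy2 X \<Longrightarrow> cauchy2 Y \<Longrightarrow> abs_qtwo X = abs_qtwo Y \<longleftrightarrow> vanishes2 (\<lambda>n. X n - Y n)"
  using qtwo.rel_eq_transfer pcr_qtwo_abs unfolding rel_fun_def qtwo_rel_def by blast

instantiation qtwo :: field
begin

lift_definition zero_qtwo :: qtwo is "\<lambda>n. 0"
  by (simp add: qtwo_rel_refl)

lift_definition one_qtwo :: qtwo is "\<lambda>n. 1"
  by (simp add: qtwo_rel_refl)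

lift_definition plus_qtwo :: "qtwo \<Rightarrow> qtwo \<Rightarrow> qtwo" is "\<lambda>X Y n. X n + Y n"
proof -
  fix X X' Y Y' assume "qtwo_rel X X'" "qtwo_rel Y Y'"
  then show "qtwo_rel (\<lambda>n. X n + Y n) (\<lambda>n. X' n + Y' n)"
    using vanishes2_add[of "\<lambda>n. X n - X' n" "\<lambda>n. Y n - Y' n"]
    by (simp add: qtwo_rel_def cauchy2_add add_diff_add)
qed

lift_definition uminus_qtwo :: "qtwo \<Rightarrow> qtwo" is "\<lambda>X n. - X n"
  unfolding qtwo_rel_def minus_diff_minus by (elim conjE) (intro conjI cauchy2_minus vanishes2_minus; assumption)

lift_definition times_qtwo :: "qtwo \<Rightarrow> qtwo \<Rightarrow> qtwo" is "\<lambda>X Y n. X n * Y n"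
  unfolding qtwo_rel_def by (intro conjI cauchy2_mult vanishes2_mult_diff) simp_all

lift_definition inverse_qtwo :: "qtwo \<Rightarrow> qtwo"
  is "\<lambda>X. if vanishes2 X then (\<lambda>n. 0) else (\<lambda>n. inverse (X n))"
proof -
  fix X Y
  assume "qtwo_rel X Y"
  then have X: "cauchy2 X" and Y: "cauchy2 Y" and XY: "vanishes2 (\<lambda>n. X n - Y n)"
    by (simp_all add: qtwo_rel_def)
  have "vanishes2 X \<longleftrightarrow> vanishes2 Y"
  proof
    assume "vanishes2 X"
    from vanishes2_diff[OF this XY] show "vanishes2 Y" by simp
  next
    assume "vanishes2 Y"
    from vanishes2_add[OF XY this] show "vanishes2 X" by simp
  qed
  then show "?thesis X Y"
    by (simp add: vanishes2_diff_inverse cauchy2_inverse X Y XY qtwo_rel_def)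
qed

definition "x - y = x + - y" for x y :: qtwo

definition "x div y = x * inverse y" for x y :: qtwo

lemma abs_qtwo_add: "cauchy2 X \<Longrightarrow> cauchy2 Y \<Longrightarrow> abs_qtwo X + abs_qtwo Y = abs_qtwo (\<lambda>n. X n + Y n)"
  by (simp add: plus_qtwo.abs_eq qtwo_rel_refl)

lemma abs_qtwo_minus: "cauchy2 X \<Longrightarrow> - abs_qtwo X = abs_qtwo (\<lambda>n. - X n)"
  by (simp add: uminus_qtwo.abs_eq qtwo_rel_refl)

lemma abs_qtwo_diff: "cauchy2 X \<Longrightarrow> cauchy2 Y \<Longrightarrow> abs_qtwo X - abs_qtwo Y = abs_qtwo (\<lambda>n. X n - Y n)"
  by (simp add: minus_qtwo_def abs_qtwo_add abs_qtwo_minus cauchy2_minus)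

lemma abs_qtwo_mult: "cauchy2 X \<Longrightarrow> cauchy2 Y \<Longrightarrow> abs_qtwo X * abs_qtwo Y = abs_qtwo (\<lambda>n. X n * Y n)"
  by (simp add: times_qtwo.abs_eq qtwo_rel_refl)

lemma abs_qtwo_inverse:
  "cauchy2 X \<Longrightarrow> \<not> vanishes2 X \<Longrightarrow> inverse (abs_qtwo X) = abs_qtwo (\<lambda>n. inverse (X n))"
  by (simp add: inverse_qtwo.abs_eq qtwo_rel_refl)

instance
proof
  fix a b c :: qtwo
  have ex: "\<exists>X. cauchy2 X \<and> x = abs_qtwo X" for x
    by (induct x) blast
  obtain X Y Z where X: "cauchy2 X" "a = abs_qtwo X" and Y: "cauchy2 Y" "b = abs_qtwo Y"
    and Z: "cauchy2 Z" "c = abs_qtwo Z"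
    using ex[of a] ex[of b] ex[of c] by blast
  note XY = X Y Z abs_qtwo_add abs_qtwo_mult cauchy2_add cauchy2_mult
  show "a + b = b + a"
    by (simp only: XY add.commute)
  show "(a + b) + c = a + (b + c)"
    by (simp only: XY add.assoc)
  show "0 + a = a"
    by (simp only: XY zero_qtwo_def map_fun_def id_apply cauchy2_const add_0_left)
  show "- a + a = 0"
    by (simp only: XY abs_qtwo_minus cauchy2_minus zero_qtwo_def add.left_inverse)
  show "a - b = a + - b"
    by (rule minus_qtwo_def)
  show "(a * b) * c = a * (b * c)"
    by (simp only: XY mult.assoc)
  show "a * b = b * a"
    by (simp only: XY mult.commute)
  show "1 * a = a"
    by (simp only: XY one_qtwo_def cauchy2_const mult_1_left)
  show "(a + b) * c = a * c + b * c"
    by (simp only: XY distrib_right)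
  show "(0::qtwo) \<noteq> 1"
  proof -
    have "\<not> vanishes2 (\<lambda>n. 0 - 1)"
      by (simp only: vanishes2_const)
    then show ?thesis
      by (simp only: zero_qtwo_def one_qtwo_def eq_abs_qtwo cauchy2_const not_False_eq_True)
  qed
  show "inverse a * a = 1" if "a \<noteq> 0"
  proof -
    have nz: "\<not> vanishes2 X"
      using that X by (simp only: zero_qtwo_def eq_abs_qtwo cauchy2_const diff_zero not_False_eq_True)
    obtain b k where b: "b > 0" "\<And>n. n \<ge> k \<Longrightarrow> b \<le> rat_abs2 (X n)"
      using cauchy2_not_vanishes2[OF X(1) nz] by blast
    have "X n \<noteq> 0" if "n \<ge> k" for n
      using b(1) b(2)[OF that] by auto
    then have eq: "inverse (X n) * X n - 1 = 0" if "n \<ge> k" for n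
      using that by simp
    have "vanishes2 (\<lambda>n. inverse (X n) * X n - 1)"
      by (rule vanishes2_eventually_le[where X = "\<lambda>n. 0" and k = k and a = 0])
        (simp_all only: eq rat_abs2_0 vanishes2_const mult_zero_left order_refl)
    then show ?thesis
      by (simp only: X nz one_qtwo_def abs_qtwo_inverse abs_qtwo_mult cauchy2_inverse
          cauchy2_mult cauchy2_const eq_abs_qtwo not_False_eq_True)
  qed
  show "a div b = a * inverse b"
    by (rule divide_qtwo_def)
  show "inverse (0::qtwo) = 0"
    by (simp only: zero_qtwo_def inverse_qtwo.abs_eq qtwo_rel_refl cauchy2_const vanishes2_const if_True
        simp_thms)
qed

end

lemma of_nat_qtwo: "of_nat k = abs_qtwo (\<lambda>n. of_nat k)"
  by (induction k) (simp_all only: of_nat_0 of_nat_Suc zero_qtwo_def one_qtwo_def abs_qtwo_add cauchy2_const)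

instance qtwo :: field_char_0
proof
  show "inj (of_nat :: nat \<Rightarrow> qtwo)"
    by (rule injI)
      (simp only: of_nat_qtwo eq_abs_qtwo cauchy2_const vanishes2_const right_minus_eq of_nat_eq_iff)
qed

lemma of_int_qtwo: "of_int k = abs_qtwo (\<lambda>n. of_int k)"
  by (cases k) (simp_all only: of_int_of_nat_eq of_int_minus of_nat_qtwo abs_qtwo_minus cauchy2_const)

lemma of_rat_qtwo: "of_rat r = abs_qtwo (\<lambda>n. r)"
proof -
  obtain a b where r: "b \<noteq> 0" "r = of_int a / of_int b"
    by (rule rat_as_frac)
  have "abs_qtwo (\<lambda>n. r) * of_int b = of_int a"
    using r by (simp only: of_int_qtwo abs_qtwo_mult cauchy2_const nonzero_eq_divide_eq of_int_eq_0_iff)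
      simp
  moreover have "of_rat r * (of_int b :: qtwo) = of_int a"
    unfolding r(2) of_rat_divide of_rat_of_int_eq using r(1) by simp
  ultimately show ?thesis
    using r by (metis mult_right_cancel of_int_eq_0_iff)
qed

subsection \<open>Absolute value and topology\<close>

lemma cauchy2_tendsto:
  assumes "cauchy2 X"
  shows "(\<lambda>n. rat_abs2 (X n)) \<longlonglongrightarrow> lim (\<lambda>n. rat_abs2 (X n))"
proof -
  have "Cauchy (\<lambda>n. rat_abs2 (X n))"
    using assms unfolding cauchy2_def Cauchy_def dist_real_def
    by (meson le_less_trans rat_abs2_triangle_diff)
  then show ?thesis
    by (simp add: Cauchy_convergent_iff convergent_LIMSEQ_iff)
qed

lift_definition qtwo_abs :: "qtwo \<Rightarrow> real" is "\<lambda>X. lim (\<lambda>n. rat_abs2 (X n))"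
proof -
  fix X Y assume XY: "qtwo_rel X Y"
  have "(\<lambda>n. rat_abs2 (X n) - rat_abs2 (Y n)) \<longlonglongrightarrow> 0"
    by (rule Lim_null_comparison[where g = "\<lambda>n. rat_abs2 (X n - Y n)"])
      (use XY in \<open>simp_all add: qtwo_rel_def vanishes2_def rat_abs2_triangle_diff\<close>)
  moreover have "(\<lambda>n. rat_abs2 (X n) - rat_abs2 (Y n)) \<longlonglongrightarrow>
      lim (\<lambda>n. rat_abs2 (X n)) - lim (\<lambda>n. rat_abs2 (Y n))"
    using XY unfolding qtwo_rel_def by (intro tendsto_diff cauchy2_tendsto) auto
  ultimately show "lim (\<lambda>n. rat_abs2 (X n)) = lim (\<lambda>n. rat_abs2 (Y n))"
    using LIMSEQ_unique by fastforce
qed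

lemma qtwo_abs_tendsto: "cauchy2 X \<Longrightarrow> (\<lambda>n. rat_abs2 (X n)) \<longlonglongrightarrow> qtwo_abs (abs_qtwo X)"
  using cauchy2_tendsto by (simp add: qtwo_abs.abs_eq qtwo_rel_refl)

lemma qtwo_abs_of_rat [simp]: "qtwo_abs (of_rat r :: qtwo) = rat_abs2 r"
  using qtwo_abs_tendsto[of "\<lambda>n. r"] by (simp add: of_rat_qtwo LIMSEQ_const_iff)

lemma qtwo_abs_eq_0_iff [simp]: "qtwo_abs x = 0 \<longleftrightarrow> x = 0" for x :: qtwo
proof (induct x)
  case (abs_qtwo X)
  have "qtwo_abs (abs_qtwo X) = 0 \<longleftrightarrow> vanishes2 X"
    using qtwo_abs_tendsto[OF abs_qtwo] LIMSEQ_unique unfolding vanishes2_def by fastforce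
  then show ?case
    using abs_qtwo by (simp add: zero_qtwo_def eq_abs_qtwo)
qed

lemma qtwo_abs_nonneg [simp]: "0 \<le> qtwo_abs x" for x :: qtwo
proof (induct x)
  case (abs_qtwo X)
  then show ?case
    using qtwo_abs_tendsto[OF abs_qtwo] by (intro LIMSEQ_le_const) auto
qed

lemma qtwo_abs_mult: "qtwo_abs (x * y) = qtwo_abs x * qtwo_abs y" for x y :: qtwo
proof (induct x)
  case X: (abs_qtwo X)
  show ?case
  proof (induct y)
    case Y: (abs_qtwo Y)
    have "(\<lambda>n. rat_abs2 (X n * Y n)) \<longlonglongrightarrow> qtwo_abs (abs_qtwo X) * qtwo_abs (abs_qtwo Y)"
      unfolding rat_abs2_mult using X Y by (intro tendsto_mult qtwo_abs_tendsto)
    moreover have "(\<lambda>n. rat_abs2 (X n * Y n)) \<longlonglongrightarrow> qtwo_abs (abs_qtwo X * abs_qtwo Y)"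
      using qtwo_abs_tendsto[OF cauchy2_mult[OF X Y]] X Y by (simp add: abs_qtwo_mult)
    ultimately show ?case
      by (rule LIMSEQ_unique[symmetric])
  qed
qed

lemma qtwo_abs_minus [simp]: "qtwo_abs (- x) = qtwo_abs x" for x :: qtwo
proof -
  have "qtwo_abs (- 1 :: qtwo) = 1"
    using qtwo_abs_of_rat[of "-1"] by (simp add: of_rat_minus)
  then show ?thesis
    using qtwo_abs_mult[of "- 1" x] by simp
qed

lemma qtwo_abs_ultrametric: "qtwo_abs (x + y) \<le> max (qtwo_abs x) (qtwo_abs y)" for x y :: qtwo
proof (induct x)
  case X: (abs_qtwo X)
  show ?case
  proof (induct y)
    case Y: (abs_qtwo Y)
    have "(\<lambda>n. max (rat_abs2 (X n)) (rat_abs2 (Y n))) \<longlonglongrightarrow> max (qtwo_abs (abs_qtwo X)) (qtwo_abs (abs_qtwo Y))"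
      using X Y by (intro tendsto_max qtwo_abs_tendsto)
    moreover have "(\<lambda>n. rat_abs2 (X n + Y n)) \<longlonglongrightarrow> qtwo_abs (abs_qtwo X + abs_qtwo Y)"
      using qtwo_abs_tendsto[OF cauchy2_add[OF X Y]] X Y by (simp add: abs_qtwo_add)
    ultimately show ?case
      by (intro LIMSEQ_le) (auto intro: rat_abs2_ultrametric)
  qed
qed

lemma qtwo_abs_triangle: "qtwo_abs (x + y) \<le> qtwo_abs x + qtwo_abs y" for x y :: qtwo
  using qtwo_abs_ultrametric[of x y] qtwo_abs_nonneg[of x] qtwo_abs_nonneg[of y] by linarith

instantiation qtwo :: metric_space
begin

definition dist_qtwo :: "qtwo \<Rightarrow> qtwo \<Rightarrow> real" where
  "dist_qtwo x y = qtwo_abs (x - y)"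

definition uniformity_qtwo :: "(qtwo \<times> qtwo) filter" where
  "uniformity_qtwo = (INF e\<in>{0<..}. principal {(x, y). dist x y < e})"

definition open_qtwo :: "qtwo set \<Rightarrow> bool" where
  "open_qtwo U \<longleftrightarrow> (\<forall>x\<in>U. eventually (\<lambda>(x', y). x' = x \<longrightarrow> y \<in> U) uniformity)"

instance
proof
  show "uniformity = (INF e\<in>{0<..}. principal {(x :: qtwo, y). dist x y < e})"
    by (rule uniformity_qtwo_def)
  show "open U \<longleftrightarrow> (\<forall>x\<in>U. eventually (\<lambda>(x', y). x' = x \<longrightarrow> y \<in> U) uniformity)" for U :: "qtwo set"
    by (rule open_qtwo_def)
  show "dist x y = 0 \<longleftrightarrow> x = y" for x y :: qtwo
    by (simp add: dist_qtwo_def)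
  show "dist x y \<le> dist x z + dist y z" for x y z :: qtwo
    using qtwo_abs_triangle[of "x - z" "z - y"] qtwo_abs_minus[of "y - z"]
    by (simp add: dist_qtwo_def)
qed

end

instance qtwo :: topological_ab_group_add
proof
  fix a b :: qtwo
  show "((\<lambda>x. fst x + snd x) \<longlongrightarrow> a + b) (nhds a \<times>\<^sub>F nhds b)"
  proof (rule tendstoI)
    fix e :: real assume e: "e > 0"
    have "eventually (\<lambda>x. dist x a < e / 2) (nhds a)" "eventually (\<lambda>x. dist x b < e / 2) (nhds b)"
      using e by (auto intro!: eventually_nhds_metric[THEN iffD2] half_gt_zero)
    moreover have "dist (x + y) (a + b) < e" if "dist x a < e / 2" "dist y b < e / 2" for x y
      using that qtwo_abs_triangle[of "x - a" "y - b"] by (simp add: dist_qtwo_def add_diff_add)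
    ultimately show "eventually (\<lambda>x. dist (fst x + snd x) (a + b) < e) (nhds a \<times>\<^sub>F nhds b)"
      unfolding eventually_prod_filter fst_conv snd_conv by blast
  qed
  show "((\<lambda>x. - x) \<longlongrightarrow> - a) (nhds a)"
  proof (rule tendstoI)
    fix e :: real assume e: "e > 0"
    have "dist (- x) (- a) = dist x a" for x
      using qtwo_abs_minus[of "x - a"] by (simp add: dist_qtwo_def)
    then show "eventually (\<lambda>x. dist (- x) (- a) < e) (nhds a)"
      using e by (auto intro!: eventually_nhds_metric[THEN iffD2])
  qed
qed

lemma of_rat_tendsto_abs_qtwo:
  assumes "cauchy2 X"
  shows "(\<lambda>n. of_rat (X n)) \<longlonglongrightarrow> abs_qtwo X"
proof (rule metric_LIMSEQ_I)
  fix e :: real assume e: "e > 0"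
  then obtain k where k: "\<And>m n. m \<ge> k \<Longrightarrow> n \<ge> k \<Longrightarrow> rat_abs2 (X m - X n) < e / 2"
    using assms[unfolded cauchy2_def, rule_format, of "e / 2"] by auto
  have "dist (of_rat (X n)) (abs_qtwo X) < e" if "n \<ge> k" for n
  proof -
    have "cauchy2 (\<lambda>m. X n - X m)"
      using cauchy2_add[OF cauchy2_const cauchy2_minus[OF assms], of "X n"] by simp
    from qtwo_abs_tendsto[OF this] have "qtwo_abs (abs_qtwo (\<lambda>m. X n - X m)) \<le> e / 2"
      by (rule LIMSEQ_le_const2) (use k that in \<open>auto intro!: exI[of _ k] less_imp_le\<close>)
    then show ?thesis
      using e assms by (simp add: dist_qtwo_def of_rat_qtwo abs_qtwo_diff)
  qed
  then show "\<exists>k. \<forall>n\<ge>k. dist (of_rat (X n)) (abs_qtwo X) < e" by blast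
qed

instance qtwo :: complete_space
proof
  fix x :: "nat \<Rightarrow> qtwo" assume x: "Cauchy x"
  have "\<exists>r. dist (of_rat r) y < e" if "e > 0" for y :: qtwo and e
  proof (induct y)
    case (abs_qtwo X)
    show ?case
      using metric_LIMSEQ_D[OF of_rat_tendsto_abs_qtwo[OF abs_qtwo] \<open>e > 0\<close>] by blast
  qed
  then have "\<exists>r. dist (of_rat r) (x n) < 1 / real (Suc n)" for n
    by simp
  then obtain r where r: "\<And>n. dist (of_rat (r n)) (x n) < 1 / real (Suc n)"
    by metis
  have close: "(\<lambda>n. dist (of_rat (r n)) (x n)) \<longlonglongrightarrow> 0"
    by (rule Lim_null_comparison[OF _ LIMSEQ_inverse_real_of_nat])
      (use r in \<open>auto intro!: always_eventually less_imp_le simp: inverse_eq_divide\<close>)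
  have "cauchy2 r"
    unfolding cauchy2_def
  proof (intro allI impI)
    fix e :: real assume e: "e > 0"
    obtain i where i: "\<And>m n. m \<ge> i \<Longrightarrow> n \<ge> i \<Longrightarrow> dist (x m) (x n) < e / 3"
      using x e unfolding Cauchy_def by (meson divide_pos_pos zero_less_numeral)
    obtain j where j: "\<And>n. n \<ge> j \<Longrightarrow> dist (of_rat (r n)) (x n) < e / 3"
      using metric_LIMSEQ_D[OF close, of "e / 3"] e by auto
    have "rat_abs2 (r m - r n) < e" if "m \<ge> max i j" "n \<ge> max i j" for m n
    proof -
      have "dist (of_rat (r m)) (of_rat (r n) :: qtwo)
          \<le> dist (of_rat (r m)) (x m) + dist (x m) (x n) + dist (of_rat (r n)) (x n)"
        using dist_triangle[of "of_rat (r m)" "of_rat (r n)" "x m"]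
          dist_triangle2[of "x m" "of_rat (r n)" "x n"] by linarith
      also have "\<dots> < e"
        using i[of m n] j[of m] j[of n] that by simp
      finally show ?thesis
        by (simp add: dist_qtwo_def flip: of_rat_diff)
    qed
    then show "\<exists>k. \<forall>m\<ge>k. \<forall>n\<ge>k. rat_abs2 (r m - r n) < e" by blast
  qed
  then have "(\<lambda>n. of_rat (r n)) \<longlonglongrightarrow> abs_qtwo r"
    by (rule of_rat_tendsto_abs_qtwo)
  then have "(\<lambda>n. dist (of_rat (r n)) (x n) + dist (of_rat (r n)) (abs_qtwo r)) \<longlonglongrightarrow> 0 + 0"
    using close by (intro tendsto_add) (simp_all only: tendsto_dist_iff[symmetric])
  then have "(\<lambda>n. dist (x n) (abs_qtwo r)) \<longlonglongrightarrow> 0"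
    unfolding add_0_left by (rule Lim_null_comparison[rotated]) (simp add: dist_triangle3)
  then have "x \<longlonglongrightarrow> abs_qtwo r"
    by (simp only: tendsto_dist_iff[symmetric])
  then show "convergent x"
    by (rule convergentI)
qed

definition val2 :: "qtwo \<Rightarrow> real" where
  "val2 x = - log 2 (qtwo_abs x)"

section \<open>Overconvergent forms of weight 0\<close>

text \<open>All forms are given by their \<open>q\<close>-expansions in \<open>\<rat>\<^sub>2[[q]]\<close>, where \<open>q\<close> is \<^const>\<open>fps_X\<close>;
  the infinite product is the limit in the \<open>q\<close>-adic metric of \<^type>\<open>fps\<close>.\<close>

definition Delta_q :: "qtwo fps" where
  "Delta_q = fps_X * (\<Prod>n. (1 - fps_X ^ Suc n) ^ 24)"

definition f_q :: "qtwo fps" where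
  "f_q = fps_compose Delta_q (fps_X ^ 2) / Delta_q"

definition g_q :: "qtwo fps" where
  "g_q = fps_const (2 ^ 6) * f_q"

text \<open>The composition is the \<open>q\<close>-expansion of \<open>\<Sum>n. a n * g ^ n\<close>: since \<^const>\<open>g_q\<close> has no constant
  term, only finitely many summands contribute to each coefficient.\<close>

definition g_series :: "(nat \<Rightarrow> qtwo) \<Rightarrow> qtwo fps" where
  "g_series a = fps_compose (Abs_fps a) g_q"

definition M0 :: "qtwo fps set" where
  "M0 = {g_series a | a. a \<longlonglongrightarrow> 0}"

text \<open>The coefficients \<open>a\<close> are determined by the \<open>q\<close>-expansion, as \<^const>\<open>g_q\<close> has order 1.\<close>

definition M0_norm :: "qtwo fps \<Rightarrow> real" where
  "M0_norm F = (THE r. \<exists>a. a \<longlonglongrightarrow> 0 \<and> F = g_series a \<and> r = (SUP n. qtwo_abs (a n)))"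

definition S0 :: "qtwo fps set" where
  "S0 = {F \<in> M0. fps_nth F 0 = 0}"

definition U2 :: "qtwo fps \<Rightarrow> qtwo fps" where
  "U2 F = Abs_fps (\<lambda>n. fps_nth F (2 * n))"

section \<open>Characteristic power series\<close>

text \<open>In this section \<open>E\<close> is a Banach space of power series over the 2-adic numbers, with norm \<open>N\<close>.\<close>

definition basis_expansion ::
    "(qtwo fps \<Rightarrow> real) \<Rightarrow> (nat \<Rightarrow> qtwo fps) \<Rightarrow> qtwo fps \<Rightarrow> (nat \<Rightarrow> qtwo) \<Rightarrow> bool" where
  "basis_expansion N e x a \<longleftrightarrow>
     a \<longlonglongrightarrow> 0 \<and> (\<lambda>n. N (x - (\<Sum>i<n. fps_const (a i) * e i))) \<longlonglongrightarrow> 0"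

definition orthonormal_basis ::
    "qtwo fps set \<Rightarrow> (qtwo fps \<Rightarrow> real) \<Rightarrow> (nat \<Rightarrow> qtwo fps) \<Rightarrow> bool" where
  "orthonormal_basis E N e \<longleftrightarrow>
     range e \<subseteq> E \<and>
     (\<forall>x\<in>E. \<exists>!a. basis_expansion N e x a) \<and>
     (\<forall>x\<in>E. \<forall>a. basis_expansion N e x a \<longrightarrow> N x = (SUP i. qtwo_abs (a i)))"

definition matrix_entry ::
    "(qtwo fps \<Rightarrow> real) \<Rightarrow> (nat \<Rightarrow> qtwo fps) \<Rightarrow> (qtwo fps \<Rightarrow> qtwo fps) \<Rightarrow> nat \<Rightarrow> nat \<Rightarrow> qtwo" where
  "matrix_entry N e u i j = (THE a. basis_expansion N e (u (e j)) a) i"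

definition principal_minor :: "(nat \<Rightarrow> nat \<Rightarrow> qtwo) \<Rightarrow> nat set \<Rightarrow> qtwo" where
  "principal_minor A S = (\<Sum>p | p permutes S. of_int (sign p) * (\<Prod>i\<in>S. A i (p i)))"

text \<open>Serre's formula for \<open>det (1 - X * A)\<close>: the coefficient of \<open>X ^ m\<close> is \<open>(-1) ^ m\<close> times the sum
  of all principal minors of size \<open>m\<close>.\<close>

definition fredholm_series :: "(nat \<Rightarrow> nat \<Rightarrow> qtwo) \<Rightarrow> qtwo fps" where
  "fredholm_series A =
     Abs_fps (\<lambda>m. (- 1) ^ m * infsum (principal_minor A) {S. finite S \<and> card S = m})"

text \<open>For compact \<open>u\<close> the series does not depend on the orthonormal basis, so an arbitrary one is
  chosen.\<close>

definition char_series ::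
    "qtwo fps set \<Rightarrow> (qtwo fps \<Rightarrow> real) \<Rightarrow> (qtwo fps \<Rightarrow> qtwo fps) \<Rightarrow> qtwo fps" where
  "char_series E N u = fredholm_series (matrix_entry N (SOME e. orthonormal_basis E N e) u)"

section \<open>Newton polygons\<close>

definition newton_points :: "qtwo fps \<Rightarrow> (real \<times> real) set" where
  "newton_points P = {(real n, val2 (fps_nth P n)) | n. fps_nth P n \<noteq> 0}"

text \<open>The lower boundary of the convex hull, as a function of the abscissa; it is \<open>\<infinity>\<close> outside the
  projection of the hull.\<close>

definition newton_polygon :: "qtwo fps \<Rightarrow> real \<Rightarrow> ereal" where
  "newton_polygon P x = (INF y\<in>{y. (x, y) \<in> convex hull newton_points P}. ereal y)"

end

theory Submission
  imports Defs
begin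

text \<open>
  The quadratic equation \<open>g\<^sup>2 = (48 G + 64 G\<^sup>2) g + 64 G\<close> with \<open>G(q) = g(q\<^sup>2)\<close>, a consequence of Jacobi's
  \<open>aequatio identica satis abstrusa\<close>, gives a recurrence for \<open>U (g ^ j)\<close>. Solving it, the coefficient of
  \<open>g ^ i\<close> in \<open>U (g ^ j)\<close> is \<open>3j (i + j - 1)! 2\<^bsup>2i + 2j - 1\<^esup> / ((2i - j)! (2j - i)!)\<close>.
  This matrix factors as \<open>A D B\<close> with \<open>A\<close> lower and \<open>B\<close> upper triangular, both 2-integral and congruent to the
  identity modulo \<open>2\<close>, and \<open>D\<close> diagonal with entries of valuation \<open>1 + 2 v((3t)! / t!)\<close>, a strictly
  increasing function of \<open>t \<ge> 1\<close>. As \<open>B A\<close> is again the identity modulo \<open>2\<close>, the \<open>n\<close>-th coefficient of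
  the characteristic series has the absolute value of the product of the first \<open>n\<close> diagonal entries, which is also the
  absolute value of the \<open>n\<close>-th product in the theorem. The argument applies to the matrix of \<open>U\<close> in any
  orthonormal basis, since only the products \<open>X D Y\<close> and \<open>Y X = B A\<close> of the transformed factors enter.
\<close>

text \<open>Equality of the polygons is obtained from equality of the absolute values of all
  coefficients. These cannot be read off from the principal minors of A D B, in which the diagonal
  entries mix and whose sum may cancel. A principal minor of D (B A) on a set T is the product of
  the entries of D over T times a unit; as the valuations increase strictly, the set of the first n
  indices alone gives the largest term, and nothing can cancel it.

  \<open>char_series\<close> uses an unspecified orthonormal basis, so the factorisation has to be
  free of bases: U x is the sum over t of the t-th diagonal entry times a linear form in x (a row of
  B) times a fixed cusp form (a column of A). The values of the linear forms on these cusp forms are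
  the entries of B A, whatever the basis.

  The factors are exchanged for finite matrices: the inner index is cut off at N, with an error
  below the expected value, and the outer one at I, where I tends to infinity.\<close>

section \<open>Triangular factorisation of the matrix of U\<close>

text \<open>Reciprocal factorials, extended by \<open>0\<close> to the negative integers: sums of their products then have the
  right support without side conditions.\<close>

definition rfact :: "int \<Rightarrow> 'a::field_char_0" where
  "rfact n = (if n < 0 then 0 else 1 / fact (nat n))"

lemma rfact_of_nat [simp]: "rfact (int n) = 1 / fact n"
  by (simp add: rfact_def)

lemma rfact_neg [simp]: "n < 0 \<Longrightarrow> rfact n = 0"
  by (simp add: rfact_def)

text \<open>Valid for every integer: at n = 0 the factor n supplies the value 0, and for n < 0 both
  sides vanish.\<close>

lemma rfact_rec: "rfact (n - 1) = of_int n * (rfact n :: 'a::field_char_0)"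
proof (cases "n > 0")
  case True
  then obtain m where "n = int (Suc m)"
    by (metis zero_less_imp_eq_int Suc_pred')
  then show ?thesis
    by (simp add: rfact_def nat_diff_distrib field_simps del: of_nat_Suc)
next
  case False
  then show ?thesis
    by (auto simp: rfact_def)
qed

text \<open>The t-th term in the (i, j) entry of the product of the triangular and diagonal factors,
  freed of the factors that do not depend on t.\<close>

definition ldu_summand :: "nat \<Rightarrow> nat \<Rightarrow> nat \<Rightarrow> 'a::field_char_0" where
  "ldu_summand i j t = 4 * of_nat t * fact (i + 2 * t - 1) * fact (j + 2 * t - 1)
     * rfact (int i - int t) * rfact (int i + int t) * rfact (2 * int t - int i)
     * rfact (int j - int t) * rfact (int j + int t) * rfact (2 * int t - int j)"

text \<open>A Wilf-Zeilberger mate of \<open>ldu_summand\<close>: a combination of the summands for \<open>i\<close> and \<open>i + 1\<close> telescopes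
  in \<open>t\<close>, which gives a first-order recurrence in \<open>i\<close> for the sum over \<open>t\<close>.\<close>

definition ldu_certificate :: "nat \<Rightarrow> nat \<Rightarrow> nat \<Rightarrow> 'a::field_char_0" where
  "ldu_certificate i j t = - 2 * (3 * of_nat i + 2) / (of_nat i + of_nat j + 1)
     * fact (i + 2 * t - 1) * fact (j + 2 * t - 1)
     * rfact (2 * int t - int i - 2) * rfact (2 * int t - int j - 2)
     * rfact (int i + 1 - int t) * rfact (int i + int t)
     * rfact (int j - int t) * rfact (int j + int t - 1)"

definition ldu_value :: "nat \<Rightarrow> nat \<Rightarrow> 'a::field_char_0" where
  "ldu_value i j = fact (2 * i) * fact (2 * j) * fact (i + j - 1) / (fact i ^ 2 * fact j ^ 2)
     * rfact (2 * int i - int j) * rfact (2 * int j - int i)"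

lemma ldu_wz:
  assumes "i \<ge> 1" "j \<ge> 1"
  shows "(of_nat i + 1) * (2 * of_nat i + 2 - of_nat j) * (2 * of_nat i + 1 - of_nat j) * ldu_summand (Suc i) j t
       - 2 * (2 * of_nat i + 1) * (of_nat i + of_nat j) * (2 * of_nat j - of_nat i) * ldu_summand i j t
       = (ldu_certificate i j (Suc t) - ldu_certificate i j t :: 'a::field_char_0)"
proof -
  obtain i' j' where ij: "i = Suc i'" "j = Suc j'"
    using assms by (metis Suc_le_D One_nat_def)
  define I J T :: 'a where "I = of_nat i" and "J = of_nat j" and "T = of_nat t"
  define a b :: 'a where "a = fact (i + 2 * t - 1)" and "b = fact (j + 2 * t - 1)"
  \<comment> \<open>Of each kind the reciprocal factorial with the largest argument: by
    \<open>rfact_rec\<close> all others are polynomial multiples of these, so nothing that may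
    vanish is ever divided by.\<close>
  define c e h k l m :: 'a where "c = rfact (int i + 1 - int t)" and "e = rfact (int i + int t + 1)"
    and "h = rfact (2 * int t - int i)" and "k = rfact (int j - int t)"
    and "l = rfact (int j + int t)" and "m = rfact (2 * int t - int j)"
  have f1: "fact (Suc i + 2 * t - 1) = (I + 2 * T) * a"
    by (simp add: ij I_def T_def a_def algebra_simps)
  have f2: "fact (i + 2 * Suc t - 1) = (I + 2 * T + 1) * (I + 2 * T) * a"
    by (simp add: ij I_def T_def a_def algebra_simps)
  have f3: "fact (j + 2 * Suc t - 1) = (J + 2 * T + 1) * (J + 2 * T) * b"
    by (simp add: ij J_def T_def b_def algebra_simps)
  have r1: "rfact (int i - int t) = (I + 1 - T) * c"
    using rfact_rec[of "int i + 1 - int t", where 'a='a] by (simp add: I_def T_def c_def)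
  have r2: "rfact (int i + int t) = (I + T + 1) * e"
    using rfact_rec[of "int i + int t + 1", where 'a='a] by (simp add: I_def T_def e_def)
  have r3: "rfact (2 * int t - int i - 1) = (2 * T - I) * h"
    using rfact_rec[of "2 * int t - int i", where 'a='a] by (simp add: I_def T_def h_def)
  have r4: "rfact (2 * int t - int i - 2) = (2 * T - I - 1) * (2 * T - I) * h"
    using rfact_rec[of "2 * int t - int i - 1", where 'a='a] r3 by (simp add: I_def T_def)
  have r5: "rfact (2 * int t - int j - 2) = (2 * T - J - 1) * (2 * T - J) * m"
    using rfact_rec[of "2 * int t - int j - 1", where 'a='a] rfact_rec[of "2 * int t - int j", where 'a='a]
    by (simp add: J_def T_def m_def)
  have r6: "rfact (int j - int t - 1) = (J - T) * k"
    using rfact_rec[of "int j - int t", where 'a='a] by (simp add: J_def T_def k_def)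
  have r7: "rfact (int j + int t - 1) = (J + T) * l"
    using rfact_rec[of "int j + int t", where 'a='a] by (simp add: J_def T_def l_def)
  have F1: "ldu_summand (Suc i) j t = 4 * T * ((I + 2 * T) * a) * b * c * e * ((2 * T - I) * h) * k * l * m"
  proof -
    have e: "int (Suc i) - int t = int i + 1 - int t" "int (Suc i) + int t = int i + int t + 1"
      "2 * int t - int (Suc i) = 2 * int t - int i - 1" by auto
    show ?thesis
      unfolding ldu_summand_def f1 e r3 by (simp add: c_def e_def k_def l_def m_def b_def T_def)
  qed
  have F2: "ldu_summand i j t = 4 * T * a * b * ((I + 1 - T) * c) * ((I + T + 1) * e) * h * k * l * m"
    unfolding ldu_summand_def r1 r2 by (simp add: h_def k_def l_def m_def a_def b_def T_def)
  have G1: "ldu_certificate i j (Suc t) = - 2 * (3 * I + 2) / (I + J + 1)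
     * ((I + 2 * T + 1) * (I + 2 * T) * a) * ((J + 2 * T + 1) * (J + 2 * T) * b)
     * h * m * ((I + 1 - T) * c) * e * ((J - T) * k) * l"
  proof -
    have e: "int i + 1 - int (Suc t) = int i - int t" "int i + int (Suc t) = int i + int t + 1"
      "2 * int (Suc t) - int i - 2 = 2 * int t - int i" "2 * int (Suc t) - int j - 2 = 2 * int t - int j"
      "int j - int (Suc t) = int j - int t - 1" "int j + int (Suc t) - 1 = int j + int t" by auto
    show ?thesis
      unfolding ldu_certificate_def f2 f3 e r1 r6 by (simp add: I_def J_def h_def m_def e_def l_def)
  qed
  have G2: "ldu_certificate i j t = - 2 * (3 * I + 2) / (I + J + 1) * a * b
     * ((2 * T - I - 1) * (2 * T - I) * h) * ((2 * T - J - 1) * (2 * T - J) * m)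
     * c * ((I + T + 1) * e) * k * ((J + T) * l)"
    unfolding ldu_certificate_def r4 r5 r2 r7 by (simp add: I_def J_def a_def b_def c_def k_def)
  have nz: "I + J + 1 \<noteq> 0"
    unfolding I_def J_def by (metis of_nat_add of_nat_1 of_nat_eq_0_iff add_is_0 one_neq_zero)
  have poly: "(I + J + 1) * ((I + 1) * (2 * I + 2 - J) * (2 * I + 1 - J) * (4 * T * (I + 2 * T) * (2 * T - I))
       - 2 * (2 * I + 1) * (I + J) * (2 * J - I) * (4 * T * (I + 1 - T) * (I + T + 1)))
     = - 2 * (3 * I + 2) * ((I + 2 * T + 1) * (I + 2 * T) * (J + 2 * T + 1) * (J + 2 * T) * (I + 1 - T) * (J - T)
        - (2 * T - I - 1) * (2 * T - I) * (2 * T - J - 1) * (2 * T - J) * (I + T + 1) * (J + T))"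
    by algebra
  have "?thesis \<longleftrightarrow> (I + 1) * (2 * I + 2 - J) * (2 * I + 1 - J) * ldu_summand (Suc i) j t
       - 2 * (2 * I + 1) * (I + J) * (2 * J - I) * ldu_summand i j t
       = (ldu_certificate i j (Suc t) - ldu_certificate i j t)"
    by (simp add: I_def J_def)
  also have "\<dots> \<longleftrightarrow> ((I + 1) * (2 * I + 2 - J) * (2 * I + 1 - J) * (4 * T * (I + 2 * T) * (2 * T - I))
       - 2 * (2 * I + 1) * (I + J) * (2 * J - I) * (4 * T * (I + 1 - T) * (I + T + 1))) * (a * b * c * e * h * k * l * m)
     = - 2 * (3 * I + 2) / (I + J + 1) * ((I + 2 * T + 1) * (I + 2 * T) * (J + 2 * T + 1) * (J + 2 * T) * (I + 1 - T) * (J - T)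
        - (2 * T - I - 1) * (2 * T - I) * (2 * T - J - 1) * (2 * T - J) * (I + T + 1) * (J + T)) * (a * b * c * e * h * k * l * m)"
    unfolding F1 F2 G1 G2 left_diff_distrib right_diff_distrib by (simp only: mult_ac)
  also have "\<dots> \<longleftrightarrow> True"
    using poly nz by (simp add: field_simps)
  finally show ?thesis by simp
qed

lemma ldu_sum_rec:
  assumes "i \<ge> 1" "j \<ge> 1"
  shows "(of_nat i + 1) * (2 * of_nat i + 2 - of_nat j) * (2 * of_nat i + 1 - of_nat j) * (\<Sum>t<i+3. ldu_summand (Suc i) j t)
       = (2 * (2 * of_nat i + 1) * (of_nat i + of_nat j) * (2 * of_nat j - of_nat i) * (\<Sum>t<i+3. ldu_summand i j t) :: 'a::field_char_0)"
proof -
  have "(\<Sum>t<i+3. (of_nat i + 1) * (2 * of_nat i + 2 - of_nat j) * (2 * of_nat i + 1 - of_nat j) * ldu_summand (Suc i) j t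
       - 2 * (2 * of_nat i + 1) * (of_nat i + of_nat j) * (2 * of_nat j - of_nat i) * ldu_summand i j t)
      = (ldu_certificate i j (i+3) - ldu_certificate i j 0 :: 'a)"
    unfolding ldu_wz[OF assms] by (rule sum_lessThan_telescope)
  \<comment> \<open>The boundary terms contain \<open>rfact (- i - 2)\<close> at t = 0 and
    \<open>rfact (- 2)\<close> at t = i + 3.\<close>
  also have "\<dots> = 0"
    by (simp add: ldu_certificate_def)
  finally show ?thesis
    by (simp add: sum_subtractf sum_distrib_left)
qed

lemma ldu_value_rec:
  assumes "j \<ge> 1"
  shows "(of_nat i + 1) * (2 * of_nat i + 2 - of_nat j) * (2 * of_nat i + 1 - of_nat j) * ldu_value (Suc i) j
       = (2 * (2 * of_nat i + 1) * (of_nat i + of_nat j) * (2 * of_nat j - of_nat i) * ldu_value i j :: 'a::field_char_0)"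
proof -
  define I J where "I = (of_nat i :: 'a)" and "J = (of_nat j :: 'a)"
  have nz: "I + 1 \<noteq> 0"
    unfolding I_def by (metis of_nat_Suc of_nat_eq_0_iff add.commute nat.distinct(1))
  have e: "2 * int i + 2 - int j - 1 = 2 * int i + 1 - int j" "2 * int i + 1 - int j - 1 = 2 * int i - int j"
    "2 * int j - (int i + 1) = 2 * int j - int i - 1"
    by auto
  have r1: "rfact (2 * int i - int j) = (2 * I + 2 - J) * (2 * I + 1 - J) * rfact (2 * int i + 2 - int j)"
    using rfact_rec[of "2 * int i + 2 - int j", where 'a='a] rfact_rec[of "2 * int i + 1 - int j", where 'a='a]
    unfolding e by (simp add: I_def J_def)
  have r2: "rfact (2 * int j - (int i + 1)) = (2 * J - I) * rfact (2 * int j - int i)"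
    using rfact_rec[of "2 * int j - int i", where 'a='a] unfolding e by (simp add: I_def J_def)
  have f1: "fact (2 * Suc i) = 2 * (I + 1) * (2 * I + 1) * (fact (2 * i) :: 'a)"
    by (simp add: I_def algebra_simps)
  have f2: "fact (Suc i + j - 1) = (I + J) * (fact (i + j - 1) :: 'a)"
    using assms by (cases j) (auto simp: I_def J_def algebra_simps)
  have f3: "fact (Suc i) = (I + 1) * (fact i :: 'a)"
    by (simp add: I_def)
  have A: "ldu_value (Suc i) j = 2 * (2 * I + 1) * (I + J) * (2 * J - I) / (I + 1) *
      (fact (2 * i) * fact (2 * j) * fact (i + j - 1) / (fact i ^ 2 * fact j ^ 2)
      * rfact (2 * int i + 2 - int j) * rfact (2 * int j - int i))"
  proof -
    define x y where "x = (fact i :: 'a)" and "y = (fact j :: 'a)"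
    have e': "2 * int (Suc i) - int j = 2 * int i + 2 - int j" "2 * int j - int (Suc i) = 2 * int j - (int i + 1)"
      by auto
    have "x \<noteq> 0" "y \<noteq> 0" by (simp_all add: x_def y_def)
    then show ?thesis
      unfolding ldu_value_def f1 f2 f3 e' r2 x_def[symmetric] y_def[symmetric] using nz
      by (simp add: divide_simps power2_eq_square) (simp add: algebra_simps)
  qed
  have B: "ldu_value i j = (2 * I + 2 - J) * (2 * I + 1 - J) *
      (fact (2 * i) * fact (2 * j) * fact (i + j - 1) / (fact i ^ 2 * fact j ^ 2)
      * rfact (2 * int i + 2 - int j) * rfact (2 * int j - int i))"
    unfolding ldu_value_def r1 by (simp add: mult_ac)
  show ?thesis
    unfolding A B I_def[symmetric] J_def[symmetric] using nz by (simp add: mult_ac)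
qed

lemma ldu_summand_eq_0: "t > i \<or> t > j \<or> 2 * t < i \<or> 2 * t < j \<Longrightarrow> ldu_summand i j t = 0"
  by (auto simp: ldu_summand_def)

lemma ldu_sum_extend:
  assumes "i < n"
  shows "(\<Sum>t<n. ldu_summand i j t) = (\<Sum>t\<le>i. ldu_summand i j t)"
  by (rule sum.mono_neutral_right) (use assms in \<open>auto intro!: ldu_summand_eq_0\<close>)

text \<open>For j = 2 m and i = m the conditions t <= i and j <= 2 t leave the single term t = m.
  The odd case is similar, with i = m + 1 and j = 2 m + 1.\<close>

lemma ldu_sum_base_even:
  assumes "m \<ge> 1"
  shows "(\<Sum>t\<le>m. ldu_summand m (2 * m) t) = (ldu_value m (2 * m) :: 'a::field_char_0)"
proof -
  have "(\<Sum>t\<le>m. ldu_summand m (2 * m) t) = (\<Sum>t\<in>{m}. ldu_summand m (2 * m) t :: 'a)"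
    by (rule sum.mono_neutral_right) (auto intro!: ldu_summand_eq_0)
  also have "\<dots> = ldu_summand m (2 * m) m" by simp
  also have "\<dots> = ldu_value m (2 * m)"
  proof -
    have r: "int m + int m = int (2*m)" "2 * int m - int m = int m"
      "int (2 * m) - int m = int m" "int (2 * m) + int m = int (3*m)" "2 * int (2 * m) - int m = int (3*m)"
      "2 * int m - int (2*m) = int 0" "int m - int m = int 0"
      by auto
    have f: "fact (2 * m + 2 * m) = 4 * of_nat m * (fact (2 * m + 2 * m - 1) :: 'a)"
      using assms by (cases m) (simp_all add: algebra_simps)
    have f': "fact (2 * (2 * m)) = 4 * of_nat m * (fact (2 * m + 2 * m - 1) :: 'a)"
      using f by (simp add: mult_2)
    define x :: 'a where "x = fact (2 * m + 2 * m - 1)"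
    have n: "m + 2 * m - 1 = 3 * m - 1" by simp
    show ?thesis
      unfolding ldu_summand_def ldu_value_def f' r rfact_of_nat x_def[symmetric] n
      by (simp add: divide_simps power2_eq_square)
  qed
  finally show ?thesis .
qed

lemma ldu_sum_base_odd:
  "(\<Sum>t\<le>Suc m. ldu_summand (Suc m) (2 * m + 1) t) = (ldu_value (Suc m) (2 * m + 1) :: 'a::field_char_0)"
proof -
  have "(\<Sum>t\<le>Suc m. ldu_summand (Suc m) (2 * m + 1) t) = (\<Sum>t\<in>{Suc m}. ldu_summand (Suc m) (2 * m + 1) t :: 'a)"
    by (rule sum.mono_neutral_right) (auto intro!: ldu_summand_eq_0)
  also have "\<dots> = ldu_summand (Suc m) (2 * m + 1) (Suc m)" by simp
  also have "\<dots> = ldu_value (Suc m) (2 * m + 1)"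
  proof -
    have r: "int (Suc m) + int (Suc m) = int (2*m+2)" "2 * int (Suc m) - int (Suc m) = int (m+1)"
      "int (2 * m+1) - int (Suc m) = int m" "int (2 * m+1) + int (Suc m) = int (3*m+2)" "2 * int (2 * m+1) - int (Suc m) = int (3*m+1)"
      "2 * int (Suc m) - int (2*m+1) = int 1" "int (Suc m) - int (Suc m) = int 0"
      by auto
    have n: "Suc m + 2 * Suc m - 1 = 3 * m + 2" "2 * m + 1 + 2 * Suc m - 1 = 4 * m + 2" "2 * Suc m = 2 * m + 2"
        "2 * (2 * m + 1) = 4 * m + 2" "Suc m + (2 * m + 1) - 1 = 3 * m + 1"
      by auto
    have f: "fact (2 * m + 2) = 2 * (of_nat m + 1) * (fact (2 * m + 1) :: 'a)"
      "fact (m + 1) = (of_nat m + 1) * (fact m :: 'a)"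
      "fact (Suc m) = (of_nat m + 1) * (fact m :: 'a)"
      by (simp_all add: algebra_simps)
    define x y z v w :: 'a where "x = fact (2 * m + 1)" and "y = fact m" and "z = fact (4 * m + 2)"
      and "v = fact (3 * m + 2)" and "w = fact (3 * m + 1)"
    have nz': "x \<noteq> 0" "y \<noteq> 0" "z \<noteq> 0" "v \<noteq> 0" "w \<noteq> 0"
      unfolding x_def y_def z_def v_def w_def by (rule fact_nonzero)+
    have nz: "of_nat m + 1 \<noteq> (0::'a)"
      by (metis of_nat_Suc of_nat_eq_0_iff add.commute nat.distinct(1))
    show ?thesis
      unfolding ldu_summand_def ldu_value_def n(1,2,5)
      unfolding r rfact_of_nat n f x_def[symmetric] y_def[symmetric]
        z_def[symmetric] v_def[symmetric] w_def[symmetric] using nz nz'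
      by (simp add: divide_simps power2_eq_square) (simp add: algebra_simps)
  qed
  finally show ?thesis .
qed

text \<open>The leading coefficient of the recurrence in i vanishes for j = 2 i + 1 and j = 2 i + 2,
  exactly at the step into the support j <= 2 i. Hence the induction starts at the least i with j <=
  2 i, and below it both sides are 0.\<close>

lemma ldu_sum:
  assumes "i \<ge> 1" "j \<ge> 1"
  shows "(\<Sum>t\<le>i. ldu_summand i j t) = (ldu_value i j :: 'a::field_char_0)"
proof -
  define m where "m = (j + 1) div 2"
  have m: "m \<ge> 1" "j \<le> 2 * m" using assms by (auto simp: m_def)
  have base: "(\<Sum>t\<le>m. ldu_summand m j t) = (ldu_value m j :: 'a)"
  proof (cases "even j")
    case True
    then have "j = 2 * m" by (auto simp: m_def)
    with ldu_sum_base_even m show ?thesis by blast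
  next
    case False
    then obtain k where "j = 2 * k + 1" by (auto elim: oddE)
    then show ?thesis using ldu_sum_base_odd[of k] by (simp add: m_def)
  qed
  show ?thesis
  proof (cases "i \<ge> m")
    case True
    then show ?thesis
    proof (induction i rule: dec_induct)
      case base show ?case by (rule \<open>(\<Sum>t\<le>m. ldu_summand m j t) = (ldu_value m j :: 'a)\<close>)
    next
      case (step i)
      have "int j \<le> 2 * int i" using m step by auto
      then have "2 * int i + 2 - int j \<noteq> 0" "2 * int i + 1 - int j \<noteq> 0" by auto
      then have "(of_int (2 * int i + 2 - int j) :: 'a) \<noteq> 0" "(of_int (2 * int i + 1 - int j) :: 'a) \<noteq> 0"
        unfolding of_int_eq_0_iff by auto
      then have nz: "(2 * of_nat i + 2 - of_nat j :: 'a) \<noteq> 0" "(2 * of_nat i + 1 - of_nat j :: 'a) \<noteq> 0"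
        "of_nat i + 1 \<noteq> (0::'a)"
        by (simp, simp, metis of_nat_Suc of_nat_eq_0_iff add.commute nat.distinct(1))
      have "(of_nat i + 1) * (2 * of_nat i + 2 - of_nat j) * (2 * of_nat i + 1 - of_nat j) * (\<Sum>t\<le>Suc i. ldu_summand (Suc i) j t)
        = (of_nat i + 1) * (2 * of_nat i + 2 - of_nat j) * (2 * of_nat i + 1 - of_nat j) * (ldu_value (Suc i) j :: 'a)"
        using ldu_sum_rec[of i j, where ?'a='a] ldu_value_rec[of j i, where ?'a='a] step.IH step.hyps m assms
        by (simp only: ldu_sum_extend[of "Suc i" "i+3"] ldu_sum_extend[of "i" "i+3"])
      then show ?case using nz by (simp only: mult_cancel_left mult_eq_0_iff simp_thms)
    qed
  next
    case False
    then have "2 * i < j" by (auto simp: m_def)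
    then have "ldu_value i j = (0 :: 'a)" by (simp add: ldu_value_def)
    moreover have "(\<Sum>t\<le>i. ldu_summand i j t) = (0 :: 'a)"
      using \<open>2 * i < j\<close> by (intro sum.neutral ballI ldu_summand_eq_0) auto
    ultimately show ?thesis by simp
  qed
qed

section \<open>Integral triangular factors\<close>

primrec odd_fact :: "nat \<Rightarrow> nat" where
  "odd_fact 0 = 1"
| "odd_fact (Suc n) = (2 * n + 1) * odd_fact n"

lemma fact_double_odd_fact: "fact (2 * n) = (2 ^ n * fact n * of_nat (odd_fact n) :: 'a::field_char_0)"
proof (induction n)
  case (Suc n)
  have "fact (2 * Suc n) = 2 * (of_nat n + 1) * (2 * of_nat n + 1) * (fact (2 * n) :: 'a)"
    by (simp add: algebra_simps)
  also have "\<dots> = 2 ^ Suc n * fact (Suc n) * of_nat (odd_fact (Suc n))"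
    unfolding Suc.IH by (simp add: algebra_simps)
  finally show ?case .
qed simp

lemma odd_odd_fact: "odd (odd_fact n)"
  by (induction n) auto

lemma odd_fact_nonzero [simp]: "odd_fact n \<noteq> 0"
  using odd_odd_fact[of n] by (metis even_zero)

text \<open>A product of a binomial coefficient and two quotients of factorials, so that integrality
  is built in: on the support t <= i <= 2 t both i + t <= 2 i and 2 t - i <= t hold, and the
  divisions are exact.\<close>

definition ldu_num :: "nat \<Rightarrow> nat \<Rightarrow> nat" where
  "ldu_num i t = (if t \<le> i \<and> i \<le> 2 * t
     then (i + 2 * t - 1 choose (i - t)) * (fact (2 * i) div fact (i + t)) * (fact t div fact (2 * t - i)) else 0)"

text \<open>The factors \<open>odd_fact n\<close> \<open>= (2n - 1)!!\<close> are 2-adic units. They are distributed so that both triangular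
  factors of the matrix of \<open>U\<close> are 2-integral and congruent to the identity modulo \<open>2\<close>.\<close>

definition ldu_left :: "nat \<Rightarrow> nat \<Rightarrow> 'a::field_char_0" where
  "ldu_left i t = of_nat (ldu_num i t) * of_nat (odd_fact t) ^ 2 / of_nat (odd_fact i) ^ 2"

definition ldu_diag :: "nat \<Rightarrow> 'a::field_char_0" where
  "ldu_diag t = 2 / 3 * (fact (3 * t) / fact t) ^ 2 / of_nat (odd_fact t) ^ 4"

text \<open>\<open>U_entry i j / j\<close> is symmetric in i and j; accordingly the right factor is
  the transpose of the left one, conjugated by the diagonal matrix with entries j.\<close>

definition ldu_right :: "nat \<Rightarrow> nat \<Rightarrow> 'a::field_char_0" where
  "ldu_right t j = ldu_left j t * of_nat j / of_nat t"

text \<open>The coefficient of \<open>g ^ i\<close> in \<open>U (g ^ j)\<close> for \<open>j \<ge> 1\<close>.\<close>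

definition U_entry :: "nat \<Rightarrow> nat \<Rightarrow> 'a::field_char_0" where
  "U_entry i j = 3 * of_nat j * fact (i + j - 1) * 2 ^ (2 * i + 2 * j - 1)
     * rfact (2 * int i - int j) * rfact (2 * int j - int i)"

lemma of_nat_fact_div_fact:
  assumes "m \<le> n"
  shows "of_nat (fact n div fact m) = (fact n / fact m :: 'a::field_char_0)"
proof -
  obtain k where k: "fact n = fact m * (k :: nat)"
    using fact_dvd[OF assms] by blast
  then have "(fact n :: 'a) = fact m * of_nat k"
    by (metis of_nat_fact of_nat_mult)
  then show ?thesis by (simp add: k)
qed

lemma of_nat_ldu_num:
  assumes "t \<ge> 1"
  shows "of_nat (ldu_num i t) = (fact (i + 2 * t - 1) / fact (3 * t - 1) * rfact (int i - int t) * fact (2 * i)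
     * rfact (int i + int t) * fact t * rfact (2 * int t - int i) :: 'a::field_char_0)"
proof (cases "t \<le> i \<and> i \<le> 2 * t")
  case True
  have c: "of_nat (i + 2 * t - 1 choose (i - t)) = (fact (i + 2 * t - 1) / (fact (i - t) * fact (3 * t - 1)) :: 'a)"
  proof -
    have "i + 2 * t - 1 - (i - t) = 3 * t - 1" using True assms by auto
    then show ?thesis using True assms by (subst binomial_fact) auto
  qed
  have d: "of_nat (fact (2 * i) div fact (i + t)) = (fact (2 * i) / fact (i + t) :: 'a)"
    "of_nat (fact t div fact (2 * t - i)) = (fact t / fact (2 * t - i) :: 'a)"
    using True of_nat_fact_div_fact[where 'a = 'a, of "i + t" "2 * i"] of_nat_fact_div_fact[where 'a = 'a, of "2 * t - i" t] by auto
  have e: "int i - int t = int (i - t)" "int i + int t = int (i + t)" "2 * int t - int i = int (2 * t - i)"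
    using True by auto
  show ?thesis
    unfolding e rfact_of_nat ldu_num_def if_P[OF True] of_nat_mult c d by simp
next
  case False
  then show ?thesis by (auto simp: ldu_num_def)
qed

text \<open>For t < i the quotient (2 i)! / (i + t)! contains the factor 2 i and t! / (2 t - i)!
  contains t. The 2 makes both triangular factors the identity modulo 2, and the t cancels the
  denominator of \<open>ldu_right\<close>.\<close>

lemma ldu_num_double:
  assumes "t < i" "1 \<le> t"
  shows "\<exists>k. ldu_num i t = 2 * t * k"
proof (cases "i \<le> 2 * t")
  case True
  have "fact (2 * i) div fact (i + t) = 2 * i * (fact (2 * i - 1) div fact (i + t) :: nat)"
  proof -
    have "fact (2 * i) = 2 * i * (fact (2 * i - 1) :: nat)" using assms by (simp add: fact_reduce)
    moreover have "fact (i + t) dvd (fact (2 * i - 1) :: nat)" using assms by (intro fact_dvd) auto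
    ultimately show ?thesis by (simp add: div_mult_swap)
  qed
  moreover have "fact t div fact (2 * t - i) = t * (fact (t - 1) div fact (2 * t - i) :: nat)"
  proof -
    have "fact t = t * (fact (t - 1) :: nat)" using assms by (simp add: fact_reduce)
    moreover have "fact (2 * t - i) dvd (fact (t - 1) :: nat)" using assms by (intro fact_dvd) auto
    ultimately show ?thesis by (simp add: div_mult_swap)
  qed
  ultimately show ?thesis
    using True assms unfolding ldu_num_def by (intro exI[of _ "(i + 2 * t - 1 choose (i - t)) * i *
       (fact (2 * i - 1) div fact (i + t)) * (fact (t - 1) div fact (2 * t - i))"]) simp
qed (auto simp: ldu_num_def)

lemma ldu_num_diag [simp]: "ldu_num t t = 1"
  by (simp add: ldu_num_def mult_2)

lemma ldu_num_0 [simp]: "i \<ge> 1 \<Longrightarrow> ldu_num i 0 = 0"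
  by (simp add: ldu_num_def)

text \<open>Taking out C, which does not depend on t, leaves the sum evaluated by
  \<open>ldu_sum\<close>. The powers of 2 in \<open>U_entry\<close> come from (2 i)! / (i! (2 i -
  1)!!) = 2^i, which occurs squared, and likewise for j.\<close>

lemma U_entry_ldu:
  assumes "i \<ge> 1" "j \<ge> 1"
  shows "U_entry i j = (\<Sum>t\<le>i. ldu_left i t * ldu_diag t * ldu_right t j :: 'a::field_char_0)"
proof -
  define C where "C = (of_nat j * fact (2 * i) * fact (2 * j) / (of_nat (odd_fact i) ^ 2 * of_nat (odd_fact j) ^ 2) :: 'a)"
  have "ldu_left i t * ldu_diag t * ldu_right t j = 3 / 2 * C * ldu_summand i j t" for t
  proof (cases "t = 0")
    case True
    then show ?thesis using assms by (simp add: ldu_left_def ldu_summand_def)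
  next
    case False
    then have t1: "t \<ge> 1" by simp
    have f: "fact (3 * t) = 3 * of_nat t * (fact (3 * t - 1) :: 'a)"
      using fact_reduce[of "3 * t", where 'a = 'a] False by simp
    have nz: "of_nat t \<noteq> (0::'a)" "of_nat (odd_fact t) \<noteq> (0::'a)" using False by auto
    have gen: "(x1 / y * x2 * x3 * x4 * F * x5) * Q\<^sup>2 / p * (2 / 3 * (3 * T * y / F)\<^sup>2 / Q ^ 4)
        * ((x1' / y * x2' * x3' * x4' * F * x5') * Q\<^sup>2 / p' * J / T)
       = 3 / 2 * (J * x3 * x3' / (p * p')) * (4 * T * x1 * x1' * x2 * x4 * x5 * x2' * x4' * x5')"
      if "y \<noteq> 0" "F \<noteq> 0" "T \<noteq> 0" "Q \<noteq> 0" "p \<noteq> 0" "p' \<noteq> 0"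
      for x1 x2 x3 x4 x5 x1' x2' x3' x4' x5' y F p p' T J Q :: 'a
      using that by (simp add: divide_simps) (simp add: algebra_simps power2_eq_square power4_eq_xxxx)
    show ?thesis
      unfolding ldu_left_def ldu_right_def ldu_diag_def ldu_summand_def C_def
        of_nat_ldu_num[of t i, where 'a = 'a, OF t1]
        of_nat_ldu_num[of t j, where 'a = 'a, OF t1] f
      by (rule gen) (use nz in auto)
  qed
  then have "(\<Sum>t\<le>i. ldu_left i t * ldu_diag t * ldu_right t j) = 3 / 2 * C * ldu_value i j"
    unfolding ldu_sum[OF assms, symmetric] sum_distrib_left by (intro sum.cong refl)
  also have "\<dots> = U_entry i j"
  proof -
    have p: "2 ^ (2 * i + 2 * j - 1) = (2 ^ i)\<^sup>2 * (2 ^ j)\<^sup>2 / (2::'a)"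
    proof -
      have "2 ^ (2 * i + 2 * j) = 2 * (2 ^ (2 * i + 2 * j - 1) :: 'a)"
        using assms by (subst power_Suc[symmetric]) (auto intro!: arg_cong[of _ _ "power 2"])
      moreover have "2 ^ (2 * i + 2 * j) = ((2 ^ i)\<^sup>2 * (2 ^ j)\<^sup>2 :: 'a)"
        by (simp add: power_add power_mult mult.commute flip: power_mult)
      ultimately show ?thesis by simp
    qed
    have gen: "3 / 2 * (J * (q * a * x) * (q' * a' * y) / (x\<^sup>2 * y\<^sup>2)) * ((q * a * x) * (q' * a' * y) * f / (a\<^sup>2 * a'\<^sup>2) * r * r')
       = 3 * J * f * (q\<^sup>2 * q'\<^sup>2 / 2) * r * r'" if "a \<noteq> 0" "a' \<noteq> 0" "x \<noteq> 0" "y \<noteq> 0"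
      for J q a x q' a' y f r r' :: 'a
      using that by (simp add: divide_simps) (simp add: algebra_simps power2_eq_square)
    show ?thesis
      unfolding C_def ldu_value_def U_entry_def fact_double_odd_fact p
      by (rule gen) auto
  qed
  finally show ?thesis by simp
qed

section \<open>Jacobi's identity and the modular equation\<close>

lemma tendsto_mult_fps:
  fixes P Q :: "'b \<Rightarrow> 'a::comm_ring_1 fps"
  assumes "(P \<longlongrightarrow> L) F" "(Q \<longlongrightarrow> M) F"
  shows "((\<lambda>n. P n * Q n) \<longlongrightarrow> L * M) F"
proof (rule tendsto_fpsI)
  fix k
  have "\<forall>\<^sub>F n in F. \<forall>i\<in>{..k}. fps_nth (P n) i = fps_nth L i"
    "\<forall>\<^sub>F n in F. \<forall>i\<in>{..k}. fps_nth (Q n) i = fps_nth M i"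
    using assms by (auto simp: tendsto_fps_iff eventually_ball_finite_distrib)
  then show "\<forall>\<^sub>F n in F. fps_nth (P n * Q n) k = fps_nth (L * M) k"
    by eventually_elim (simp add: fps_mult_nth)
qed

lemma tendsto_power_fps:
  fixes P :: "'b \<Rightarrow> 'a::comm_ring_1 fps"
  assumes "(P \<longlongrightarrow> L) F"
  shows "((\<lambda>n. P n ^ k) \<longlongrightarrow> L ^ k) F"
  by (induction k) (simp_all add: tendsto_mult_fps assms)

lemma tendsto_compose_fps:
  fixes P :: "'b \<Rightarrow> 'a::comm_ring_1 fps"
  assumes "(P \<longlongrightarrow> L) F"
  shows "((\<lambda>n. P n oo c) \<longlongrightarrow> L oo c) F"
proof (rule tendsto_fpsI)
  fix k
  have "\<forall>\<^sub>F n in F. \<forall>i\<in>{0..k}. fps_nth (P n) i = fps_nth L i"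
    using assms by (auto simp: tendsto_fps_iff eventually_ball_finite_distrib)
  then show "\<forall>\<^sub>F n in F. fps_nth (P n oo c) k = fps_nth (L oo c) k"
    by eventually_elim (simp add: fps_compose_nth)
qed

text \<open>If f k is 1 modulo \<open>fps_X ^ Suc k\<close>, the factors with k >= m leave the
  coefficient m unchanged, so the product over k < m already shows it.\<close>

definition fps_infprod :: "(nat \<Rightarrow> 'a::comm_ring_1 fps) \<Rightarrow> 'a fps" where
  "fps_infprod f = Abs_fps (\<lambda>m. fps_nth (\<Prod>k<m. f k) m)"

lemma fps_infprod_nth:
  assumes "\<And>k. fps_X ^ Suc k dvd f k - 1" "m \<le> n"
  shows "fps_nth (fps_infprod f) m = fps_nth (\<Prod>k<n. f k) m"
  using assms(2)
proof (induction n rule: dec_induct)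
  case base
  show ?case by (simp add: fps_infprod_def)
next
  case (step n)
  obtain h where "f n - 1 = fps_X ^ Suc n * h"
    using assms(1) by (meson dvdE)
  then have "f n = 1 + fps_X ^ Suc n * h" by (simp add: algebra_simps)
  then have "(\<Prod>k<Suc n. f k) = (\<Prod>k<n. f k) + fps_X ^ Suc n * ((\<Prod>k<n. f k) * h)"
    by (simp add: algebra_simps)
  then have "fps_nth (\<Prod>k<Suc n. f k) m = fps_nth (\<Prod>k<n. f k) m"
    using step.hyps by (simp add: fps_X_power_mult_nth del: power_Suc prod.lessThan_Suc)
  then show ?case using step.IH by simp
qed

lemma fps_infprod_tendsto:
  assumes "\<And>k. fps_X ^ Suc k dvd f k - 1"
  shows "(\<lambda>n. \<Prod>k<n. f k) \<longlonglongrightarrow> fps_infprod f"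
proof (rule tendsto_fpsI)
  fix m
  show "\<forall>\<^sub>F n in sequentially. fps_nth (\<Prod>k<n. f k) m = fps_nth (fps_infprod f) m"
    using eventually_ge_at_top[of m] by eventually_elim (use fps_infprod_nth[OF assms] in auto)
qed

definition euler_fps :: "'a::field_char_0 fps" where
  "euler_fps = fps_infprod (\<lambda>k. 1 - fps_X ^ Suc k)"

definition odd_plus :: "'a::field_char_0 fps" where
  "odd_plus = fps_infprod (\<lambda>k. 1 + fps_X ^ (2 * k + 1))"

definition odd_minus :: "'a::field_char_0 fps" where
  "odd_minus = fps_infprod (\<lambda>k. 1 - fps_X ^ (2 * k + 1))"

abbreviation even_euler :: "'a::field_char_0 fps" where
  "even_euler \<equiv> euler_fps oo fps_X ^ 2"

lemma euler_fps_tendsto: "(\<lambda>n. \<Prod>k<n. 1 - fps_X ^ Suc k) \<longlonglongrightarrow> (euler_fps :: 'a::field_char_0 fps)"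
  unfolding euler_fps_def by (rule fps_infprod_tendsto) simp

lemma odd_plus_tendsto: "(\<lambda>n. \<Prod>k<n. 1 + fps_X ^ (2 * k + 1)) \<longlonglongrightarrow> (odd_plus :: 'a::field_char_0 fps)"
  unfolding odd_plus_def by (rule fps_infprod_tendsto) (auto intro: le_imp_power_dvd simp flip: power_Suc)

lemma odd_minus_tendsto: "(\<lambda>n. \<Prod>k<n. 1 - fps_X ^ (2 * k + 1)) \<longlonglongrightarrow> (odd_minus :: 'a::field_char_0 fps)"
  unfolding odd_minus_def by (rule fps_infprod_tendsto) (auto intro: le_imp_power_dvd simp flip: power_Suc)

lemma fps_X_power_compose:
  "fps_nth c 0 = 0 \<Longrightarrow> fps_X ^ n oo c = (c ^ n :: 'a::idom fps)"
  by (simp flip: fps_compose_power)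

lemma even_euler_tendsto: "(\<lambda>n. \<Prod>k<n. 1 - fps_X ^ (2 * k + 2)) \<longlonglongrightarrow> (even_euler :: 'a::field_char_0 fps)"
proof -
  have "(\<Prod>k<n. 1 - fps_X ^ Suc k) oo fps_X ^ 2 = (\<Prod>k<n. 1 - fps_X ^ (2 * k + 2) :: 'a fps)" for n
    by (simp add: fps_compose_prod_distrib fps_compose_sub_distrib fps_X_power_compose mult_2
        flip: power_mult power_Suc)
  then show ?thesis
    using tendsto_compose_fps[OF euler_fps_tendsto, of "fps_X ^ 2 :: 'a fps"] by simp
qed

lemma fps_nth_0_products [simp]:
  "fps_nth euler_fps 0 = 1" "fps_nth odd_plus 0 = 1" "fps_nth odd_minus 0 = 1"
  by (simp_all add: euler_fps_def odd_plus_def odd_minus_def fps_infprod_def)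

lemma compose_X2_assoc: "(F oo fps_X ^ 2) oo - fps_X = (F oo fps_X ^ 2 :: 'a::field_char_0 fps)"
  by (subst fps_compose_assoc[symmetric]) (auto simp: fps_compose_power[symmetric])

lemma odd_plus_uminus: "odd_plus oo - fps_X = (odd_minus :: 'a::field_char_0 fps)"
proof -
  have "(\<Prod>k<n. 1 + fps_X ^ (2 * k + 1)) oo - fps_X = (\<Prod>k<n. 1 - fps_X ^ (2 * k + 1) :: 'a fps)" for n
    by (simp add: fps_compose_prod_distrib fps_compose_add_distrib fps_compose_mult_distrib flip: fps_compose_power)
  then show ?thesis
    using tendsto_compose_fps[OF odd_plus_tendsto, of "- fps_X :: 'a fps"] odd_minus_tendsto[where 'a='a]
    by (metis (no_types, lifting) LIMSEQ_unique ext)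
qed

lemma odd_plus_times_odd_minus: "odd_plus * odd_minus = (odd_minus oo fps_X ^ 2 :: 'a::field_char_0 fps)"
proof (rule LIMSEQ_unique)
  have "(\<Prod>k<n. 1 - fps_X ^ (2 * k + 1)) oo fps_X ^ 2
      = (\<Prod>k<n. 1 + fps_X ^ (2 * k + 1)) * (\<Prod>k<n. 1 - fps_X ^ (2 * k + 1) :: 'a fps)" for n
  proof -
    have "(1 - fps_X ^ (2 * k + 1)) oo fps_X ^ 2 = (1 + fps_X ^ (2 * k + 1)) * (1 - fps_X ^ (2 * k + 1) :: 'a fps)" for k
    proof -
      have "(1 - fps_X ^ (2 * k + 1)) oo fps_X ^ 2 = (1 - (fps_X ^ 2) ^ (2 * k + 1) :: 'a fps)"
        by (subst fps_compose_sub_distrib, subst fps_X_power_compose) simp_all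
      also have "(fps_X ^ 2) ^ (2 * k + 1) = (fps_X ^ (2 * k + 1) * fps_X ^ (2 * k + 1) :: 'a fps)"
        by (simp only: power2_eq_square power_mult_distrib)
      finally show ?thesis by (simp add: algebra_simps)
    qed
    then show ?thesis
      by (subst fps_compose_prod_distrib) (simp_all only: prod.distrib fps_nth_power_0, simp)
  qed
  then show "(\<lambda>n. (\<Prod>k<n. 1 + fps_X ^ (2 * k + 1)) * (\<Prod>k<n. 1 - fps_X ^ (2 * k + 1) :: 'a fps))
     \<longlonglongrightarrow> (odd_minus oo fps_X ^ 2)"
    using tendsto_compose_fps[OF odd_minus_tendsto, of "fps_X ^ 2 :: 'a fps"] by simp
qed (rule tendsto_mult_fps odd_plus_tendsto odd_minus_tendsto)+

lemma euler_fps_split: "euler_fps = even_euler * (odd_minus :: 'a::field_char_0 fps)"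
proof (rule LIMSEQ_unique)
  have "(\<Prod>k<2*n. 1 - fps_X ^ Suc k) = (\<Prod>k<n. 1 - fps_X ^ (2 * k + 2)) * (\<Prod>k<n. 1 - fps_X ^ (2 * k + 1) :: 'a fps)" for n
    by (induction n) (simp_all add: mult_ac)
  then show "(\<lambda>n. \<Prod>k<2*n. 1 - fps_X ^ Suc k) \<longlonglongrightarrow> even_euler * (odd_minus :: 'a fps)"
    using tendsto_mult_fps[OF even_euler_tendsto[where 'a = 'a] odd_minus_tendsto] by simp
  show "(\<lambda>n. \<Prod>k<2*n. 1 - fps_X ^ Suc k) \<longlonglongrightarrow> (euler_fps :: 'a fps)"
    by (rule LIMSEQ_subseq_LIMSEQ[OF euler_fps_tendsto, of "\<lambda>n. 2 * n", unfolded o_def]) (simp add: strict_mono_def)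
qed

section \<open>The triple product in finite form\<close>

text \<open>Gaussian binomial coefficients with base \<open>q\<^sup>2\<close>, in which the exponents of the triple product are integral.\<close>

definition even_poch :: "nat \<Rightarrow> 'a::field_char_0 fps" where
  "even_poch n = (\<Prod>k<n. 1 - fps_X ^ (2 * k + 2))"

definition gauss_binomial :: "nat \<Rightarrow> nat \<Rightarrow> 'a::field_char_0 fps" where
  "gauss_binomial n k = (if k \<le> n then even_poch n * inverse (even_poch k * even_poch (n - k)) else 0)"

lemma even_poch_nth_0 [simp]: "fps_nth (even_poch n) 0 = 1"
  by (induction n) (simp_all add: even_poch_def)

lemma even_poch_nonzero [simp]: "even_poch n \<noteq> 0"
  by (metis even_poch_nth_0 fps_zero_nth zero_neq_one)

lemma even_poch_Suc: "even_poch (Suc n) = even_poch n * (1 - fps_X ^ (2 * n + 2))"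
  by (simp add: even_poch_def)

lemma gauss_binomial_mult:
  assumes "k \<le> n"
  shows "gauss_binomial n k * (even_poch k * even_poch (n - k)) = even_poch n"
proof -
  have "fps_nth (even_poch k * even_poch (n - k)) 0 \<noteq> (0::'a)"
    by simp
  then have "inverse (even_poch k * even_poch (n - k)) * (even_poch k * even_poch (n - k)) = (1 :: 'a fps)"
    by (rule inverse_mult_eq_1)
  then show ?thesis
    using assms by (simp add: gauss_binomial_def mult.assoc)
qed

lemma gauss_binomial_0 [simp]: "gauss_binomial n 0 = 1"
  using gauss_binomial_mult[of 0 n] by (simp add: even_poch_def[of 0])

lemma gauss_binomial_self [simp]: "gauss_binomial n n = 1"
  using gauss_binomial_mult[of n n] by (simp add: even_poch_def[of 0])

lemma gauss_binomial_Suc: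
  assumes "k \<le> n"
  shows "gauss_binomial (Suc n) (Suc k)
    = (gauss_binomial n (Suc k) + fps_X ^ (2 * (n - k)) * gauss_binomial n k :: 'a::field_char_0 fps)"
proof (cases "k = n")
  case True
  then show ?thesis by (simp add: gauss_binomial_def[of n "Suc n"])
next
  case False
  then obtain d where d: "n = k + Suc d"
    using assms by (metis add_Suc_right le_neq_implies_less less_imp_Suc_add)
  \<comment> \<open>A common denominator of the three Gaussian binomials in the q-Pascal
    rule.\<close>
  define P where "P = (even_poch (Suc k) * even_poch (Suc d) :: 'a fps)"
  have "gauss_binomial (Suc n) (Suc k) * P = even_poch (Suc n)"
    using gauss_binomial_mult[of "Suc k" "Suc n", where 'a = 'a] d by (simp add: P_def)
  moreover have "gauss_binomial n (Suc k) * P = even_poch n * (1 - fps_X ^ (2 * d + 2))"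
    using gauss_binomial_mult[of "Suc k" n, where 'a = 'a] d by (simp add: P_def even_poch_Suc[of d] mult_ac)
  moreover have "gauss_binomial n k * P = even_poch n * (1 - fps_X ^ (2 * k + 2))"
    using gauss_binomial_mult[of k n, where 'a = 'a] d by (simp add: P_def even_poch_Suc[of k] mult_ac)
  moreover have "even_poch (Suc n) = even_poch n * (1 - fps_X ^ (2 * d + 2) * fps_X ^ (2 * k + 2) :: 'a fps)"
  proof -
    have "2 * n + 2 = (2 * d + 2) + (2 * k + 2)" using d by simp
    then show ?thesis by (simp only: even_poch_Suc[of n] power_add)
  qed
  moreover have "2 * (n - k) = 2 * d + 2" using d by simp
  ultimately have "gauss_binomial (Suc n) (Suc k) * P
      = (gauss_binomial n (Suc k) + fps_X ^ (2 * (n - k)) * gauss_binomial n k) * P"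
    by (simp add: distrib_right mult.assoc del: power_Suc) (simp add: algebra_simps del: power_Suc)
  then show ?thesis by (simp add: P_def)
qed

text \<open>The homogeneous form allows y to be a positive power of q, where the usual form of the
  triple product has negative powers of q in place of x.\<close>

lemma gauss_binomial_theorem:
  fixes x y :: "'a::field_char_0 fps"
  shows "(\<Prod>i<n. y + x * fps_X ^ (2 * i)) = (\<Sum>k\<le>n. fps_X ^ (k * (k - 1)) * gauss_binomial n k * x ^ k * y ^ (n - k))"
proof (induction n)
  case (Suc n)
  define a where "a = (\<lambda>k. fps_X ^ (k * (k - 1)) * gauss_binomial n k :: 'a fps)"
  have a_eq: "fps_X ^ (k * (k - 1)) * gauss_binomial n k = a k" for k
    by (simp only: a_def)
  have a: "fps_X ^ (Suc k * (Suc k - 1)) * gauss_binomial (Suc n) (Suc k) = a (Suc k) + fps_X ^ (2 * n) * a k"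
    if "k \<le> n" for k
  proof -
    have e: "Suc k * (Suc k - 1) + 2 * (n - k) = 2 * n + k * (k - 1)"
      using that by (cases k) (auto simp: algebra_simps)
    have "fps_X ^ (Suc k * (Suc k - 1)) * (fps_X ^ (2 * (n - k)) * gauss_binomial n k) = fps_X ^ (2 * n) * a k"
      unfolding a_def mult.assoc[symmetric] power_add[symmetric] e ..
    then show ?thesis
      unfolding gauss_binomial_Suc[OF that] distrib_left by (simp add: a_def)
  qed
  have "(\<Sum>k\<le>Suc n. fps_X ^ (k * (k - 1)) * gauss_binomial (Suc n) k * x ^ k * y ^ (Suc n - k))
      = y ^ Suc n + (\<Sum>k\<le>n. (a (Suc k) + fps_X ^ (2 * n) * a k) * x ^ Suc k * y ^ (n - k))"
  proof -
    have "(\<Sum>k\<le>n. fps_X ^ (Suc k * (Suc k - 1)) * gauss_binomial (Suc n) (Suc k) * x ^ Suc k * y ^ (Suc n - Suc k))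
        = (\<Sum>k\<le>n. (a (Suc k) + fps_X ^ (2 * n) * a k) * x ^ Suc k * y ^ (n - k))"
      by (intro sum.cong refl) (simp only: a atMost_iff diff_Suc_Suc)
    then show ?thesis
      unfolding sum.atMost_Suc_shift by simp
  qed
  also have "\<dots> = (a 0 * x ^ 0 * y ^ (Suc n - 0) + (\<Sum>k\<le>n. a (Suc k) * x ^ Suc k * y ^ (Suc n - Suc k)))
      + (\<Sum>k\<le>n. fps_X ^ (2 * n) * a k * x ^ Suc k * y ^ (n - k))"
    by (simp add: a_def distrib_right sum.distrib)
  also have "a 0 * x ^ 0 * y ^ (Suc n - 0) + (\<Sum>k\<le>n. a (Suc k) * x ^ Suc k * y ^ (Suc n - Suc k))
      = (\<Sum>k\<le>Suc n. a k * x ^ k * y ^ (Suc n - k))"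
    by (rule sum.atMost_Suc_shift[symmetric])
  also have "\<dots> = (\<Sum>k\<le>n. a k * x ^ k * y ^ (Suc n - k))"
    by (simp add: a_def gauss_binomial_def[of n "Suc n"])
  also have "\<dots> = y * (\<Sum>k\<le>n. a k * x ^ k * y ^ (n - k))"
    by (simp add: sum_distrib_left Suc_diff_le mult_ac)
  also have "(\<Sum>k\<le>n. fps_X ^ (2 * n) * a k * x ^ Suc k * y ^ (n - k))
      = x * fps_X ^ (2 * n) * (\<Sum>k\<le>n. a k * x ^ k * y ^ (n - k))"
    by (simp add: sum_distrib_left mult_ac)
  also have "y * (\<Sum>k\<le>n. a k * x ^ k * y ^ (n - k)) + x * fps_X ^ (2 * n) * (\<Sum>k\<le>n. a k * x ^ k * y ^ (n - k))
      = (\<Prod>i<Suc n. y + x * fps_X ^ (2 * i))"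
    unfolding prod.lessThan_Suc Suc.IH a_eq by (simp add: algebra_simps)
  finally show ?case by simp
qed simp

lemma abs_le_square_int: "\<bar>j :: int\<bar> \<le> j\<^sup>2"
proof (cases "j = 0")
  case False
  then have "\<bar>j\<bar> * 1 \<le> \<bar>j\<bar> * \<bar>j\<bar>" by (intro mult_left_mono) auto
  then show ?thesis by (simp add: power2_eq_square)
qed simp

text \<open>Completing the square: the exponent is its minimum, taken at k = n, plus (n -
  k)^2.\<close>

lemma triple_exponent:
  assumes "n \<ge> 1" "k \<le> 2 * n"
  shows "k * (k - 1) + (2 * n - 1) * (2 * n - k) = n * (n - 1) + n * (2 * n - 1) + nat ((int n - int k)\<^sup>2)"
proof -
  have "int (k * (k - 1)) = int k * (int k - 1)" by (cases k) (auto simp: algebra_simps)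
  moreover have "int (2 * n - 1) = 2 * int n - 1" "int (2 * n - k) = 2 * int n - int k" "int (n - 1) = int n - 1"
    using assms by auto
  ultimately have "int (k * (k - 1) + (2 * n - 1) * (2 * n - k)) = int (n * (n - 1) + n * (2 * n - 1) + nat ((int n - int k)\<^sup>2))"
    by (simp only: of_nat_add of_nat_mult int_nat_eq zero_le_power2 if_True) (simp add: algebra_simps power2_eq_square)
  then show ?thesis by (simp only: of_nat_eq_iff)
qed

text \<open>The \<open>q\<close>-binomial theorem with \<open>x = 1\<close> and \<open>y = q\<^bsup>2n - 1\<^esup>\<close>, divided by the lowest power of \<open>q\<close>.\<close>

lemma finite_triple_product:
  assumes "n \<ge> 1"
  shows "(\<Prod>k<n. 1 + fps_X ^ (2 * k + 1)) ^ 2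
    = (\<Sum>k\<le>2 * n. gauss_binomial (2 * n) k * fps_X ^ nat ((int n - int k)\<^sup>2) :: 'a::field_char_0 fps)"
proof -
  define A where "A = (\<Prod>k<n. 1 + fps_X ^ (2 * k + 1) :: 'a fps)"
  define e where "e = n * (n - 1) + n * (2 * n - 1)"
  have "(\<Prod>i<2*n. fps_X ^ (2 * n - 1) + 1 * fps_X ^ (2 * i)) = (fps_X ^ e * A ^ 2 :: 'a fps)"
  proof -
    \<comment> \<open>In each factor the lower of the two powers is taken out, which is
      \<open>fps_X ^ (2 * i)\<close> for i < n and \<open>fps_X ^ (2 * n - 1)\<close> for i >= n.
      Either half then leaves the product A.\<close>
    have "{..<2*n} = {..<n} \<union> {n..<2*n}" by auto
    then have "(\<Prod>i<2*n. fps_X ^ (2 * n - 1) + 1 * fps_X ^ (2 * i) :: 'a fps)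
      = (\<Prod>i<n. fps_X ^ (2 * n - 1) + fps_X ^ (2 * i)) * (\<Prod>i=n..<2*n. fps_X ^ (2 * n - 1) + fps_X ^ (2 * i))"
      by (simp add: prod.union_disjoint ivl_disj_int)
    also have "(\<Prod>i<n. fps_X ^ (2 * n - 1) + fps_X ^ (2 * i)) = (\<Prod>i<n. fps_X ^ (2 * i) * (1 + fps_X ^ (2 * (n - Suc i) + 1)) :: 'a fps)"
    proof (intro prod.cong refl)
      fix i assume "i \<in> {..<n}"
      then have "2 * n - 1 = 2 * i + (2 * (n - Suc i) + 1)" by auto
      then show "fps_X ^ (2 * n - 1) + fps_X ^ (2 * i) = (fps_X ^ (2 * i) * (1 + fps_X ^ (2 * (n - Suc i) + 1)) :: 'a fps)"
        by (simp only: power_add distrib_left mult_1_right add.commute)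
    qed
    also have "\<dots> = (\<Prod>i<n. fps_X ^ (2 * i)) * A"
      unfolding prod.distrib A_def by (subst prod.nat_diff_reindex) simp
    also have "(\<Prod>i<n. fps_X ^ (2 * i)) = (fps_X ^ (n * (n - 1)) :: 'a fps)"
    proof -
      have "(\<Sum>i<n. 2 * i) = n * (n - 1)"
      proof (induction n)
        case (Suc n)
        then show ?case by (cases n) auto
      qed simp
      then show ?thesis by (simp only: power_sum[symmetric])
    qed
    also have "(\<Prod>i=n..<2*n. fps_X ^ (2 * n - 1) + fps_X ^ (2 * i)) = (\<Prod>i<n. fps_X ^ (2 * n - 1) * (1 + fps_X ^ (2 * i + 1)) :: 'a fps)"
    proof (rule prod.reindex_bij_witness[of _ "\<lambda>i. i + n" "\<lambda>i. i - n"])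
      fix i assume "i \<in> {n..<2*n}"
      then have "2 * i = (2 * n - 1) + (2 * (i - n) + 1)" using assms by auto
      then show "fps_X ^ (2 * n - 1) * (1 + fps_X ^ (2 * (i - n) + 1)) = (fps_X ^ (2 * n - 1) + fps_X ^ (2 * i) :: 'a fps)"
        by (simp only: power_add distrib_left mult_1_right)
    qed auto
    also have "\<dots> = fps_X ^ (n * (2 * n - 1)) * A"
      unfolding prod.distrib A_def by (simp add: mult.commute flip: power_mult)
    finally show ?thesis
      by (simp add: e_def power_add power2_eq_square mult_ac)
  qed
  moreover have "(\<Prod>i<2*n. fps_X ^ (2 * n - 1) + 1 * fps_X ^ (2 * i))
     = (\<Sum>k\<le>2 * n. fps_X ^ e * (gauss_binomial (2 * n) k * fps_X ^ nat ((int n - int k)\<^sup>2)) :: 'a fps)"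
    unfolding gauss_binomial_theorem
  proof (intro sum.cong refl)
    fix k assume "k \<in> {..2*n}"
    then show "fps_X ^ (k * (k - 1)) * gauss_binomial (2 * n) k * 1 ^ k * (fps_X ^ (2 * n - 1)) ^ (2 * n - k) =
         (fps_X ^ e * (gauss_binomial (2 * n) k * fps_X ^ nat ((int n - int k)\<^sup>2)) :: 'a fps)"
      using triple_exponent[OF assms, of k] unfolding e_def[symmetric]
      by (simp add: mult_ac flip: power_add power_mult)
  qed
  ultimately have "fps_X ^ e * A ^ 2 = (fps_X ^ e * (\<Sum>k\<le>2 * n. gauss_binomial (2 * n) k * fps_X ^ nat ((int n - int k)\<^sup>2)) :: 'a fps)"
    by (simp add: sum_distrib_left)
  then show ?thesis
    by (simp add: A_def)
qed

section \<open>The theta series and sums of two squares\<close>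

definition theta_fps :: "'a::field_char_0 fps" where
  "theta_fps = Abs_fps (\<lambda>n. of_nat (card {j :: int. j ^ 2 = int n}))"

lemma fps_X_power_dvdI:
  assumes "\<And>i. i < n \<Longrightarrow> fps_nth f i = 0"
  shows "fps_X ^ n dvd (f :: 'a::comm_ring_1 fps)"
proof
  show "f = fps_X ^ n * fps_shift n f"
    using assms by (auto simp: fps_eq_iff fps_X_power_mult_nth)
qed

lemma even_poch_cong:
  assumes "m \<le> r"
  shows "fps_X ^ Suc m dvd even_poch r - (even_euler :: 'a::field_char_0 fps)"
proof -
  have d: "fps_X ^ Suc k dvd (1 - fps_X ^ (2 * k + 2)) - (1 :: 'a fps)" for k
    by (auto intro: le_imp_power_dvd simp flip: power_Suc)
  have "fps_infprod (\<lambda>k. 1 - fps_X ^ (2 * k + 2)) = (even_euler :: 'a fps)"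
    by (rule LIMSEQ_unique[OF fps_infprod_tendsto[OF d] even_euler_tendsto])
  then have "fps_nth (even_poch r) i = fps_nth (even_euler :: 'a fps) i" if "i \<le> m" for i
    using fps_infprod_nth[OF d, of i r] that assms by (simp add: even_poch_def)
  then show ?thesis
    by (intro fps_X_power_dvdI) simp
qed

text \<open>Since k, n - k and n are at least m, all three Pochhammer products agree with the Euler
  product E modulo \<open>fps_X ^ Suc m\<close>, and E times E / (E E) is 1.\<close>

lemma gauss_binomial_cong:
  assumes "m \<le> k" "k + m \<le> n"
  shows "fps_X ^ Suc m dvd even_euler * gauss_binomial n k - (1 :: 'a::field_char_0 fps)"
proof -
  define E where "E = (even_euler :: 'a fps)"
  define c where "c = (gauss_binomial n k :: 'a fps)"
  have n0: "fps_nth E 0 \<noteq> 0" by (simp add: E_def)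
  have m: "m \<le> n - k" "m \<le> n" using assms by auto
  obtain u where "even_poch k - E = fps_X ^ Suc m * u"
    using even_poch_cong[OF assms(1)] unfolding E_def by (rule dvdE)
  moreover obtain v where "even_poch (n - k) - E = fps_X ^ Suc m * v"
    using even_poch_cong[OF m(1)] unfolding E_def by (rule dvdE)
  moreover obtain w where "even_poch n - E = fps_X ^ Suc m * w"
    using even_poch_cong[OF m(2)] unfolding E_def by (rule dvdE)
  ultimately have p: "even_poch k = E + fps_X ^ Suc m * u" "even_poch (n - k) = E + fps_X ^ Suc m * v"
     "even_poch n = E + fps_X ^ Suc m * w"
    by (simp_all add: algebra_simps)
  have "c * ((E + fps_X ^ Suc m * u) * (E + fps_X ^ Suc m * v)) = E + fps_X ^ Suc m * w"
    using gauss_binomial_mult[of k n, where 'a = 'a] assms unfolding p c_def by simp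
  then have "E * (E * c - 1) = fps_X ^ Suc m * (w - c * (E * v + u * E + fps_X ^ Suc m * u * v))"
    by (simp add: algebra_simps del: power_Suc)
  then have "E * c - 1 = fps_X ^ Suc m * (inverse E * (w - c * (E * v + u * E + fps_X ^ Suc m * u * v)))"
    using inverse_mult_eq_1[OF n0] by (metis mult.left_commute mult.assoc mult_1_left)
  then show ?thesis unfolding E_def c_def by (rule dvdI)
qed

text \<open>The limit of the finite triple product: in a fixed coefficient m only the central k with
  (n - k)^2 <= m matter, and there the Gaussian binomial times the Euler product is 1 to the
  required order.\<close>

theorem theta_product: "even_euler * odd_plus ^ 2 = (theta_fps :: 'a::field_char_0 fps)"
proof (rule LIMSEQ_unique)
  show "(\<lambda>n. even_euler * (\<Prod>k<n. 1 + fps_X ^ (2 * k + 1)) ^ 2) \<longlonglongrightarrow> even_euler * (odd_plus ^ 2 :: 'a fps)"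
    by (intro tendsto_mult_fps tendsto_const tendsto_power_fps odd_plus_tendsto)
  show "(\<lambda>n. even_euler * (\<Prod>k<n. 1 + fps_X ^ (2 * k + 1)) ^ 2) \<longlonglongrightarrow> (theta_fps :: 'a fps)"
  proof (rule tendsto_fpsI)
    fix m
    have "fps_nth (even_euler * (\<Prod>k<n. 1 + fps_X ^ (2 * k + 1)) ^ 2) m = fps_nth (theta_fps :: 'a fps) m"
      if n: "n \<ge> 2 * m + 1" for n
    proof -
      have t: "fps_nth (even_euler * (gauss_binomial (2 * n) k * fps_X ^ nat ((int n - int k)\<^sup>2))) m
          = (if (int n - int k)\<^sup>2 = int m then 1 else 0 :: 'a)" for k
      proof (cases "(int n - int k)\<^sup>2 \<le> int m")
        case True
        then have "\<bar>int n - int k\<bar> \<le> int m" using abs_le_square_int[of "int n - int k"] by simp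
        then have "m \<le> k" "k + m \<le> 2 * n" using n by auto
        from gauss_binomial_cong[OF this] obtain u where
          "even_euler * gauss_binomial (2 * n) k = 1 + fps_X ^ Suc m * (u :: 'a fps)"
          unfolding dvd_def by (metis diff_eq_eq add.commute)
        then have "even_euler * (gauss_binomial (2 * n) k * fps_X ^ nat ((int n - int k)\<^sup>2))
          = fps_X ^ nat ((int n - int k)\<^sup>2) + fps_X ^ Suc m * (u * fps_X ^ nat ((int n - int k)\<^sup>2))"
          by (simp add: mult.assoc[symmetric] distrib_right del: power_Suc)
        then show ?thesis
          by (auto simp: fps_X_power_mult_nth fps_X_power_nth simp del: power_Suc)
      next
        case False
        then show ?thesis
          by (simp add: fps_X_power_mult_right_nth flip: mult.assoc)
      qed
      have "{j :: int. j ^ 2 = int m} = (\<lambda>k. int n - int k) ` {k \<in> {..2*n}. (int n - int k)\<^sup>2 = int m}"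
      proof safe
        fix j :: int assume j: "j ^ 2 = int m"
        then have "\<bar>j\<bar> \<le> int m" using abs_le_square_int[of j] by simp
        then show "j \<in> (\<lambda>k. int n - int k) ` {k \<in> {..2*n}. (int n - int k)\<^sup>2 = int m}"
          using n j by (intro image_eqI[of _ _ "nat (int n - j)"]) auto
      qed
      then have c: "card {j :: int. j ^ 2 = int m} = card {k \<in> {..2*n}. (int n - int k)\<^sup>2 = int m}"
        by (simp add: card_image inj_on_def)
      have "fps_nth (even_euler * (\<Prod>k<n. 1 + fps_X ^ (2 * k + 1)) ^ 2) m
          = (\<Sum>k\<le>2 * n. if (int n - int k)\<^sup>2 = int m then 1 else 0 :: 'a)"
        using n by (simp only: finite_triple_product[of n] sum_distrib_left fps_sum_nth t)
      also have "\<dots> = fps_nth theta_fps m"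
        by (simp add: theta_fps_def c sum.If_cases Int_def)
      finally show ?thesis .
    qed
    then show "\<forall>\<^sub>F n in sequentially. fps_nth (even_euler * (\<Prod>k<n. 1 + fps_X ^ (2 * k + 1)) ^ 2) m = fps_nth (theta_fps :: 'a fps) m"
      by (auto simp: eventually_at_top_linorder)
  qed
qed

lemma fps_compose_X2_nth:
  "fps_nth (F oo fps_X ^ 2) n = (if even n then fps_nth F (n div 2) else (0::'a::field_char_0))"
proof -
  have "fps_nth (F oo fps_X ^ 2) n = (\<Sum>i=0..n. fps_nth F i * (if n = 2 * i then 1 else 0))"
    by (simp add: fps_compose_nth fps_X_power_nth flip: power_mult)
  also have "\<dots> = (\<Sum>i\<in>(if even n then {n div 2} else {}). fps_nth F i)"
    by (rule sum.mono_neutral_cong_right) (auto split: if_splits)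
  finally show ?thesis by simp
qed

lemma square_roots_0: "{j :: int. j\<^sup>2 = 0} = {0}" and square_roots_1: "{j :: int. j\<^sup>2 = 1} = {1, -1}"
  by (auto simp: power2_eq_1_iff)

lemma theta_fps_nth_0_1 [simp]: "fps_nth theta_fps 0 = 1" "fps_nth theta_fps (Suc 0) = 2"
  by (simp_all add: theta_fps_def square_roots_0 square_roots_1)

definition two_squares :: "nat \<Rightarrow> (int \<times> int) set" where
  "two_squares n = {(x, y). x\<^sup>2 + y\<^sup>2 = int n}"

lemma finite_square_roots: "finite {j :: int. j\<^sup>2 = a}"
proof (rule finite_subset)
  show "{j :: int. j\<^sup>2 = a} \<subseteq> {- \<bar>a\<bar>..\<bar>a\<bar>}"
  proof safe
    fix j :: int
    show "j \<in> {- \<bar>j\<^sup>2\<bar>..\<bar>j\<^sup>2\<bar>}" using abs_le_square_int[of j] by auto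
  qed
qed auto

lemma theta_square_nth: "fps_nth (theta_fps ^ 2) n = (of_nat (card (two_squares n)) :: 'a::field_char_0)"
proof -
  have "two_squares n = (\<Union>i\<in>{0..n}. {j :: int. j ^ 2 = int i} \<times> {j :: int. j ^ 2 = int (n - i)})" (is "_ = ?R")
  proof (intro equalityI subsetI)
    fix p assume "p \<in> two_squares n"
    then obtain x y where p: "p = (x, y)" "x\<^sup>2 + y\<^sup>2 = int n" by (auto simp: two_squares_def)
    have "0 \<le> x\<^sup>2" "0 \<le> y\<^sup>2" by auto
    then have "nat (x\<^sup>2) \<le> n" "x\<^sup>2 = int (nat (x\<^sup>2))" "y\<^sup>2 = int (n - nat (x\<^sup>2))"
      using p(2) by linarith+
    then show "p \<in> ?R" using p(1) by (intro UN_I[of "nat (x\<^sup>2)"]) auto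
  qed (auto simp: two_squares_def)
  then have "card (two_squares n) = (\<Sum>i\<in>{0..n}. card ({j :: int. j ^ 2 = int i} \<times> {j :: int. j ^ 2 = int (n - i)}))"
    by (simp only:) (rule card_UN_disjoint, auto intro!: finite_cartesian_product finite_square_roots)
  then show ?thesis
    by (simp add: power2_eq_square[of theta_fps] fps_mult_nth card_cartesian_product) (simp add: theta_fps_def)
qed

text \<open>Up to the order of the coordinates the bijection is multiplication by 1 + i on the
  Gaussian integers. It is onto because an even sum of two squares has u and v of equal
  parity.\<close>

lemma card_two_squares_double: "card (two_squares (2 * m)) = card (two_squares m)"
proof (rule bij_betw_same_card[symmetric])
  show "bij_betw (\<lambda>(x, y). (x + y, x - y)) (two_squares m) (two_squares (2 * m))"
  proof (rule bij_betw_byWitness[where f' = "\<lambda>(u, v). ((u + v) div 2, (u - v) div 2)"])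
    have ev: "even (u + v)" "even (u - v)" if "u\<^sup>2 + v\<^sup>2 = 2 * int m" for u v
    proof -
      have "even (u\<^sup>2 + v\<^sup>2)" using that by simp
      then show "even (u + v)" "even (u - v)" by auto
    qed
    show "\<forall>p\<in>two_squares m. (case case p of (x, y) \<Rightarrow> (x + y, x - y) of (u, v) \<Rightarrow> ((u + v) div 2, (u - v) div 2)) = p"
      by auto
    show "\<forall>p\<in>two_squares (2 * m). (case case p of (u, v) \<Rightarrow> ((u + v) div 2, (u - v) div 2) of (x, y) \<Rightarrow> (x + y, x - y)) = p"
    proof
      fix p assume "p \<in> two_squares (2 * m)"
      then obtain u v where p: "p = (u, v)" and uv: "u\<^sup>2 + v\<^sup>2 = 2 * int m" by (auto simp: two_squares_def)
      obtain x y where xy: "u + v = 2 * x" "u - v = 2 * y"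
        using ev[OF uv] by (meson evenE)
      then have "u = x + y" "v = x - y" by auto
      then show "(case case p of (u, v) \<Rightarrow> ((u + v) div 2, (u - v) div 2) of (x, y) \<Rightarrow> (x + y, x - y)) = p"
        using xy by (simp add: p)
    qed
    show "(\<lambda>(x, y). (x + y, x - y)) ` two_squares m \<subseteq> two_squares (2 * m)"
      by (auto simp: two_squares_def power2_eq_square algebra_simps)
    show "(\<lambda>(u, v). ((u + v) div 2, (u - v) div 2)) ` two_squares (2 * m) \<subseteq> two_squares m"
    proof clarsimp
      fix u v assume "(u, v) \<in> two_squares (2 * m)"
      then have uv: "u\<^sup>2 + v\<^sup>2 = 2 * int m" by (simp add: two_squares_def)
      obtain x y where xy: "u + v = 2 * x" "u - v = 2 * y"
        using ev[OF uv] by (meson evenE)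
      then have e: "u = x + y" "v = x - y" by auto
      have "2 * (x\<^sup>2 + y\<^sup>2) = 2 * int m" using uv unfolding e by algebra
      then show "((u + v) div 2, (u - v) div 2) \<in> two_squares m"
        using xy by (simp add: two_squares_def)
    qed
  qed
qed

text \<open>Adding the values at q and -q doubles the even coefficients of the square of theta and
  removes the odd ones; the rest is the equality of the numbers of representations of 2 m and
  m.\<close>

lemma theta_lattice:
  "theta_fps ^ 2 + (theta_fps oo - fps_X) ^ 2 = 2 * (theta_fps oo fps_X ^ 2) ^ 2" (is "?L = (?R :: 'a::field_char_0 fps)")
proof (rule fps_ext)
  fix n
  have L: "?L = theta_fps ^ 2 + (theta_fps ^ 2 oo - (fps_X :: 'a fps))"
    by (simp add: fps_compose_power)
  have R: "?R = 2 * (theta_fps ^ 2 oo (fps_X :: 'a fps) ^ 2)"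
    by (simp add: fps_compose_power)
  have t: "fps_nth (theta_fps ^ 2 :: 'a fps) n = fps_nth (theta_fps ^ 2) (n div 2)" if "even n"
    using that card_two_squares_double[of "n div 2"] unfolding theta_square_nth by simp
  show "fps_nth ?L n = fps_nth ?R n"
    unfolding L R unfolding fps_compose_uminus' using t by (simp add: fps_compose_X2_nth numeral_fps_const)
qed

text \<open>When the coefficients strictly between 0 and n vanish, comparing the coefficients of
  index n equates twice the n-th one with 0 or with the one of index n div 2, which vanishes
  already.\<close>

lemma fps_eq_one_if_square_eq_compose:
  assumes W: "W ^ 2 = W oo fps_X ^ 2" and W0: "fps_nth W 0 = (1::'a::field_char_0)"
  shows "W = 1"
proof -
  have "fps_nth W n = 0" if "n > 0" for n
    using that
  proof (induction n rule: less_induct)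
    case (less n)
    have "fps_nth (W ^ 2) n = (\<Sum>i=0..n. fps_nth W i * fps_nth W (n - i))"
      by (simp add: power2_eq_square fps_mult_nth)
    also have "\<dots> = (\<Sum>i\<in>{0, n}. fps_nth W i * fps_nth W (n - i))"
      by (rule sum.mono_neutral_right) (use less.IH in auto)
    also have "\<dots> = 2 * fps_nth W n"
      using less.prems W0 by simp
    finally have "2 * fps_nth W n = fps_nth (W oo fps_X ^ 2) n" by (simp only: W)
    also have "\<dots> = 0"
      using less.IH[of "n div 2"] less.prems by (auto simp: fps_compose_X2_nth elim!: evenE)
    finally show ?case by simp
  qed
  then show ?thesis using W0 by (simp add: fps_eq_iff)
qed

text \<open>With \<open>\<theta>\<close> the theta series, \<open>T = \<theta>(q)\<^sup>4 - \<theta>(-q)\<^sup>4\<close> and the product \<open>S\<close> both satisfy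
  \<open>F(q)\<^sup>2 = 16 F(q\<^sup>2) \<theta>(q\<^sup>2)\<^sup>4\<close>. Hence \<open>W = T / S\<close> satisfies \<open>W(q)\<^sup>2 = W(q\<^sup>2)\<close>, which forces \<open>W = 1\<close>.\<close>

theorem jacobi_aequatio:
  "odd_plus ^ 8 - odd_minus ^ 8 = 16 * fps_X * inverse (odd_plus * odd_minus :: 'a::field_char_0 fps) ^ 8"
proof -
  let ?sq = "\<lambda>F :: 'a fps. F oo fps_X ^ 2"
  have sq_mult: "?sq (F * G) = ?sq F * ?sq G" for F G by (simp add: fps_compose_mult_distrib)
  have sq_pow: "?sq (F ^ k) = ?sq F ^ k" for F k by (simp add: fps_compose_power)
  define A B E iB :: "'a fps" where "A = odd_plus" and "B = odd_minus" and "E = even_euler" and "iB = inverse odd_minus"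
  define E2 A2 B2 iB2 iB4 where "E2 = ?sq E" and "A2 = ?sq A" and "B2 = ?sq B" and "iB2 = ?sq iB" and "iB4 = ?sq iB2"
  define p n P N where "p = E * A ^ 2" and "n = E * B ^ 2" and "P = ?sq p" and "N = ?sq n"
  have AB: "A * B = B2" unfolding A_def B_def B2_def by (rule odd_plus_times_odd_minus)
  have EB: "E = E2 * B2"
    unfolding E_def E2_def B2_def B_def by (subst euler_fps_split) (simp add: sq_mult)
  have "B * iB = 1" unfolding B_def iB_def by (subst mult.commute) (simp add: inverse_mult_eq_1)
  then have BB: "B2 * iB2 = 1"
    unfolding B2_def iB2_def sq_mult[symmetric] by simp
  then have BB4: "?sq B2 * iB4 = 1"
    unfolding iB4_def sq_mult[symmetric] by simp
  have A2B: "A2 * B2 = ?sq B2"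
    using arg_cong[OF AB, of ?sq] by (simp add: sq_mult A2_def B2_def)
  have A2iB4: "A2 * iB4 = iB2"
  proof -
    have "A2 * iB4 = A2 * iB4 * (B2 * iB2)" by (simp only: BB mult_1_right)
    also have "\<dots> = (A2 * B2) * iB4 * iB2" by (simp only: mult_ac)
    finally show ?thesis by (simp only: A2B BB4 mult_1_left)
  qed
  have p: "p = theta_fps" unfolding p_def E_def A_def by (rule theta_product)
  have "n = p oo - fps_X"
    unfolding p_def n_def A_def B_def E_def
    by (simp add: fps_compose_mult_distrib compose_X2_assoc odd_plus_uminus flip: fps_compose_power)
  then have lat: "p ^ 2 + n ^ 2 = 2 * P ^ 2"
    using theta_lattice[where 'a = 'a] by (simp add: p P_def)
  have n_alt: "n = theta_fps oo - fps_X" using \<open>n = p oo - fps_X\<close> p by simp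
  \<comment> \<open>Together with \<open>lat\<close> this is the arithmetic-geometric mean:
    \<open>P ^ 2\<close> and \<open>N ^ 2\<close>, taken at q^2, are the arithmetic and a geometric
    mean of \<open>p ^ 2\<close> and \<open>n ^ 2\<close>.\<close>
  have pn: "p * n = N ^ 2"
  proof -
    have "p * n = E ^ 2 * (A * B) ^ 2" by (simp add: p_def n_def power2_eq_square mult_ac)
    also have "\<dots> = (E2 * B2 ^ 2) ^ 2"
      unfolding AB by (subst EB) (simp add: power2_eq_square mult_ac)
    also have "E2 * B2 ^ 2 = N" by (simp add: N_def n_def sq_mult sq_pow E2_def B2_def)
    finally show ?thesis .
  qed
  define T where "T = p ^ 4 - n ^ 4"
  define S where "S = 16 * fps_X * E ^ 4 * iB2 ^ 8"
  have T2: "T ^ 2 = 16 * ?sq T * P ^ 4"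
  proof -
    have "?sq T = P ^ 4 - N ^ 4" by (simp add: T_def fps_compose_sub_distrib sq_pow P_def N_def)
    moreover have "T ^ 2 = ((p ^ 2 + n ^ 2) ^ 2 - 4 * (p * n) ^ 2) * (p ^ 2 + n ^ 2) ^ 2"
      unfolding T_def by algebra
    ultimately show ?thesis unfolding lat pn by algebra
  qed
  have S2: "S ^ 2 = 16 * ?sq S * P ^ 4"
  proof -
    have "?sq S = 16 * fps_X ^ 2 * E2 ^ 4 * iB4 ^ 8"
      by (simp add: S_def sq_mult sq_pow E2_def iB4_def numeral_fps_const)
    moreover have "P = E2 * A2 ^ 2" by (simp add: P_def p_def sq_mult sq_pow E2_def A2_def)
    ultimately have "16 * ?sq S * P ^ 4 = 256 * fps_X ^ 2 * E2 ^ 8 * (A2 * iB4) ^ 8" by algebra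
    also have "\<dots> = 256 * fps_X ^ 2 * E2 ^ 8 * iB2 ^ 8 * (B2 * iB2) ^ 8" unfolding BB A2iB4 by simp
    also have "\<dots> = S ^ 2"
    proof -
      have "S = 16 * fps_X * (E2 * B2) ^ 4 * iB2 ^ 8" using EB by (simp add: S_def)
      then show ?thesis by algebra
    qed
    finally show ?thesis by simp
  qed
  \<comment> \<open>T and S have no constant term. Divided by \<open>fps_X\<close> both begin with
    16 (for T because theta begins with 1 + 2 q), so their quotient is a power series with constant
    term 1.\<close>
  define t s where "t = fps_shift 1 T" and "s = fps_shift 1 S"
  have T0: "fps_nth T 0 = 0" and S0: "fps_nth S 0 = 0"
    by (simp_all add: T_def S_def p_def n_def E_def A_def B_def fps_power_zeroth)
  have Tt: "T = fps_X * t" and Ss: "S = fps_X * s"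
    using T0 S0 by (auto simp: t_def s_def fps_eq_iff)
  have t0: "fps_nth t 0 = 16"
  proof -
    have "fps_nth t 0 = fps_nth (fps_deriv T) 0" by (simp add: t_def)
    also have "\<dots> = 16"
      unfolding T_def p n_alt fps_compose_uminus'
      by (simp add: fps_deriv_power numeral_fps_const fps_power_zeroth)
    finally show ?thesis .
  qed
  have s0: "fps_nth s 0 = 16"
  proof -
    have "S = fps_X * (16 * E ^ 4 * iB2 ^ 8)" by (simp add: S_def mult_ac)
    then have "s = 16 * E ^ 4 * iB2 ^ 8" using Ss by simp
    then show ?thesis by (simp add: fps_power_zeroth E_def iB2_def iB_def numeral_fps_const)
  qed
  have s: "inverse s * s = 1" using s0 by (intro inverse_mult_eq_1) simp
  define W where "W = t * inverse s"
  have tW: "t = W * s" by (simp add: W_def mult.assoc s)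
  have "W ^ 2 = ?sq W"
  proof -
    have "s \<noteq> 0" using s0 by auto
    have "S \<noteq> 0" using Ss \<open>s \<noteq> 0\<close> by simp
    have TW: "T = W * S" by (simp add: Tt Ss tW mult_ac)
    have "W ^ 2 * S ^ 2 = ?sq W * (16 * ?sq S * P ^ 4)"
      using T2 unfolding TW sq_mult by (simp add: power_mult_distrib mult_ac)
    then show ?thesis unfolding S2[symmetric] using \<open>S \<noteq> 0\<close> by simp
  qed
  moreover have "fps_nth W 0 = 1" by (simp add: W_def t0 s0)
  ultimately have "W = 1" by (rule fps_eq_one_if_square_eq_compose)
  then have "T = S" by (simp add: Tt Ss tW)
  then have "E ^ 4 * (A ^ 8 - B ^ 8) = E ^ 4 * (16 * fps_X * iB2 ^ 8)"
    unfolding T_def S_def p_def n_def by (simp add: power_mult_distrib algebra_simps flip: power_mult)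
  moreover have "E \<noteq> 0"
  proof
    assume "E = 0"
    then have "fps_nth E 0 = 0" by simp
    then show False by (simp add: E_def)
  qed
  ultimately have "A ^ 8 - B ^ 8 = 16 * fps_X * iB2 ^ 8" by simp
  moreover have "iB2 = inverse (A * B)"
    unfolding AB by (rule fps_inverse_unique[symmetric]) (rule BB)
  ultimately show ?thesis by (simp add: A_def B_def)
qed

text \<open>The q-expansion of Delta(2 tau) / Delta(tau): by \<open>euler_fps_split\<close> the
  quotient of the Euler products at q^2 and at q is the inverse of the product over odd
  exponents.\<close>

definition hauptmodul_fps :: "'a::field_char_0 fps" where
  "hauptmodul_fps = fps_X * inverse odd_minus ^ 24"

theorem hauptmodul_equation:
  fixes f F :: "'a::field_char_0 fps"
  defines "f \<equiv> hauptmodul_fps" and "F \<equiv> hauptmodul_fps oo fps_X ^ 2"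
  shows "f ^ 2 = (48 * F + 4096 * F ^ 2) * f + F"
proof -
  define A B a b :: "'a fps" where "A = odd_plus" and "B = odd_minus" and "a = inverse A ^ 8" and "b = inverse B ^ 8"
  have iA: "inverse A * A = 1" and iB: "inverse B * B = 1"
    by (simp_all add: A_def B_def inverse_mult_eq_1)
  have i2: "inverse B oo fps_X ^ 2 = inverse A * inverse B"
    by (simp add: A_def B_def fps_inverse_compose flip: odd_plus_times_odd_minus fps_inverse_mult)
  have f: "f = fps_X * b ^ 3"
    by (simp add: f_def hauptmodul_fps_def b_def B_def flip: power_mult)
  have F: "F = fps_X ^ 2 * a ^ 3 * b ^ 3"
    unfolding F_def hauptmodul_fps_def B_def[symmetric]
    by (simp add: fps_compose_mult_distrib i2 power_mult_distrib a_def b_def mult.assoc flip: fps_compose_power power_mult)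
  have aA: "a * A ^ 8 = 1" and bB: "b * B ^ 8 = 1"
    unfolding a_def b_def by (simp_all add: iA iB flip: power_mult_distrib)
  have J: "A ^ 8 - B ^ 8 = 16 * fps_X * a * b"
    unfolding A_def B_def jacobi_aequatio a_def b_def by (simp add: fps_inverse_mult power_mult_distrib mult_ac)
  \<comment> \<open>Jacobi's identity divided by \<open>A ^ 8 * B ^ 8\<close>.\<close>
  have y: "b - a = 16 * fps_X * a ^ 2 * b ^ 2"
  proof -
    have "b - a = a * b * (A ^ 8 - B ^ 8)"
      using aA bB by algebra
    then show ?thesis unfolding J by algebra
  qed
  \<comment> \<open>After division by \<open>fps_X ^ 2 * b ^ 3\<close> this is b^3 - a^3 = 3 a b (b
    - a) + (b - a)^3 with the value of b - a inserted, whence 48 = 3 * 16 and 4096 = 16^3.\<close>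
  have "f ^ 2 - ((48 * F + 4096 * F ^ 2) * f + F) = 0"
    unfolding f F using y by algebra
  then show ?thesis by simp
qed

section \<open>Principal minors and Fredholm series\<close>

lemma qtwo_abs_0 [simp]: "qtwo_abs 0 = 0"
  by simp

lemma qtwo_abs_1 [simp]: "qtwo_abs 1 = 1"
  using qtwo_abs_of_rat[of 1] by simp

lemma qtwo_abs_pos_iff [simp]: "0 < qtwo_abs x \<longleftrightarrow> x \<noteq> 0"
  using qtwo_abs_nonneg[of x] qtwo_abs_eq_0_iff[of x] by linarith

lemma qtwo_abs_sum_le:
  assumes "\<And>i. i \<in> A \<Longrightarrow> qtwo_abs (f i) \<le> c" "0 \<le> c"
  shows "qtwo_abs (sum f A) \<le> c"
  using assms(1)
proof (induction A rule: infinite_finite_induct)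
  case (insert x A)
  then have "qtwo_abs (f x) \<le> c" "qtwo_abs (sum f A) \<le> c" by auto
  then show ?case
    using qtwo_abs_ultrametric[of "f x" "sum f A"] insert.hyps by simp
qed (use assms(2) in auto)

lemma qtwo_abs_prod: "qtwo_abs (prod f A) = (\<Prod>i\<in>A. qtwo_abs (f i))"
  by (induction A rule: infinite_finite_induct) (auto simp: qtwo_abs_mult)

lemma qtwo_abs_power: "qtwo_abs (x ^ n) = qtwo_abs x ^ n"
  by (induction n) (auto simp: qtwo_abs_mult)

lemma qtwo_abs_divide: "qtwo_abs (x / y) = qtwo_abs x / qtwo_abs y"
proof (cases "y = 0")
  case False
  then have "qtwo_abs (x / y) * qtwo_abs y = qtwo_abs x"
    by (simp flip: qtwo_abs_mult)
  then show ?thesis using False by (simp add: nonzero_eq_divide_eq)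
qed simp

lemma qtwo_abs_diff_ultrametric: "qtwo_abs (x - y) \<le> max (qtwo_abs x) (qtwo_abs y)"
  using qtwo_abs_ultrametric[of x "- y"] by simp

lemma qtwo_abs_diff_commute: "qtwo_abs (x - y) = qtwo_abs (y - x)"
  using qtwo_abs_minus[of "x - y"] by simp

lemma qtwo_abs_isosceles:
  assumes "qtwo_abs (x - y) < qtwo_abs x"
  shows "qtwo_abs y = qtwo_abs x"
proof -
  have "qtwo_abs y \<le> max (qtwo_abs x) (qtwo_abs (y - x))"
    using qtwo_abs_ultrametric[of x "y - x"] by simp
  moreover have "qtwo_abs x \<le> max (qtwo_abs (x - y)) (qtwo_abs y)"
    using qtwo_abs_ultrametric[of "x - y" y] by simp
  ultimately show ?thesis using assms qtwo_abs_diff_commute[of x y] by linarith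
qed

lemma qtwo_abs_of_int: "qtwo_abs (of_int k) = (if k = 0 then 0 else 2 powi - int (multiplicity 2 k))"
proof -
  have "qtwo_abs (of_int k) = rat_abs2 (of_int k)"
    using qtwo_abs_of_rat[of "of_int k"] by simp
  then show ?thesis
    using rat_abs2_frac[of k 1] by auto
qed

lemma qtwo_abs_of_int_le_1: "qtwo_abs (of_int k) \<le> 1"
  by (simp add: qtwo_abs_of_int power_int_minus one_le_power inverse_le_1_iff)

lemma qtwo_abs_of_nat_le_1: "qtwo_abs (of_nat k) \<le> 1"
  using qtwo_abs_of_int_le_1[of "int k"] by simp

lemma qtwo_abs_of_nat_odd: "odd k \<Longrightarrow> qtwo_abs (of_nat k) = 1"
  using qtwo_abs_of_int[of "int k"] by (auto simp: not_dvd_imp_multiplicity_0 odd_pos)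

lemma qtwo_abs_2 [simp]: "qtwo_abs 2 = 1 / 2"
  using qtwo_abs_of_int[of 2] by (simp add: power_int_minus field_simps)

lemma qtwo_abs_of_nat_double: "qtwo_abs (2 * of_nat k) \<le> 1 / 2"
  using qtwo_abs_of_nat_le_1[of k] by (simp add: qtwo_abs_mult)

lemma qtwo_abs_sign [simp]: "qtwo_abs (of_int (sign p)) = 1"
  by (cases p rule: sign_cases) auto

lemma qtwo_abs_prod_le_1:
  assumes "\<And>i. i \<in> A \<Longrightarrow> qtwo_abs (f i) \<le> 1"
  shows "qtwo_abs (prod f A) \<le> 1"
  unfolding qtwo_abs_prod using assms by (intro prod_le_1) auto

lemma qtwo_abs_mult_le: "qtwo_abs x \<le> a \<Longrightarrow> qtwo_abs y \<le> b \<Longrightarrow> qtwo_abs (x * y) \<le> a * b"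
  unfolding qtwo_abs_mult by (intro mult_mono) (auto intro: order_trans[OF qtwo_abs_nonneg])

lemma qtwo_abs_prod_diff:
  assumes "\<And>i. i \<in> A \<Longrightarrow> qtwo_abs (f i) \<le> 1" "\<And>i. i \<in> A \<Longrightarrow> qtwo_abs (g i) \<le> 1"
    and "\<And>i. i \<in> A \<Longrightarrow> qtwo_abs (f i - g i) \<le> e" "0 \<le> e"
  shows "qtwo_abs (prod f A - prod g A) \<le> e"
  using assms(1-3)
proof (induction A rule: infinite_finite_induct)
  case (insert x A)
  have "qtwo_abs (prod g A) \<le> 1"
    using insert.prems by (intro qtwo_abs_prod_le_1) auto
  then have "qtwo_abs (f x * (prod f A - prod g A)) \<le> 1 * e" "qtwo_abs ((f x - g x) * prod g A) \<le> e * 1"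
    using insert by (auto intro: qtwo_abs_mult_le[of _ 1 _ e, simplified] qtwo_abs_mult_le[of _ e _ 1, simplified])
  moreover have "f x * prod f A - g x * prod g A = f x * (prod f A - prod g A) + (f x - g x) * prod g A"
    by (simp add: algebra_simps)
  ultimately show ?case
    using qtwo_abs_ultrametric[of "f x * (prod f A - prod g A)" "(f x - g x) * prod g A"] insert.hyps
    by simp
qed (use assms(4) in auto)

text \<open>A minor is a polynomial with integer coefficients in the entries, so on 2-integral
  matrices it moves by no more than the entries do.\<close>

lemma principal_minor_diff:
  assumes "\<And>i j. i \<in> S \<Longrightarrow> j \<in> S \<Longrightarrow> qtwo_abs (A i j) \<le> 1" "\<And>i j. i \<in> S \<Longrightarrow> j \<in> S \<Longrightarrow> qtwo_abs (B i j) \<le> 1"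
    and "\<And>i j. i \<in> S \<Longrightarrow> j \<in> S \<Longrightarrow> qtwo_abs (A i j - B i j) \<le> e" "0 \<le> e"
  shows "qtwo_abs (principal_minor A S - principal_minor B S) \<le> e"
proof -
  have "principal_minor A S - principal_minor B S
     = (\<Sum>p | p permutes S. of_int (sign p) * ((\<Prod>i\<in>S. A i (p i)) - (\<Prod>i\<in>S. B i (p i))))"
    by (simp add: principal_minor_def sum_subtractf algebra_simps)
  also have "qtwo_abs \<dots> \<le> e"
    using assms by (intro qtwo_abs_sum_le) (auto simp: qtwo_abs_mult permutes_in_image intro!: qtwo_abs_prod_diff)
  finally show ?thesis .
qed

lemma principal_minor_le:
  assumes "finite S" "i0 \<in> S" "\<And>i j. i \<in> S \<Longrightarrow> j \<in> S \<Longrightarrow> qtwo_abs (A i j) \<le> 1"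
    and "\<And>j. j \<in> S \<Longrightarrow> qtwo_abs (A i0 j) \<le> e" "0 \<le> e"
  shows "qtwo_abs (principal_minor A S) \<le> e"
  unfolding principal_minor_def
proof (intro qtwo_abs_sum_le \<open>0 \<le> e\<close>)
  fix p assume "p \<in> {p. p permutes S}"
  then have p: "p i \<in> S" if "i \<in> S" for i using that by (simp add: permutes_in_image)
  have "(\<Prod>i\<in>S. A i (p i)) = A i0 (p i0) * (\<Prod>i\<in>S - {i0}. A i (p i))"
    using assms(1,2) by (rule prod.remove)
  moreover have "qtwo_abs (A i0 (p i0) * (\<Prod>i\<in>S - {i0}. A i (p i))) \<le> e * 1"
    using assms p by (intro qtwo_abs_mult_le qtwo_abs_prod_le_1) auto
  ultimately show "qtwo_abs (of_int (sign p) * (\<Prod>i\<in>S. A i (p i))) \<le> e"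
    by (simp add: qtwo_abs_mult)
qed

lemma principal_minor_identity:
  assumes "finite S"
  shows "principal_minor (\<lambda>i j. if i = j then 1 else 0) S = 1"
proof -
  have "principal_minor (\<lambda>i j. if i = j then 1 else 0) S
      = (\<Sum>p\<in>{id}. of_int (sign p) * (\<Prod>i\<in>S. if i = p i then 1 else 0 :: qtwo))"
    unfolding principal_minor_def
  proof (rule sum.mono_neutral_right)
    show "\<forall>p\<in>{p. p permutes S} - {id}. of_int (sign p) * (\<Prod>i\<in>S. if i = p i then 1 else 0 :: qtwo) = 0"
    proof
      fix p assume p: "p \<in> {p. p permutes S} - {id}"
      then obtain i where "p i \<noteq> i" by (auto simp: fun_eq_iff)
      then have "i \<in> S" using p by (auto simp: permutes_def)
      then show "of_int (sign p) * (\<Prod>i\<in>S. if i = p i then 1 else 0 :: qtwo) = 0"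
        using \<open>p i \<noteq> i\<close> assms by (auto intro!: bexI[of _ i])
    qed
  qed (use assms in \<open>auto simp: finite_permutations permutes_id\<close>)
  then show ?thesis by simp
qed

lemma principal_minor_scale_rows:
  "principal_minor (\<lambda>i j. d i * A i j) S = (\<Prod>i\<in>S. d i) * principal_minor A S"
  by (simp add: principal_minor_def prod.distrib sum_distrib_left mult_ac)

section \<open>Principal minors of X Y and Y X\<close>

text \<open>Summing over \<open>n\<close>-tuples instead of \<open>n\<close>-subsets counts every subset \<open>n!\<close> times, but reduces the identity between
  the principal minors of \<open>XY\<close> and \<open>YX\<close> to a reindexing.\<close>

definition tuple_minor :: "(nat \<Rightarrow> nat \<Rightarrow> qtwo) \<Rightarrow> nat \<Rightarrow> (nat \<Rightarrow> nat) \<Rightarrow> qtwo" where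
  "tuple_minor A n f = (\<Sum>p | p permutes {..<n}. of_int (sign p) * (\<Prod>k<n. A (f k) (f (p k))))"

lemma tuple_minor_inj:
  assumes "bij_betw f {..<n} S"
  shows "tuple_minor A n f = principal_minor A S"
proof -
  let ?h = "map_permutation {..<n} f"
  have inj: "inj_on f {..<n}" and S: "f ` {..<n} = S" using assms by (auto simp: bij_betw_def)
  have h: "?h p permutes S" if "p permutes {..<n}" for p
    using assms that by (rule map_permutation_permutes)
  show ?thesis
    unfolding tuple_minor_def principal_minor_def
  proof (rule sum.reindex_bij_witness[of _ "map_permutation S (inv_into {..<n} f)" ?h])
    have b': "bij_betw (inv_into {..<n} f) S {..<n}" using assms by (rule bij_betw_inv_into)
    fix p assume "p \<in> {p. p permutes {..<n}}"
    then have p: "p permutes {..<n}" by simp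
    show "map_permutation S (inv_into {..<n} f) (?h p) = p"
      using assms p by (intro map_permutation_compose_inv) (auto simp: bij_betw_def)
    show "?h p \<in> {p. p permutes S}" using h[OF p] by simp
    have "(\<Prod>i\<in>S. A i (?h p i)) = (\<Prod>k<n. A (f k) (?h p (f k)))"
      unfolding S[symmetric] by (rule prod.reindex[OF inj, unfolded o_def])
    also have "\<dots> = (\<Prod>k<n. A (f k) (f (p k)))"
      using inj by (intro prod.cong refl) (simp add: map_permutation_apply)
    finally show "of_int (sign (?h p)) * (\<Prod>i\<in>S. A i (?h p i)) = of_int (sign p) * (\<Prod>k<n. A (f k) (f (p k)))"
      using inj p by (simp add: sign_map_permutation)
  next
    fix q assume "q \<in> {q. q permutes S}"
    then have q: "q permutes S" by simp
    have b': "bij_betw (inv_into {..<n} f) S {..<n}" using assms by (rule bij_betw_inv_into)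
    show "map_permutation S (inv_into {..<n} f) q \<in> {p. p permutes {..<n}}"
      using map_permutation_permutes[OF b' q] by simp
    show "?h (map_permutation S (inv_into {..<n} f) q) = q"
      using b' q S by (intro map_permutation_compose_inv) (auto simp: f_inv_into_f)
  qed
qed

text \<open>Two equal columns: composing p with their transposition preserves every product and
  reverses the sign, so the sum equals its negative.\<close>

lemma tuple_minor_not_inj:
  assumes "\<not> inj_on f {..<n}"
  shows "tuple_minor A n f = 0"
proof -
  obtain a b where ab: "a < n" "b < n" "a \<noteq> b" "f a = f b"
    using assms by (auto simp: inj_on_def)
  let ?t = "Transposition.transpose a b"
  have t: "?t permutes {..<n}" using ab by (auto intro: permutes_swap_id)
  have tt: "?t \<circ> (?t \<circ> p) = p" for p :: "nat \<Rightarrow> nat" by (simp add: fun_eq_iff)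
  have "tuple_minor A n f = (\<Sum>p | p permutes {..<n}. of_int (sign (?t \<circ> p)) * (\<Prod>k<n. A (f k) (f ((?t \<circ> p) k))))"
    unfolding tuple_minor_def
  proof (rule sum.reindex_bij_witness[of _ "\<lambda>p. ?t \<circ> p" "\<lambda>p. ?t \<circ> p"])
    fix p assume "p \<in> {p. p permutes {..<n}}"
    then show "?t \<circ> p \<in> {p. p permutes {..<n}}" using t by (auto intro: permutes_compose)
  next
    fix p assume "p \<in> {p. p permutes {..<n}}"
    then show "?t \<circ> p \<in> {p. p permutes {..<n}}" using t by (auto intro: permutes_compose)
  qed (simp_all add: tt)
  also have "\<dots> = - tuple_minor A n f"
    unfolding tuple_minor_def sum_negf[symmetric]
  proof (intro sum.cong refl)
    fix p assume "p \<in> {p. p permutes {..<n}}"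
    then have "permutation p" by (auto intro: permutes_imp_permutation[of "{..<n}"])
    then have "sign (?t \<circ> p) = - sign p"
      using ab by (subst sign_compose) (auto simp: sign_swap_id intro: permutation_swap_id)
    moreover have "f ((?t \<circ> p) k) = f (p k)" for k
      using ab by (auto simp: Transposition.transpose_def)
    ultimately show "of_int (sign (?t \<circ> p)) * (\<Prod>k<n. A (f k) (f ((?t \<circ> p) k)))
        = - (of_int (sign p) * (\<Prod>k<n. A (f k) (f (p k))))"
      by simp
  qed
  finally show ?thesis by simp
qed

lemma card_bij_funcset:
  assumes "finite S" "card S = n"
  shows "card {f \<in> {..<n} \<rightarrow>\<^sub>E S. bij_betw f {..<n} S} = fact n"
proof -
  have "{f \<in> {..<n} \<rightarrow>\<^sub>E S. bij_betw f {..<n} S} = {f \<in> {..<n} \<rightarrow>\<^sub>E S. inj_on f {..<n}}"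
  proof (intro Collect_cong conj_cong refl iffI)
    fix f assume f: "f \<in> {..<n} \<rightarrow>\<^sub>E S" "inj_on f {..<n}"
    then have "f ` {..<n} = S"
      using assms by (intro card_subset_eq) (auto simp: card_image)
    then show "bij_betw f {..<n} S" using f by (simp add: bij_betw_def)
  qed (simp add: bij_betw_def)
  then show ?thesis
    using assms by (simp add: card_inj_on_subset_funcset fact_prod_rev)
qed

lemma sum_tuple_minor:
  assumes "finite F"
  shows "(\<Sum>f\<in>{..<n} \<rightarrow>\<^sub>E F. tuple_minor A n f) = fact n * (\<Sum>S | S \<subseteq> F \<and> card S = n. principal_minor A S)"
proof -
  let ?I = "{f \<in> {..<n} \<rightarrow>\<^sub>E F. inj_on f {..<n}}"
  let ?T = "{S. S \<subseteq> F \<and> card S = n}"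
  have finI: "finite ?I" using assms by (intro finite_subset[OF _ finite_PiE[of "{..<n}" "\<lambda>_. F"]]) auto
  have finT: "finite ?T" using assms by auto
  have "(\<Sum>f\<in>{..<n} \<rightarrow>\<^sub>E F. tuple_minor A n f) = (\<Sum>f\<in>?I. tuple_minor A n f)"
  proof (rule sum.mono_neutral_right)
    show "finite ({..<n} \<rightarrow>\<^sub>E F)" using assms by (intro finite_PiE) auto
    show "\<forall>f\<in>({..<n} \<rightarrow>\<^sub>E F) - ?I. tuple_minor A n f = 0"
      by (intro ballI tuple_minor_not_inj) blast
  qed blast
  also have "\<dots> = (\<Sum>S\<in>?T. \<Sum>f | f \<in> ?I \<and> f ` {..<n} = S. tuple_minor A n f)"
  proof (rule sum.group[symmetric, OF finI finT])
    show "(\<lambda>f. f ` {..<n}) ` ?I \<subseteq> ?T"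
    proof clarify
      fix f assume "f \<in> {..<n} \<rightarrow>\<^sub>E F" "inj_on f {..<n}"
      then show "f ` {..<n} \<subseteq> F \<and> card (f ` {..<n}) = n"
        using card_image[of f "{..<n}"] by auto
    qed
  qed
  also have "\<dots> = (\<Sum>S\<in>?T. fact n * principal_minor A S)"
  proof (intro sum.cong refl)
    fix S assume S: "S \<in> ?T"
    have eq: "{f. f \<in> ?I \<and> f ` {..<n} = S} = {f \<in> {..<n} \<rightarrow>\<^sub>E S. bij_betw f {..<n} S}"
      using S by (auto simp: bij_betw_def PiE_iff)
    have "(\<Sum>f | f \<in> ?I \<and> f ` {..<n} = S. tuple_minor A n f)
        = (\<Sum>f\<in>{f \<in> {..<n} \<rightarrow>\<^sub>E S. bij_betw f {..<n} S}. principal_minor A S)"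
      unfolding eq by (intro sum.cong refl) (auto simp: tuple_minor_inj)
    also have "\<dots> = fact n * principal_minor A S"
      using S finite_subset[OF _ assms, of S] card_bij_funcset[of S n] by simp
    finally show "(\<Sum>f | f \<in> ?I \<and> f ` {..<n} = S. tuple_minor A n f) = fact n * principal_minor A S" .
  qed
  finally show ?thesis by (simp add: sum_distrib_left)
qed

lemma tuple_minor_mult_expand:
  assumes "finite G"
  shows "tuple_minor (\<lambda>i j. \<Sum>t\<in>G. X i t * Y t j) n f
    = (\<Sum>h\<in>{..<n} \<rightarrow>\<^sub>E G. \<Sum>p | p permutes {..<n}. of_int (sign p) * (\<Prod>k<n. X (f k) (h k) * Y (h k) (f (p k))))"
  unfolding tuple_minor_def using assms
  by (simp add: prod_sum_PiE sum_distrib_left) (rule sum.swap)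

text \<open>The n-th exterior powers of X Y and Y X have the same trace; equivalently, det (1 - z X
  Y) = det (1 - z Y X) for finite rectangular matrices.\<close>

lemma sum_principal_minor_commute:
  assumes F: "finite F" and G: "finite G"
  shows "(\<Sum>S | S \<subseteq> F \<and> card S = n. principal_minor (\<lambda>i j. \<Sum>t\<in>G. X i t * Y t j) S)
    = (\<Sum>T | T \<subseteq> G \<and> card T = n. principal_minor (\<lambda>t s. \<Sum>i\<in>F. Y t i * X i s) T)"
proof -
  let ?P = "{p. p permutes {..<n}}"
  have "(\<Sum>f\<in>{..<n} \<rightarrow>\<^sub>E F. tuple_minor (\<lambda>i j. \<Sum>t\<in>G. X i t * Y t j) n f)
    = (\<Sum>f\<in>{..<n} \<rightarrow>\<^sub>E F. \<Sum>h\<in>{..<n} \<rightarrow>\<^sub>E G. \<Sum>p\<in>?P. of_int (sign p) * (\<Prod>k<n. X (f k) (h k) * Y (h k) (f (p k))))"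
    using G by (simp add: tuple_minor_mult_expand)
  also have "\<dots> = (\<Sum>h\<in>{..<n} \<rightarrow>\<^sub>E G. \<Sum>f\<in>{..<n} \<rightarrow>\<^sub>E F. \<Sum>p\<in>?P. of_int (sign p) * (\<Prod>k<n. X (f k) (h k) * Y (h k) (f (p k))))"
    by (rule sum.swap)
  also have "\<dots> = (\<Sum>h\<in>{..<n} \<rightarrow>\<^sub>E G. \<Sum>p\<in>?P. \<Sum>f\<in>{..<n} \<rightarrow>\<^sub>E F. of_int (sign p) * (\<Prod>k<n. X (f k) (h k) * Y (h k) (f (p k))))"
    by (rule sum.cong[OF refl], rule sum.swap)
  also have "\<dots> = (\<Sum>h\<in>{..<n} \<rightarrow>\<^sub>E G. \<Sum>p\<in>?P. \<Sum>f\<in>{..<n} \<rightarrow>\<^sub>E F. of_int (sign p) * (\<Prod>k<n. Y (h k) (f k) * X (f k) (h (p k))))"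
  proof (rule sum.cong[OF refl], rule sum.cong[OF refl])
    fix h p assume "p \<in> ?P"
    then have p: "p permutes {..<n}" by simp
    have pin: "p k < n \<longleftrightarrow> k < n" "inv p k < n \<longleftrightarrow> k < n" for k
      using permutes_in_image[OF p, of k] permutes_in_image[OF permutes_inv[OF p], of k] by auto
    have pp: "p (inv p k) = k" "inv p (p k) = k" for k using permutes_inverses[OF p] by auto
    \<comment> \<open>The substitution of \<open>f \<circ> p\<close> for f, with the product of the
      X entries reindexed by p, moves the permutation from Y to X.\<close>
    show "(\<Sum>f\<in>{..<n} \<rightarrow>\<^sub>E F. of_int (sign p) * (\<Prod>k<n. X (f k) (h k) * Y (h k) (f (p k))))
        = (\<Sum>f\<in>{..<n} \<rightarrow>\<^sub>E F. of_int (sign p) * (\<Prod>k<n. Y (h k) (f k) * X (f k) (h (p k))))"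
    proof (rule sum.reindex_bij_witness[of _ "\<lambda>f. f \<circ> inv p" "\<lambda>f. f \<circ> p"])
      fix f assume f: "f \<in> {..<n} \<rightarrow>\<^sub>E F"
      show "f \<circ> p \<circ> inv p = f" "f \<circ> inv p \<circ> p = f" by (simp_all add: fun_eq_iff pp)
      show "f \<circ> p \<in> {..<n} \<rightarrow>\<^sub>E F" "f \<circ> inv p \<in> {..<n} \<rightarrow>\<^sub>E F"
        using f pin by (auto simp: PiE_iff extensional_def)
      have "(\<Prod>k<n. X (f k) (h k)) = (\<Prod>k<n. X (f (p k)) (h (p k)))"
        by (rule prod.permute[OF p, unfolded o_def])
      then show "of_int (sign p) * (\<Prod>k<n. Y (h k) ((f \<circ> p) k) * X ((f \<circ> p) k) (h (p k)))
          = of_int (sign p) * (\<Prod>k<n. X (f k) (h k) * Y (h k) (f (p k)))"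
        by (simp add: prod.distrib mult_ac)
    qed
  qed
  also have "\<dots> = (\<Sum>h\<in>{..<n} \<rightarrow>\<^sub>E G. \<Sum>f\<in>{..<n} \<rightarrow>\<^sub>E F. \<Sum>p\<in>?P. of_int (sign p) * (\<Prod>k<n. Y (h k) (f k) * X (f k) (h (p k))))"
    by (rule sum.cong[OF refl], rule sum.swap)
  also have "\<dots> = (\<Sum>h\<in>{..<n} \<rightarrow>\<^sub>E G. tuple_minor (\<lambda>t s. \<Sum>i\<in>F. Y t i * X i s) n h)"
    using F by (simp add: tuple_minor_mult_expand)
  finally show ?thesis
    unfolding sum_tuple_minor[OF F] sum_tuple_minor[OF G] by simp
qed

section \<open>Unconditional convergence and dominant terms\<close>

lemma tendsto_zero_qtwo_iff: "(f \<longlongrightarrow> (0 :: qtwo)) F \<longleftrightarrow> ((\<lambda>x. qtwo_abs (f x)) \<longlongrightarrow> 0) F"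
  by (subst tendsto_dist_iff) (simp add: dist_qtwo_def)

lemma tendsto_zero_qtwoD:
  assumes "(f \<longlongrightarrow> (0 :: qtwo)) F" "e > 0"
  shows "\<forall>\<^sub>F x in F. qtwo_abs (f x) < e"
  using order_tendstoD(2)[OF assms(1)[unfolded tendsto_zero_qtwo_iff] assms(2)] .

lemma tendsto_qtwoD:
  assumes "(f \<longlongrightarrow> (l :: qtwo)) F" "e > 0"
  shows "\<forall>\<^sub>F x in F. qtwo_abs (f x - l) < e"
  using tendstoD[OF assms] by (simp add: dist_qtwo_def)

text \<open>In a complete ultrametric field, terms that become small outside finite sets suffice for
  unconditional summability. This turns the \<open>infsum\<close> over all index sets into a limit
  over the subsets of \<open>{..<I}\<close>.\<close>

lemma has_sum_qtwo_exhaustion: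
  fixes h :: "'i \<Rightarrow> qtwo"
  assumes fin: "\<And>I. finite (B I)" and sub: "\<And>I. B I \<subseteq> A"
    and small: "\<And>e. e > 0 \<Longrightarrow> \<exists>I0. \<forall>I\<ge>I0. \<forall>x\<in>A - B I. qtwo_abs (h x) < e"
  shows "\<exists>L. (h has_sum L) A \<and> (\<lambda>I::nat. sum h (B I)) \<longlonglongrightarrow> L"
proof -
  have diff: "\<exists>I0. \<forall>I\<ge>I0. \<forall>Y. finite Y \<and> B I \<subseteq> Y \<and> Y \<subseteq> A \<longrightarrow> qtwo_abs (sum h Y - sum h (B I)) \<le> e" if "e > 0" for e
  proof -
    obtain I0 where I0: "\<And>I x. I \<ge> I0 \<Longrightarrow> x \<in> A - B I \<Longrightarrow> qtwo_abs (h x) < e"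
      using small[OF \<open>e > 0\<close>] by blast
    have "qtwo_abs (sum h Y - sum h (B I)) \<le> e" if "I \<ge> I0" "finite Y" "B I \<subseteq> Y" "Y \<subseteq> A" for I Y
    proof -
      have "sum h Y - sum h (B I) = sum h (Y - B I)"
        using that by (simp add: sum_diff)
      moreover have "qtwo_abs (sum h (Y - B I)) \<le> e"
      proof (rule qtwo_abs_sum_le)
        fix x assume "x \<in> Y - B I"
        then have "x \<in> A - B I" using that by blast
        then show "qtwo_abs (h x) \<le> e" using I0[OF that(1)] by (simp add: less_imp_le)
      qed (use \<open>e > 0\<close> in simp)
      ultimately show ?thesis by simp
    qed
    then show ?thesis by blast
  qed
  have "Cauchy (\<lambda>I. sum h (B I))"
  proof (rule metric_CauchyI)
    fix e :: real assume "e > 0"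
    then obtain I0 where I0: "\<And>I Y. I \<ge> I0 \<Longrightarrow> finite Y \<Longrightarrow> B I \<subseteq> Y \<Longrightarrow> Y \<subseteq> A \<Longrightarrow> qtwo_abs (sum h Y - sum h (B I)) \<le> e / 2"
      using diff[OF half_gt_zero[OF \<open>e > 0\<close>]] by blast
    have "dist (sum h (B I)) (sum h (B J)) < e" if "I \<ge> I0" "J \<ge> I0" for I J
    proof -
      have a: "qtwo_abs (sum h (B I \<union> B J) - sum h (B I)) \<le> e / 2" "qtwo_abs (sum h (B I \<union> B J) - sum h (B J)) \<le> e / 2"
        using I0[of I "B I \<union> B J"] I0[of J "B I \<union> B J"] that fin[of I] fin[of J] sub[of I] sub[of J]
        by blast+
      have "qtwo_abs ((sum h (B I \<union> B J) - sum h (B J)) - (sum h (B I \<union> B J) - sum h (B I))) \<le> e / 2"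
        using qtwo_abs_diff_ultrametric a by (meson max.bounded_iff order_trans max.boundedI)
      then show ?thesis using \<open>e > 0\<close> by (simp add: dist_qtwo_def)
    qed
    then show "\<exists>M. \<forall>m\<ge>M. \<forall>n\<ge>M. dist (sum h (B m)) (sum h (B n)) < e" by blast
  qed
  then obtain L where L: "(\<lambda>I. sum h (B I)) \<longlonglongrightarrow> L"
    using Cauchy_convergent convergent_def by blast
  have "(h has_sum L) A"
    unfolding has_sum_def
  proof (rule tendstoI)
    fix e :: real assume e: "e > 0"
    then obtain I0 where I0: "\<And>I Y. I \<ge> I0 \<Longrightarrow> finite Y \<Longrightarrow> B I \<subseteq> Y \<Longrightarrow> Y \<subseteq> A \<Longrightarrow> qtwo_abs (sum h Y - sum h (B I)) \<le> e / 2"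
      using diff[OF half_gt_zero[OF e]] by blast
    obtain I1 where I1: "\<And>I. I \<ge> I1 \<Longrightarrow> dist (sum h (B I)) L < e / 2"
      using metric_LIMSEQ_D[OF L, of "e / 2"] e by auto
    define I where "I = max I0 I1"
    have "dist (sum h Y) L < e" if "finite Y" "B I \<subseteq> Y" "Y \<subseteq> A" for Y
      using I0[of I Y] I1[of I] that dist_triangle[of "sum h Y" L "sum h (B I)"] by (simp add: I_def dist_qtwo_def)
    then show "\<forall>\<^sub>F Y in finite_subsets_at_top A. dist (sum h Y) L < e"
      using fin sub by (auto simp: eventually_finite_subsets_at_top intro!: exI[of _ "B I"])
  qed
  then show ?thesis using L by blast
qed

text \<open>An exchange argument: \<open>T - {..<n}\<close> and \<open>{..<n} - T\<close> are
  equally large and nonempty, d is at most d n on the first and at least d (n - 1) on the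
  second.\<close>

lemma prod_strict_antimono_le:
  fixes d :: "nat \<Rightarrow> real"
  assumes pos: "\<And>t. 0 < d t" and anti: "\<And>s t. s < t \<Longrightarrow> d t < d s"
    and T: "finite T" "card T = n" "T \<noteq> {..<n}"
  shows "prod d T < prod d {..<n}"
proof -
  define P Q where "P = T - {..<n}" and "Q = {..<n} - T"
  have fin: "finite P" "finite Q" using T by (auto simp: P_def Q_def)
  have "card (T \<inter> {..<n}) + card P = card (T \<inter> {..<n}) + card Q"
    using T card_Int_Diff[of T "{..<n}"] card_Int_Diff[of "{..<n}" T] by (simp add: P_def Q_def Int_commute)
  then have card: "card P = card Q" by simp
  have "P \<noteq> {}"
  proof
    assume "P = {}"
    then have "T \<subseteq> {..<n}" by (auto simp: P_def)
    then have "T = {..<n}" using T by (intro card_subset_eq) auto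
    then show False using T by simp
  qed
  then have cP: "card P > 0" using fin by (simp add: card_gt_0_iff)
  then have n: "n > 0" using card fin by (cases n) (auto simp: Q_def)
  have anti': "s \<le> t \<Longrightarrow> d t \<le> d s" for s t
    using anti[of s t] by (cases "s = t") auto
  have "prod d P \<le> (\<Prod>t\<in>P. d n)"
    using pos anti' by (intro prod_mono) (auto simp: P_def less_imp_le)
  also have "\<dots> = d n ^ card P" by simp
  also have "\<dots> < d (n - 1) ^ card P"
    using cP n pos[of n] by (intro power_strict_mono anti) (auto simp: less_imp_le)
  also have "\<dots> = (\<Prod>t\<in>Q. d (n - 1))" by (simp add: card)
  also have "\<dots> \<le> prod d Q"
    using pos by (intro prod_mono conjI anti') (auto simp: Q_def less_imp_le)
  finally have "prod d P < prod d Q" .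
  moreover have "prod d T = prod d (T \<inter> {..<n}) * prod d P"
    unfolding P_def using T by (subst prod.union_disjoint[symmetric]) (auto intro!: prod.cong)
  moreover have "prod d {..<n} = prod d (T \<inter> {..<n}) * prod d Q"
    unfolding Q_def using T by (subst prod.union_disjoint[symmetric]) (auto intro!: prod.cong)
  moreover have "0 < prod d (T \<inter> {..<n})" using pos by (simp add: prod_pos)
  ultimately show ?thesis by simp
qed

lemma qtwo_abs_sum_dominant:
  assumes "finite A" "a \<in> A" "\<And>x. x \<in> A \<Longrightarrow> x \<noteq> a \<Longrightarrow> qtwo_abs (f x) < qtwo_abs (f a)"
  shows "qtwo_abs (sum f A) = qtwo_abs (f a)"
proof (cases "A = {a}")
  case False
  have s: "sum f A = f a + sum f (A - {a})" using assms(1,2) by (rule sum.remove)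
  define c where "c = Max ((\<lambda>x. qtwo_abs (f x)) ` (A - {a}))"
  have ne: "A - {a} \<noteq> {}" using False assms(2) by blast
  have "c < qtwo_abs (f a)"
    unfolding c_def using assms ne by (subst Max_less_iff) auto
  moreover have "qtwo_abs (sum f (A - {a})) \<le> c"
  proof (rule qtwo_abs_sum_le)
    show "qtwo_abs (f x) \<le> c" if "x \<in> A - {a}" for x
      unfolding c_def using that assms(1) by (intro Max_ge) auto
    obtain x where "x \<in> A - {a}" using ne by blast
    then have "qtwo_abs (f x) \<le> c" unfolding c_def using assms(1) by (intro Max_ge) auto
    then show "0 \<le> c" using qtwo_abs_nonneg[of "f x"] by linarith
  qed
  ultimately show ?thesis
    using qtwo_abs_isosceles[of "f a" "sum f A"] unfolding s by simp
qed simp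

text \<open>The matrix is \<open>M = X D Y\<close> with \<open>D\<close> diagonal. Its principal minors of size \<open>n\<close> have the same sum as those of
  \<open>D (Y X) = D K\<close>, and since \<open>K\<close> is the identity modulo \<open>2\<close>, the minor of the first \<open>n\<close> rows dominates. Truncating
  the inner dimension at \<open>N\<close> costs an error of size at most \<open>\<bar>d N\<bar>\<close>.\<close>

theorem qtwo_abs_fredholm_series:
  fixes M X Y K :: "nat \<Rightarrow> nat \<Rightarrow> qtwo" and d :: "nat \<Rightarrow> qtwo"
  assumes X1: "\<And>i t. qtwo_abs (X i t) \<le> 1" and Y1: "\<And>t j. qtwo_abs (Y t j) \<le> 1"
    and d_nz: "\<And>t. d t \<noteq> 0" and d1: "\<And>t. qtwo_abs (d t) \<le> 1"
    and d_dec: "\<And>s t. s < t \<Longrightarrow> qtwo_abs (d t) < qtwo_abs (d s)" and d0: "d \<longlonglongrightarrow> 0"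
    and M: "\<And>i j N. qtwo_abs (M i j - (\<Sum>t<N. d t * X i t * Y t j)) \<le> qtwo_abs (d N)"
    and X0: "\<And>t. (\<lambda>i. X i t) \<longlonglongrightarrow> 0"
    and K: "\<And>t s. (\<lambda>I. \<Sum>i<I. Y t i * X i s) \<longlonglongrightarrow> K t s"
    and K_id: "\<And>t s. qtwo_abs (K t s - (if t = s then 1 else 0)) \<le> 1 / 2"
  shows "qtwo_abs (fps_nth (fredholm_series M) n) = (\<Prod>t<n. qtwo_abs (d t))"
proof -
  define D where "D = (\<Prod>t<n. qtwo_abs (d t))"
  have D: "D > 0" unfolding D_def using d_nz by (intro prod_pos) auto
  define \<F> where "\<F> I = {S :: nat set. S \<subseteq> {..<I} \<and> card S = n}" for I
  let ?A = "{S :: nat set. finite S \<and> card S = n}"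
  have dXY: "qtwo_abs (d t * X i t * Y t j) \<le> qtwo_abs (d t)" for t i j
    using qtwo_abs_mult_le[OF qtwo_abs_mult_le[OF order_refl X1, of "d t" i t] Y1[of t j]] by simp
  \<comment> \<open>The empty truncation N = 0 already bounds the entries of M by
    \<open>d 0\<close>.\<close>
  have M1: "qtwo_abs (M i j) \<le> 1" for i j
    using M[of i j 0] d1[of 0] by simp
  have MN: "qtwo_abs (\<Sum>t<N. d t * X i t * Y t j) \<le> 1" for N i j
    by (rule qtwo_abs_sum_le) (use order_trans[OF dXY d1] in auto)
  \<comment> \<open>The rows of M tend to 0 uniformly in the column, so a principal minor whose
    index set contains a large index is small.\<close>
  have M0: "\<exists>I. \<forall>i\<ge>I. \<forall>j. qtwo_abs (M i j) \<le> e" if e: "e > 0" for e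
  proof -
    obtain N where N: "qtwo_abs (d N) < e"
      using tendsto_zero_qtwoD[OF d0 e] eventually_happens'[OF sequentially_bot] by blast
    have "\<forall>\<^sub>F i in sequentially. \<forall>t\<in>{..<N}. qtwo_abs (X i t) < e"
      using tendsto_zero_qtwoD[OF X0 e] by (simp add: eventually_ball_finite_distrib)
    then obtain I where I: "\<And>i t. i \<ge> I \<Longrightarrow> t < N \<Longrightarrow> qtwo_abs (X i t) < e"
      unfolding eventually_sequentially by blast
    have "qtwo_abs (M i j) \<le> e" if "i \<ge> I" for i j
    proof -
      have "qtwo_abs (\<Sum>t<N. d t * X i t * Y t j) \<le> e"
      proof (rule qtwo_abs_sum_le)
        fix t assume "t \<in> {..<N}"
        then have "qtwo_abs (X i t) \<le> e" using I[OF that, of t] by simp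
        then show "qtwo_abs (d t * X i t * Y t j) \<le> e"
          using qtwo_abs_mult_le[OF qtwo_abs_mult_le[OF d1[of t], of "X i t" e] Y1[of t j]] by simp
      qed (use e in simp)
      then show ?thesis
        using M[of i j N] N qtwo_abs_ultrametric[of "M i j - (\<Sum>t<N. d t * X i t * Y t j)" "\<Sum>t<N. d t * X i t * Y t j"]
        by simp
    qed
    then show ?thesis by blast
  qed
  have "\<exists>L. (principal_minor M has_sum L) ?A \<and> (\<lambda>I. sum (principal_minor M) (\<F> I)) \<longlonglongrightarrow> L"
  proof (rule has_sum_qtwo_exhaustion)
    show "finite (\<F> I)" for I unfolding \<F>_def by simp
    show "\<F> I \<subseteq> ?A" for I unfolding \<F>_def by (auto intro: finite_subset)
    fix e :: real assume "e > 0"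
    then obtain I0 where I0: "\<And>i j. i \<ge> I0 \<Longrightarrow> qtwo_abs (M i j) \<le> e / 2"
      using M0[of "e / 2"] by auto
    have "qtwo_abs (principal_minor M S) < e" if "I \<ge> I0" and S: "S \<in> ?A - \<F> I" for I S
    proof -
      have "\<not> S \<subseteq> {..<I}" using S by (auto simp: \<F>_def)
      then obtain i where "i \<in> S" "i \<ge> I" by (meson lessThan_iff not_less subsetI)
      then have "qtwo_abs (principal_minor M S) \<le> e / 2"
        using S \<open>e > 0\<close> I0 M1 \<open>I \<ge> I0\<close> by (intro principal_minor_le) auto
      then show ?thesis using \<open>e > 0\<close> by simp
    qed
    then show "\<exists>I0. \<forall>I\<ge>I0. \<forall>S\<in>?A - \<F> I. qtwo_abs (principal_minor M S) < e" by blast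
  qed
  then obtain L where L: "(principal_minor M has_sum L) ?A" and lim: "(\<lambda>I. sum (principal_minor M) (\<F> I)) \<longlonglongrightarrow> L"
    by blast
  have "\<forall>\<^sub>F N in sequentially. qtwo_abs (d N) < D \<and> N \<ge> n"
    using tendsto_zero_qtwoD[OF d0 D] eventually_ge_at_top[of n] by eventually_elim simp
  \<comment> \<open>The truncation error has to stay below the expected value D, and N >= n admits
    \<open>{..<n}\<close> among the index sets of the truncated product.\<close>
  then obtain N where N: "qtwo_abs (d N) < D" "N \<ge> n"
    using eventually_happens'[OF sequentially_bot] by blast
  define KI where "KI I t s = (\<Sum>i<I. Y t i * X i s)" for I t s
  have partial: "qtwo_abs (sum (principal_minor M) (\<F> I)) = D"
    if KI: "\<And>t s. t < N \<Longrightarrow> s < N \<Longrightarrow> qtwo_abs (KI I t s - K t s) < 1 / 2" for I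
  proof -
    define M' where "M' i j = (\<Sum>t<N. X i t * (d t * Y t j))" for i j
    have M': "M' i j = (\<Sum>t<N. d t * X i t * Y t j)" for i j
      unfolding M'_def by (simp add: mult_ac)
    have KId: "qtwo_abs (KI I t s - (if t = s then 1 else 0)) \<le> 1 / 2" if "t < N" "s < N" for t s
    proof -
      have e: "KI I t s - (if t = s then 1 else 0) = (KI I t s - K t s) + (K t s - (if t = s then 1 else 0))"
        by simp
      show ?thesis
        unfolding e
        using qtwo_abs_ultrametric[of "KI I t s - K t s" "K t s - (if t = s then 1 else 0)"] KI[OF that] K_id[of t s]
        by linarith
    qed
    have KI1: "qtwo_abs (KI I t s) \<le> 1" for t s
      unfolding KI_def using qtwo_abs_mult_le[OF Y1 X1, of t _ _ s] by (intro qtwo_abs_sum_le) auto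
    have pmK: "qtwo_abs (principal_minor (KI I) T) = 1" if T: "T \<subseteq> {..<N}" for T
    proof -
      have fT: "finite T" using T by (rule finite_subset) simp
      have "qtwo_abs (principal_minor (\<lambda>i j. if i = j then 1 else 0) T - principal_minor (KI I) T) \<le> 1 / 2"
      proof (rule principal_minor_diff)
        show "qtwo_abs ((if t = s then 1 else 0) - KI I t s) \<le> 1 / 2" if "t \<in> T" "s \<in> T" for t s
          using KId[of t s] that T by (subst qtwo_abs_diff_commute) blast
      qed (use KI1 in auto)
      then have "qtwo_abs (1 - principal_minor (KI I) T) \<le> 1 / 2"
        using fT by (simp add: principal_minor_identity)
      then show ?thesis
        using qtwo_abs_isosceles[of 1 "principal_minor (KI I) T"] by simp
    qed
    \<comment> \<open>Exchanging X and d Y gives minors of the rows of \<open>KI I\<close>, scaled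
      by d, with indices below N. There \<open>KI I\<close> is the identity modulo 2 and its minors
      are units.\<close>
    have "sum (principal_minor M') (\<F> I) = (\<Sum>T\<in>\<F> N. principal_minor (\<lambda>t s. \<Sum>i<I. d t * Y t i * X i s) T)"
      unfolding \<F>_def M'_def[abs_def] by (rule sum_principal_minor_commute) auto
    also have "\<dots> = (\<Sum>T\<in>\<F> N. (\<Prod>t\<in>T. d t) * principal_minor (KI I) T)"
      unfolding KI_def by (simp add: principal_minor_scale_rows[symmetric] sum_distrib_left mult.assoc)
    also have "qtwo_abs \<dots> = qtwo_abs ((\<Prod>t<n. d t) * principal_minor (KI I) {..<n})"
    proof (rule qtwo_abs_sum_dominant)
      show "finite (\<F> N)" unfolding \<F>_def by simp
      show "{..<n} \<in> \<F> N" using N by (auto simp: \<F>_def)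
      fix T assume T: "T \<in> \<F> N" "T \<noteq> {..<n}"
      then have "T \<subseteq> {..<N}" "{..<n} \<subseteq> {..<N}" using N by (auto simp: \<F>_def)
      moreover have "(\<Prod>t\<in>T. qtwo_abs (d t)) < (\<Prod>t<n. qtwo_abs (d t))"
        using T d_nz d_dec by (intro prod_strict_antimono_le) (auto simp: \<F>_def intro: finite_subset)
      ultimately show "qtwo_abs ((\<Prod>t\<in>T. d t) * principal_minor (KI I) T) < qtwo_abs ((\<Prod>t<n. d t) * principal_minor (KI I) {..<n})"
        by (simp add: qtwo_abs_mult qtwo_abs_prod pmK)
    qed
    also have "\<dots> = D"
      using N by (simp add: qtwo_abs_mult qtwo_abs_prod pmK D_def)
    finally have M'D: "qtwo_abs (sum (principal_minor M') (\<F> I)) = D" .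
    have "qtwo_abs (sum (principal_minor M') (\<F> I) - sum (principal_minor M) (\<F> I)) \<le> qtwo_abs (d N)"
      unfolding sum_subtractf[symmetric]
    proof (intro qtwo_abs_sum_le principal_minor_diff)
      show "qtwo_abs (M' i j - M i j) \<le> qtwo_abs (d N)" for i j
        using M[of i j N] unfolding M' by (simp add: qtwo_abs_diff_commute)
    qed (use M1 MN in \<open>simp_all add: M'\<close>)
    then show ?thesis
      using qtwo_abs_isosceles[of "sum (principal_minor M') (\<F> I)"] M'D N(1) by simp
  qed
  have "\<forall>\<^sub>F I in sequentially. \<forall>t\<in>{..<N}. \<forall>s\<in>{..<N}. qtwo_abs (KI I t s - K t s) < 1 / 2"
    unfolding KI_def using tendsto_qtwoD[OF K, of "1 / 2"] by (simp add: eventually_ball_finite_distrib)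
  then have "\<forall>\<^sub>F I in sequentially. qtwo_abs (sum (principal_minor M) (\<F> I)) = D"
    by eventually_elim (use partial in auto)
  moreover have "\<forall>\<^sub>F I in sequentially. qtwo_abs (sum (principal_minor M) (\<F> I) - L) < D"
    using lim D by (rule tendsto_qtwoD)
  \<comment> \<open>All late partial sums have absolute value D; a limit closer to them than D
    shares it.\<close>
  ultimately have "\<forall>\<^sub>F I in sequentially. qtwo_abs L = D"
    by eventually_elim (metis qtwo_abs_isosceles)
  then have "qtwo_abs L = D" by simp
  moreover have "infsum (principal_minor M) ?A = L"
    using L by (rule infsumI)
  ultimately show ?thesis
    by (simp add: fredholm_series_def qtwo_abs_mult qtwo_abs_power D_def)
qed

section \<open>The operator U on powers of g\<close>

lemma prodinf_euler_24: "(\<Prod>n. (1 - fps_X ^ Suc n) ^ 24) = (euler_fps ^ 24 :: qtwo fps)"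
proof -
  have "(\<lambda>n. \<Prod>i\<le>n. (1 - fps_X ^ Suc i) ^ 24) \<longlonglongrightarrow> (euler_fps ^ 24 :: qtwo fps)"
    using tendsto_power_fps[OF LIMSEQ_Suc[OF euler_fps_tendsto[where 'a = qtwo]], of 24]
    by (simp only: lessThan_Suc_atMost prod_power_distrib)
  \<comment> \<open>\<open>has_prod\<close> demands a nonzero limit of the partial products.\<close>
  moreover have "euler_fps ^ 24 \<noteq> (0 :: qtwo fps)"
    by (metis fps_nth_0_products(1) fps_zero_nth power_not_zero zero_neq_one)
  ultimately have "(\<lambda>n. (1 - fps_X ^ Suc n) ^ 24) has_prod (euler_fps ^ 24 :: qtwo fps)"
    by (simp add: has_prod_def raw_has_prod_def)
  then show ?thesis by (rule has_prod_unique[symmetric])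
qed

lemma f_q_eq: "f_q = hauptmodul_fps"
proof -
  have D: "Delta_q = fps_X * euler_fps ^ 24"
    by (simp only: Delta_q_def prodinf_euler_24)
  have iB: "inverse odd_minus * odd_minus = (1 :: qtwo fps)"
    by (simp add: inverse_mult_eq_1)
  have "Delta_q oo fps_X ^ 2 = fps_X ^ 2 * even_euler ^ 24"
    unfolding D by (simp add: fps_compose_mult_distrib fps_compose_power)
  also have "\<dots> = fps_X ^ 2 * even_euler ^ 24 * (inverse odd_minus * odd_minus) ^ 24"
    by (simp add: iB)
  also have "\<dots> = hauptmodul_fps * Delta_q"
    unfolding D hauptmodul_fps_def by (subst (2) euler_fps_split) (simp only: power_mult_distrib power2_eq_square mult_ac)
  finally have "Delta_q oo fps_X ^ 2 = hauptmodul_fps * Delta_q" .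
  moreover have "Delta_q \<noteq> 0"
    unfolding D by (metis fps_X_neq_zero fps_nth_0_products(1) fps_zero_nth mult_eq_0_iff power_not_zero zero_neq_one)
  ultimately show ?thesis
    by (simp add: f_q_def)
qed

lemma g_q_eq: "g_q = 64 * hauptmodul_fps"
  by (simp add: g_q_def f_q_eq numeral_fps_const)

lemma g_q_nth_0 [simp]: "fps_nth g_q 0 = 0" and g_q_nth_1 [simp]: "fps_nth g_q (Suc 0) = 64"
  by (simp_all add: g_q_eq hauptmodul_fps_def numeral_fps_const fps_power_zeroth)

lemma g_q_equation:
  defines "G \<equiv> g_q oo fps_X ^ 2"
  shows "g_q ^ 2 = (48 * G + 64 * G ^ 2) * g_q + 64 * G"
proof -
  have G: "G = 64 * (hauptmodul_fps oo fps_X ^ 2)"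
    unfolding G_def g_q_eq by (simp add: fps_compose_mult_distrib numeral_fps_const)
  show ?thesis
    unfolding G unfolding g_q_eq using hauptmodul_equation[where 'a = qtwo] by algebra
qed

lemma U2_add: "U2 (F + H) = U2 F + U2 H"
  by (simp add: U2_def fps_eq_iff)

lemma U2_nth [simp]: "fps_nth (U2 F) n = fps_nth F (2 * n)"
  by (simp add: U2_def)

text \<open>The projection formula. It makes U linear over series in q^2, so that the quadratic
  equation multiplied by a power of g becomes a recurrence.\<close>

lemma U2_compose_mult: "U2 ((F oo fps_X ^ 2) * H) = F * U2 H"
proof (rule fps_ext)
  fix n
  have "fps_nth (U2 ((F oo fps_X ^ 2) * H)) n = (\<Sum>i=0..2*n. fps_nth (F oo fps_X ^ 2) i * fps_nth H (2 * n - i))"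
    by (simp add: fps_mult_nth)
  also have "\<dots> = (\<Sum>i\<in>(\<lambda>k. 2 * k) ` {0..n}. fps_nth (F oo fps_X ^ 2) i * fps_nth H (2 * n - i))"
    by (rule sum.mono_neutral_right) (auto simp: fps_compose_X2_nth elim!: evenE)
  also have "\<dots> = (\<Sum>k=0..n. fps_nth F k * fps_nth H (2 * n - 2 * k))"
    by (subst sum.reindex) (auto simp: inj_on_def fps_compose_X2_nth)
  also have "\<dots> = fps_nth (F * U2 H) n"
    by (simp add: fps_mult_nth diff_mult_distrib2)
  finally show "fps_nth (U2 ((F oo fps_X ^ 2) * H)) n = fps_nth (F * U2 H) n" .
qed

text \<open>\<open>g(q)\<close> and \<open>g(-q)\<close> are the two roots of \<open>g_q_equation\<close>, whose coefficients are series in \<open>q\<^sup>2\<close>; their sum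
  is twice \<open>U g\<close> evaluated at \<open>q\<^sup>2\<close>.\<close>

lemma U2_g_q: "U2 g_q = 24 * g_q + 32 * g_q ^ 2"
proof -
  define G h where "G = g_q oo fps_X ^ 2" and "h = g_q oo - fps_X"
  have Gm: "G oo - fps_X = G" unfolding G_def by (rule compose_X2_assoc)
  have e1: "g_q ^ 2 = (48 * G + 64 * G ^ 2) * g_q + 64 * G"
    unfolding G_def by (rule g_q_equation)
  then have "(g_q ^ 2) oo - fps_X = ((48 * G + 64 * G ^ 2) * g_q + 64 * G) oo - fps_X"
    by simp
  then have e2: "h ^ 2 = (48 * G + 64 * G ^ 2) * h + 64 * G"
    by (simp add: fps_compose_add_distrib fps_compose_mult_distrib Gm numeral_fps_const h_def flip: fps_compose_power)
  have "(g_q - h) * (g_q + h - (48 * G + 64 * G ^ 2)) = 0"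
    using e1 e2 by algebra
  \<comment> \<open>The coefficients of q are 64 and -64.\<close>
  moreover have "g_q - h \<noteq> 0"
  proof
    assume "g_q - h = 0"
    then have "fps_nth (g_q - h) (Suc 0) = 0" by simp
    then show False by (simp add: h_def fps_compose_uminus')
  qed
  ultimately have sum: "g_q + h = 48 * G + 64 * G ^ 2" by simp
  also have "\<dots> = (48 * g_q + 64 * g_q ^ 2) oo fps_X ^ 2"
    by (simp add: G_def fps_compose_add_distrib fps_compose_mult_distrib fps_compose_power numeral_fps_const)
  finally have sum: "g_q + h = (48 * g_q + 64 * g_q ^ 2) oo fps_X ^ 2" .
  show ?thesis
  proof (rule fps_ext)
    fix n
    have "2 * fps_nth (U2 g_q) n = fps_nth (g_q + h) (2 * n)"
      by (simp add: h_def fps_compose_uminus')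
    also have "\<dots> = fps_nth (48 * g_q + 64 * g_q ^ 2) n"
      unfolding sum by (simp add: fps_compose_X2_nth)
    also have "\<dots> = 2 * fps_nth (24 * g_q + 32 * g_q ^ 2) n"
      by (simp add: numeral_fps_const)
    finally show "fps_nth (U2 g_q) n = fps_nth (24 * g_q + 32 * g_q ^ 2) n"
      by (metis mult_left_cancel zero_neq_numeral)
  qed
qed

section \<open>Closed form of U on the powers of g\<close>

lemma U_entry_rec:
  assumes "i \<ge> 2"
  shows "U_entry i (j + 2) = 48 * U_entry (i - 1) (j + 1) + 64 * U_entry (i - 2) (j + 1)
    + (64 * U_entry (i - 1) j :: 'a::field_char_0)"
proof -
  define n where "n = i + j - 2"
  define I J where "I = (of_nat i :: 'a)" and "J = (of_nat j :: 'a)"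
  define a b c P :: 'a where "a = rfact (2 * int i - int j - 2)" and "b = rfact (2 * int j + 4 - int i)"
    and "c = fact n" and "P = 2 ^ (2 * n + 1)"
  have n: "of_nat n = I + J - 2" using assms by (simp add: n_def I_def J_def of_nat_diff)
  have k: "i + (j + 2) - 1 = Suc (Suc (Suc n))" "i - 1 + (j + 1) - 1 = Suc n" "i - 2 + (j + 1) - 1 = n" "i - 1 + j - 1 = n"
    "2 * i + 2 * (j + 2) - 1 = (2 * n + 1) + 6" "2 * (i - 1) + 2 * (j + 1) - 1 = (2 * n + 1) + 2"
    "2 * (i - 2) + 2 * (j + 1) - 1 = 2 * n + 1" "2 * (i - 1) + 2 * j - 1 = 2 * n + 1"
    using assms by (auto simp: n_def)
  have f: "fact (Suc n) = (I + J - 1) * c" "fact (Suc (Suc (Suc n))) = (I + J + 1) * (I + J) * (I + J - 1) * c"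
    by (simp_all add: c_def n)
  have e: "2 * int i - int (j + 2) = 2 * int i - int j - 2" "2 * int (j + 2) - int i = 2 * int j + 4 - int i"
    "2 * int (i - 1) - int (j + 1) = 2 * int i - int j - 2 - 1" "2 * int (j + 1) - int (i - 1) = 2 * int j + 4 - int i - 1"
    "2 * int (i - 2) - int (j + 1) = 2 * int i - int j - 2 - 1 - 1 - 1" "2 * int (j + 1) - int (i - 2) = 2 * int j + 4 - int i"
    "2 * int (i - 1) - int j = 2 * int i - int j - 2" "2 * int j - int (i - 1) = 2 * int j + 4 - int i - 1 - 1 - 1"
    using assms by auto
  have r: "rfact (2 * int i - int j - 2 - 1) = (2 * I - J - 2) * a"
    "rfact (2 * int j + 4 - int i - 1) = (2 * J + 4 - I) * b"
    "rfact (2 * int i - int j - 2 - 1 - 1 - 1) = (2 * I - J - 4) * (2 * I - J - 3) * (2 * I - J - 2) * a"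
    "rfact (2 * int j + 4 - int i - 1 - 1 - 1) = (2 * J + 2 - I) * (2 * J + 3 - I) * (2 * J + 4 - I) * b"
    unfolding rfact_rec a_def b_def I_def J_def by (simp_all add: algebra_simps)
  show ?thesis
    unfolding U_entry_def k e r f power_add a_def[symmetric] b_def[symmetric] c_def[symmetric]
    unfolding P_def[unfolded power_add, symmetric] I_def[symmetric] J_def[symmetric] of_nat_add
    by simp algebra
qed

text \<open>The polynomial in g that represents U (g^j). The closed form has a factor j and would
  give 0 at j = 0, whereas U 1 = 1.\<close>

definition U_poly :: "nat \<Rightarrow> qtwo fps" where
  "U_poly j = (if j = 0 then 1 else Abs_fps (\<lambda>i. U_entry i j))"

lemma U_entry_eq_0: "j > 2 * i \<or> i > 2 * j \<Longrightarrow> U_entry i j = 0"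
  by (auto simp: U_entry_def)

lemma U_entry_0_right [simp]: "U_entry i 0 = 0"
  by (simp add: U_entry_def)

lemma U_poly_rec: "U_poly (j + 2) = (48 * fps_X + 64 * fps_X ^ 2) * U_poly (j + 1) + 64 * fps_X * U_poly j"
proof (rule fps_ext)
  fix i
  let ?R = "(48 * fps_X + 64 * fps_X ^ 2) * U_poly (j + 1) + 64 * fps_X * U_poly j"
  have eq: "?R = 48 * (fps_X * U_poly (j + 1)) + 64 * (fps_X ^ 2 * U_poly (j + 1)) + 64 * (fps_X * U_poly j)"
    by (simp add: algebra_simps)
  have R: "fps_nth ?R i = 48 * (if i = 0 then 0 else fps_nth (U_poly (j + 1)) (i - 1))
      + 64 * (if i < 2 then 0 else fps_nth (U_poly (j + 1)) (i - 2)) + 64 * (if i = 0 then 0 else fps_nth (U_poly j) (i - 1))"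
    unfolding eq by (simp add: numeral_fps_const fps_X_power_mult_nth)
  consider "i = 0" | "i = 1" | "i \<ge> 2" by linarith
  then show "fps_nth (U_poly (j + 2)) i = fps_nth ?R i"
  proof cases
    case 1
    then show ?thesis unfolding R by (simp add: U_poly_def U_entry_eq_0)
  next
    case 2
    show ?thesis
    \<comment> \<open>The only coefficient in which the exceptional value
      \<open>U_poly 0 = 1\<close> takes effect.\<close>
    proof (cases "j = 0")
      case True
      have "U_entry 1 2 = (64 :: qtwo)"
        by (simp add: U_entry_def rfact_def fact_numeral)
      then show ?thesis unfolding R 2 by (simp add: U_poly_def U_entry_eq_0 True numeral_2_eq_2)
    next
      case False
      then show ?thesis unfolding R 2 by (simp add: U_poly_def U_entry_eq_0)
    qed
  next
    case 3
    then show ?thesis unfolding R using U_entry_rec[of i j, where 'a = qtwo] by (simp add: U_poly_def)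
  qed
qed

lemma U2_g_q_power: "U2 (g_q ^ j) = U_poly j oo g_q"
proof -
  have "U2 (g_q ^ j) = U_poly j oo g_q \<and> U2 (g_q ^ Suc j) = U_poly (Suc j) oo g_q"
  proof (induction j)
    case 0
    have "U_poly (Suc 0) = 24 * fps_X + 32 * fps_X ^ 2"
    proof (rule fps_ext)
      fix i :: nat
      consider "i = 0" | "i = 1" | "i = 2" | "i > 2" by linarith
      then show "fps_nth (U_poly (Suc 0)) i = fps_nth (24 * fps_X + 32 * fps_X ^ 2) i"
        by cases (auto simp: U_poly_def U_entry_def numeral_fps_const fps_X_power_nth rfact_def fact_numeral)
    qed
    moreover have "U2 1 = 1" by (rule fps_ext) simp
    ultimately show ?case
      by (simp add: U2_g_q fps_compose_add_distrib fps_compose_mult_distrib numeral_fps_const U_poly_def[of 0]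
          flip: fps_compose_power)
  next
    case (Suc j)
    define G where "G = g_q oo fps_X ^ 2"
    have "g_q ^ Suc (Suc j) = g_q ^ 2 * g_q ^ j" by (simp add: power2_eq_square mult_ac)
    also have "\<dots> = (48 * G + 64 * G ^ 2) * g_q ^ Suc j + (64 * G) * g_q ^ j"
      unfolding g_q_equation G_def[symmetric] by (simp add: algebra_simps)
    also have "\<dots> = ((48 * g_q + 64 * g_q ^ 2) oo fps_X ^ 2) * g_q ^ Suc j + ((64 * g_q) oo fps_X ^ 2) * g_q ^ j"
      by (simp add: G_def fps_compose_add_distrib fps_compose_mult_distrib fps_compose_power numeral_fps_const)
    finally have "U2 (g_q ^ Suc (Suc j)) = (48 * g_q + 64 * g_q ^ 2) * U2 (g_q ^ Suc j) + (64 * g_q) * U2 (g_q ^ j)"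
      by (simp only: U2_add U2_compose_mult)
    also have "\<dots> = ((48 * fps_X + 64 * fps_X ^ 2) * U_poly (j + 1) + 64 * fps_X * U_poly j) oo g_q"
      using Suc.IH
      by (simp add: fps_compose_add_distrib fps_compose_mult_distrib numeral_fps_const flip: fps_compose_power)
    also have "\<dots> = U_poly (Suc (Suc j)) oo g_q"
      unfolding U_poly_rec[symmetric] by simp
    finally show ?case using Suc.IH by blast
  qed
  then show ?thesis by blast
qed

text \<open>Each q-coefficient involves only finitely many j, so U acts termwise without any
  question of convergence.\<close>

lemma U2_g_series:
  assumes "a 0 = 0"
  shows "U2 (g_series a) = g_series (\<lambda>i. \<Sum>j\<le>2*i. U_entry i j * a j)"
proof (rule fps_ext)
  fix n
  have "fps_nth (U2 (g_series a)) n = (\<Sum>j=0..2*n. a j * fps_nth (U2 (g_q ^ j)) n)"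
    by (simp add: g_series_def fps_compose_nth)
  also have "\<dots> = (\<Sum>j=0..2*n. \<Sum>i=0..n. a j * U_entry i j * fps_nth (g_q ^ i) n)"
  proof (rule sum.cong[OF refl])
    fix j
    show "a j * fps_nth (U2 (g_q ^ j)) n = (\<Sum>i=0..n. a j * U_entry i j * fps_nth (g_q ^ i) n)"
    proof (cases "j = 0")
      case True
      then show ?thesis using assms by simp
    next
      case False
      then show ?thesis
        unfolding U2_g_q_power fps_compose_nth by (simp add: U_poly_def sum_distrib_left mult_ac)
    qed
  qed
  also have "\<dots> = (\<Sum>i=0..n. \<Sum>j=0..2*n. a j * U_entry i j * fps_nth (g_q ^ i) n)"
    by (rule sum.swap)
  also have "\<dots> = (\<Sum>i=0..n. \<Sum>j\<le>2*i. a j * U_entry i j * fps_nth (g_q ^ i) n)"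
  proof (rule sum.cong[OF refl])
    fix i assume "i \<in> {0..n}"
    then show "(\<Sum>j=0..2*n. a j * U_entry i j * fps_nth (g_q ^ i) n) = (\<Sum>j\<le>2*i. a j * U_entry i j * fps_nth (g_q ^ i) n)"
      by (intro sum.mono_neutral_right) (auto simp: U_entry_eq_0)
  qed
  also have "\<dots> = fps_nth (g_series (\<lambda>i. \<Sum>j\<le>2*i. U_entry i j * a j)) n"
    by (simp add: g_series_def fps_compose_nth sum_distrib_left sum_distrib_right mult_ac)
  finally show "fps_nth (U2 (g_series a)) n = fps_nth (g_series (\<lambda>i. \<Sum>j\<le>2*i. U_entry i j * a j)) n" .
qed

section \<open>2-adic sizes\<close>

lemma qtwo_abs_odd_fact [simp]: "qtwo_abs (of_nat (odd_fact n)) = 1"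
  by (simp add: qtwo_abs_of_nat_odd odd_odd_fact)

lemma qtwo_abs_ldu_left: "qtwo_abs (ldu_left i t) = qtwo_abs (of_nat (ldu_num i t))"
  by (simp add: ldu_left_def qtwo_abs_mult qtwo_abs_divide qtwo_abs_power)

lemma qtwo_abs_ldu_left_le_1: "qtwo_abs (ldu_left i t) \<le> 1"
  by (simp add: qtwo_abs_ldu_left qtwo_abs_of_nat_le_1)

lemma ldu_left_diag [simp]: "ldu_left t t = 1"
  by (simp add: ldu_left_def)

lemma ldu_left_eq_0: "i < t \<or> 2 * t < i \<Longrightarrow> ldu_left i t = 0"
  by (auto simp: ldu_left_def ldu_num_def)

lemma qtwo_abs_ldu_left_off_diag:
  assumes "i \<noteq> t" "t \<ge> 1"
  shows "qtwo_abs (ldu_left i t) \<le> 1 / 2"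
proof (cases "t < i")
  case True
  then obtain k where "ldu_num i t = 2 * t * k" using ldu_num_double assms by blast
  then show ?thesis
    using qtwo_abs_of_nat_double[of "t * k"] by (simp add: qtwo_abs_ldu_left mult.assoc)
qed (use assms in \<open>auto simp: ldu_left_eq_0\<close>)

lemma ldu_right_diag [simp]: "t \<ge> 1 \<Longrightarrow> ldu_right t t = 1"
  by (simp add: ldu_right_def)

lemma ldu_right_eq_0: "j < t \<or> 2 * t < j \<Longrightarrow> ldu_right t j = 0"
  by (simp add: ldu_right_def ldu_left_eq_0)

lemma qtwo_abs_ldu_right_off_diag:
  assumes "j \<noteq> t" "t \<ge> 1"
  shows "qtwo_abs (ldu_right t j) \<le> 1 / 2"
proof (cases "t < j")
  case True
  then obtain k where k: "ldu_num j t = 2 * t * k" using ldu_num_double assms by blast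
  have "ldu_right t j = (2 * of_nat (k * j) * of_nat (odd_fact t) ^ 2 / of_nat (odd_fact j) ^ 2 :: qtwo)"
    using assms by (simp add: ldu_right_def ldu_left_def k)
  then have "qtwo_abs (ldu_right t j) = qtwo_abs (2 * of_nat (k * j))"
    by (simp add: qtwo_abs_mult qtwo_abs_divide qtwo_abs_power)
  then show ?thesis using qtwo_abs_of_nat_double[of "k * j"] by simp
qed (use assms in \<open>auto simp: ldu_right_eq_0\<close>)

lemma qtwo_abs_ldu_right_le_1:
  assumes "t \<ge> 1"
  shows "qtwo_abs (ldu_right t j) \<le> 1"
proof (cases "j = t")
  case False
  then show ?thesis using qtwo_abs_ldu_right_off_diag[OF False assms] by simp
qed (use assms in simp)

lemma qtwo_abs_ldu_diag: "qtwo_abs (ldu_diag t) = (qtwo_abs (fact (3 * t)) / qtwo_abs (fact t))\<^sup>2 / 2"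
proof -
  have "qtwo_abs 3 = 1" using qtwo_abs_of_nat_odd[of 3] by simp
  then show ?thesis
    by (simp add: ldu_diag_def qtwo_abs_mult qtwo_abs_divide qtwo_abs_power)
qed

lemma ldu_diag_nonzero [simp]: "ldu_diag t \<noteq> (0 :: qtwo)"
  by (simp add: ldu_diag_def)

text \<open>Passing from t to t + 1 multiplies (3 t)! / t! by 3 (3 t + 2) (3 t + 1), an even number,
  and the quotient enters \<open>ldu_diag\<close> squared.\<close>

lemma qtwo_abs_ldu_diag_Suc: "qtwo_abs (ldu_diag (Suc t)) \<le> qtwo_abs (ldu_diag t) / 4"
proof -
  have f: "fact (3 * Suc t) = of_nat (3 * ((3 * t + 2) * (3 * t + 1))) * of_nat (Suc t) * (fact (3 * t) :: qtwo)"
  proof -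
    have e: "3 * Suc t = Suc (Suc (Suc (3 * t)))" by simp
    show ?thesis unfolding e by (simp add: algebra_simps)
  qed
  have "even ((3 * t + 2) * (3 * t + 1))" by simp
  then obtain k where k: "(3 * t + 2) * (3 * t + 1) = 2 * k" by blast
  have c: "qtwo_abs (of_nat (3 * ((3 * t + 2) * (3 * t + 1)))) \<le> 1 / 2"
    unfolding k using qtwo_abs_of_nat_double[of "3 * k"] by (simp add: mult_ac)
  have nz: "qtwo_abs (of_nat (Suc t)) \<noteq> 0" by (simp del: of_nat_Suc)
  have "qtwo_abs (fact (3 * Suc t)) / qtwo_abs (fact (Suc t))
      = qtwo_abs (of_nat (3 * ((3 * t + 2) * (3 * t + 1)))) * (qtwo_abs (fact (3 * t)) / qtwo_abs (fact t))"
    unfolding f fact_Suc qtwo_abs_mult using nz by simp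
  also have "\<dots> \<le> 1 / 2 * (qtwo_abs (fact (3 * t)) / qtwo_abs (fact t))"
    using c by (intro mult_right_mono) auto
  finally have "(qtwo_abs (fact (3 * Suc t)) / qtwo_abs (fact (Suc t)))\<^sup>2
      \<le> (1 / 2 * (qtwo_abs (fact (3 * t)) / qtwo_abs (fact t)))\<^sup>2"
    by (intro power_mono) auto
  then show ?thesis
    unfolding qtwo_abs_ldu_diag by (simp add: power_mult_distrib power_divide)
qed

lemma qtwo_abs_ldu_diag_less:
  assumes "s < t"
  shows "qtwo_abs (ldu_diag t) < qtwo_abs (ldu_diag s)"
proof -
  have "qtwo_abs (ldu_diag (Suc n)) < qtwo_abs (ldu_diag n)" for n
  proof -
    have "qtwo_abs (ldu_diag n) > 0" by simp
    then show ?thesis using qtwo_abs_ldu_diag_Suc[of n] by linarith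
  qed
  then show ?thesis
    using lift_Suc_mono_less[of "\<lambda>n. - qtwo_abs (ldu_diag n)", OF _ assms] by simp
qed

lemma qtwo_abs_ldu_diag_antimono: "s \<le> t \<Longrightarrow> qtwo_abs (ldu_diag t) \<le> qtwo_abs (ldu_diag s)"
  using qtwo_abs_ldu_diag_less[of s t] by (cases "s = t") auto

lemma qtwo_abs_ldu_diag_le: "qtwo_abs (ldu_diag t) \<le> (1 / 4) ^ t"
proof (induction t)
  case (Suc t)
  then show ?case using qtwo_abs_ldu_diag_Suc[of t] by simp
qed (simp add: qtwo_abs_ldu_diag)

lemma ldu_diag_tendsto_0: "(ldu_diag :: nat \<Rightarrow> qtwo) \<longlonglongrightarrow> 0"
  unfolding tendsto_zero_qtwo_iff
proof (rule Lim_null_comparison)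
  show "\<forall>\<^sub>F t in sequentially. norm (qtwo_abs (ldu_diag t)) \<le> (1 / 4) ^ t"
    by (simp add: qtwo_abs_ldu_diag_le)
  show "(\<lambda>t. (1 / 4 :: real) ^ t) \<longlonglongrightarrow> 0"
    by (rule LIMSEQ_realpow_zero) auto
qed

lemma qtwo_abs_fact_double: "qtwo_abs (fact (2 * n)) = qtwo_abs (fact n) / 2 ^ n"
  unfolding fact_double_odd_fact by (simp add: qtwo_abs_mult qtwo_abs_power power_divide)

text \<open>Dropping odd factors and repeatedly using v((2 n)!) = n + v(n!) reduces all factorials
  to (3 j)! and j!. The exponents of 2 linear in j cancel, and a single factor 2 remains.\<close>

lemma qtwo_abs_theorem_factor:
  assumes "j \<ge> 1"
  shows "qtwo_abs ((2 ^ (2 * j) * fact (12 * j + 2) * fact (6 * j)) /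
     (fact (8 * j + 2) * fact (8 * j - 2) * (- (12 * of_nat j)))) = qtwo_abs (ldu_diag j)"
proof -
  define a b J where "a = qtwo_abs (fact (3 * j))" and "b = qtwo_abs (fact j)" and "J = qtwo_abs (of_nat j)"
  have pos: "a > 0" "b > 0" "J > 0" using assms by (simp_all add: a_def b_def J_def)
  have odd: "qtwo_abs (fact (Suc m)) = qtwo_abs (fact m)" if "even m" for m
    using that unfolding fact_Suc qtwo_abs_mult by (subst qtwo_abs_of_nat_odd) auto
  have f6: "qtwo_abs (fact (6 * j)) = a / 2 ^ (3 * j)"
    using qtwo_abs_fact_double[of "3 * j"] by (simp add: a_def)
  have f12: "qtwo_abs (fact (12 * j + 2)) = a / 2 ^ (3 * j) / 2 ^ (6 * j + 1)"
    using qtwo_abs_fact_double[of "6 * j + 1"] odd[of "6 * j"] by (simp add: f6)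
  have f4: "qtwo_abs (fact (4 * j)) = b / 2 ^ j / 2 ^ (2 * j)"
    using qtwo_abs_fact_double[of "2 * j"] qtwo_abs_fact_double[of j] by (simp add: b_def)
  have f8: "qtwo_abs (fact (8 * j + 2)) = b / 2 ^ j / 2 ^ (2 * j) / 2 ^ (4 * j + 1)"
    using qtwo_abs_fact_double[of "4 * j + 1"] odd[of "4 * j"] by (simp add: f4)
  have f8': "qtwo_abs (fact (8 * j - 2)) = b / 2 ^ j / 2 ^ (2 * j) / 2 ^ (4 * j) * 8 / J"
  proof -
    \<comment> \<open>(8 j)! = 8 j (8 j - 1) (8 j - 2)! with 8 j - 1 odd. The absolute value of j
      that this leaves cancels against the one of 12 j.\<close>
    obtain m where m: "8 * j = Suc (Suc m)" "even m"
      using assms that[of "8 * j - 2"] by auto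
    have "qtwo_abs (fact (8 * j)) = qtwo_abs (of_nat (8 * j)) * qtwo_abs (fact (8 * j - 2))"
      unfolding m(1) fact_Suc[of "Suc m"] qtwo_abs_mult using odd[OF m(2)] by simp
    moreover have "qtwo_abs (of_nat (8 * j)) = J / 8"
      using qtwo_abs_power[of 2 3] by (simp add: J_def qtwo_abs_mult power_divide)
    moreover have "qtwo_abs (fact (8 * j)) = b / 2 ^ j / 2 ^ (2 * j) / 2 ^ (4 * j)"
      using qtwo_abs_fact_double[of "4 * j"] by (simp add: f4)
    ultimately have "J / 8 * qtwo_abs (fact (8 * j - 2)) = b / 2 ^ j / 2 ^ (2 * j) / 2 ^ (4 * j)"
      by simp
    then have "qtwo_abs (fact (8 * j - 2)) = (b / 2 ^ j / 2 ^ (2 * j) / 2 ^ (4 * j)) / (J / 8)"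
      using pos by (subst eq_divide_eq) (simp add: mult.commute)
    then show ?thesis by simp
  qed
  have f12': "qtwo_abs (- (12 * of_nat j)) = J / 4"
    using qtwo_abs_of_nat_odd[of 3] qtwo_abs_power[of 2 2] qtwo_abs_mult[of 3 "2 ^ 2"]
    by (simp add: J_def qtwo_abs_mult power_divide)
  have d: "qtwo_abs (ldu_diag j) = (a / b)\<^sup>2 / 2"
    by (simp add: qtwo_abs_ldu_diag a_def b_def)
  define z where "z = (2 :: real) ^ j"
  have z: "z > 0" by (simp add: z_def)
  have zp: "2 ^ (k * j) = z ^ k" for k by (simp add: z_def mult.commute flip: power_mult)
  show ?thesis
    unfolding qtwo_abs_divide qtwo_abs_mult f6 f12 f8 f8' f12' d qtwo_abs_power qtwo_abs_2 power_add power_divide zp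
      z_def[symmetric]
    using pos z by (simp add: field_simps power2_eq_square flip: power_add) (simp flip: power_Suc)
qed

section \<open>The Banach space of cusp forms\<close>

text \<open>The coefficients in powers of g, obtained by substituting the compositional inverse of
  g, which exists because 64 is invertible in the field. Being defined for every power series, they
  are linear without side conditions.\<close>

definition g_coeff :: "qtwo fps \<Rightarrow> nat \<Rightarrow> qtwo" where
  "g_coeff x = fps_nth (x oo fps_inv g_q)"

lemma fps_inv_g_q_nth_0 [simp]: "fps_nth (fps_inv g_q) 0 = 0"
  by (simp add: fps_inv_def)

lemma g_coeff_g_series [simp]: "g_coeff (g_series a) = a"
proof -
  have "g_series a oo fps_inv g_q = Abs_fps a oo (g_q oo fps_inv g_q)"
    unfolding g_series_def by (rule fps_compose_assoc[symmetric]) auto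
  also have "g_q oo fps_inv g_q = fps_X"
    by (rule fps_inv_right) auto
  finally show ?thesis by (simp add: g_coeff_def fun_eq_iff)
qed

lemma g_series_nth_0 [simp]: "fps_nth (g_series a) 0 = a 0"
  by (simp add: g_series_def)

lemma g_series_in_M0: "a \<longlonglongrightarrow> 0 \<Longrightarrow> g_series a \<in> M0"
  by (auto simp: M0_def)

lemma g_series_in_S0: "a \<longlonglongrightarrow> 0 \<Longrightarrow> a 0 = 0 \<Longrightarrow> g_series a \<in> S0"
  by (simp add: S0_def g_series_in_M0)

lemma S0_E:
  assumes "x \<in> S0"
  obtains a where "x = g_series a" "a \<longlonglongrightarrow> 0" "a 0 = 0"
  using assms by (auto simp: S0_def M0_def)

lemma S0D:
  assumes "x \<in> S0"
  shows "g_series (g_coeff x) = x" "g_coeff x \<longlonglongrightarrow> 0" "g_coeff x 0 = 0" "x \<in> M0"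
proof -
  obtain a where x: "x = g_series a" "a \<longlonglongrightarrow> 0" "a 0 = 0"
    using assms by (rule S0_E)
  show "g_series (g_coeff x) = x" "g_coeff x \<longlonglongrightarrow> 0" "g_coeff x 0 = 0"
    unfolding x(1) g_coeff_g_series by (rule refl x)+
  show "x \<in> M0" using assms by (simp add: S0_def)
qed

lemma g_coeff_add: "g_coeff (x + y) i = g_coeff x i + g_coeff y i"
  and g_coeff_diff: "g_coeff (x - y) i = g_coeff x i - g_coeff y i"
  and g_coeff_scale: "g_coeff (fps_const k * x) i = k * g_coeff x i"
  and g_coeff_0 [simp]: "g_coeff 0 i = 0"
  by (simp_all add: g_coeff_def fps_compose_add_distrib fps_compose_sub_distrib fps_compose_mult_distrib)

lemma g_coeff_sum: "g_coeff (sum f A) i = (\<Sum>k\<in>A. g_coeff (f k) i)"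
  by (simp add: g_coeff_def fps_compose_sum_distrib fps_sum_nth)

lemma g_series_add: "g_series a + g_series b = g_series (\<lambda>i. a i + b i)"
  by (simp add: g_series_def fps_eq_iff fps_compose_nth sum.distrib algebra_simps)

lemma g_series_scale: "fps_const k * g_series a = g_series (\<lambda>i. k * a i)"
  by (simp add: g_series_def fps_eq_iff fps_compose_nth sum_distrib_left mult.assoc)

lemma tendsto_zero_qtwo_scale: "(a \<longlongrightarrow> (0 :: qtwo)) F \<Longrightarrow> ((\<lambda>i. k * a i) \<longlongrightarrow> 0) F"
  unfolding tendsto_zero_qtwo_iff qtwo_abs_mult by (rule tendsto_mult_right_zero)

lemma S0_add:
  assumes "x \<in> S0" "y \<in> S0"
  shows "x + y \<in> S0"
proof -
  obtain a where x: "x = g_series a" "a \<longlonglongrightarrow> 0" "a 0 = 0" using assms(1) by (rule S0_E)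
  obtain b where y: "y = g_series b" "b \<longlonglongrightarrow> 0" "b 0 = 0" using assms(2) by (rule S0_E)
  have "(\<lambda>i. a i + b i) \<longlonglongrightarrow> 0" using tendsto_add[OF x(2) y(2)] by simp
  then show ?thesis
    unfolding x(1) y(1) g_series_add using x(3) y(3) by (intro g_series_in_S0) auto
qed

lemma S0_scale:
  assumes "x \<in> S0"
  shows "fps_const k * x \<in> S0"
proof -
  obtain a where x: "x = g_series a" "a \<longlonglongrightarrow> 0" "a 0 = 0" using assms by (rule S0_E)
  show ?thesis
    unfolding x(1) g_series_scale using x(3) tendsto_zero_qtwo_scale[OF x(2)] by (intro g_series_in_S0) auto
qed

lemma S0_0 [simp]: "0 \<in> S0"
proof -
  have "g_series (\<lambda>_. 0) = 0" by (simp add: g_series_def fps_eq_iff fps_compose_nth)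
  then show ?thesis using g_series_in_S0[of "\<lambda>_. 0"] by simp
qed

lemma S0_sum: "(\<And>i. i \<in> A \<Longrightarrow> f i \<in> S0) \<Longrightarrow> sum f A \<in> S0"
  by (induction A rule: infinite_finite_induct) (auto intro: S0_add)

lemma S0_diff: "x \<in> S0 \<Longrightarrow> y \<in> S0 \<Longrightarrow> x - y \<in> S0"
proof -
  assume "x \<in> S0" "y \<in> S0"
  moreover have "x - y = x + fps_const (- 1) * y" by (simp flip: fps_const_neg)
  ultimately show ?thesis using S0_add S0_scale by metis
qed

lemma bdd_above_qtwo_abs:
  assumes "a \<longlonglongrightarrow> (0 :: qtwo)"
  shows "bdd_above (range (\<lambda>n. qtwo_abs (a n)))"
  using assms unfolding tendsto_zero_qtwo_iff
  by (intro bounded_imp_bdd_above convergent_imp_bounded)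

lemma M0_norm_eq: "x \<in> M0 \<Longrightarrow> M0_norm x = (SUP n. qtwo_abs (g_coeff x n))"
  unfolding M0_norm_def by (rule the_equality) (auto simp: M0_def)

lemma qtwo_abs_g_coeff_le: "x \<in> S0 \<Longrightarrow> qtwo_abs (g_coeff x i) \<le> M0_norm x"
  using bdd_above_qtwo_abs[OF S0D(2)]
  by (subst M0_norm_eq) (auto simp: S0D intro!: cSUP_upper)

lemma M0_norm_le: "x \<in> S0 \<Longrightarrow> (\<And>i. qtwo_abs (g_coeff x i) \<le> r) \<Longrightarrow> M0_norm x \<le> r"
  by (subst M0_norm_eq) (auto simp: S0D intro!: cSUP_least)

lemma M0_norm_nonneg: "x \<in> S0 \<Longrightarrow> 0 \<le> M0_norm x"
  using qtwo_abs_g_coeff_le[of x 0] qtwo_abs_nonneg[of "g_coeff x 0"] by linarith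

lemma M0_norm_0 [simp]: "M0_norm 0 = 0"
  using M0_norm_le[of 0 0] M0_norm_nonneg[of 0] by simp

lemma M0_norm_add:
  assumes "x \<in> S0" "y \<in> S0"
  shows "M0_norm (x + y) \<le> M0_norm x + M0_norm y"
proof (rule M0_norm_le)
  show "qtwo_abs (g_coeff (x + y) i) \<le> M0_norm x + M0_norm y" for i
    using qtwo_abs_triangle[of "g_coeff x i" "g_coeff y i"] qtwo_abs_g_coeff_le[OF assms(1), of i]
      qtwo_abs_g_coeff_le[OF assms(2), of i] by (simp add: g_coeff_add)
qed (rule S0_add[OF assms])

lemma M0_norm_scale_le:
  assumes "x \<in> S0"
  shows "M0_norm (fps_const k * x) \<le> qtwo_abs k * M0_norm x"
proof (rule M0_norm_le)
  show "qtwo_abs (g_coeff (fps_const k * x) i) \<le> qtwo_abs k * M0_norm x" for i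
    unfolding g_coeff_scale qtwo_abs_mult using qtwo_abs_g_coeff_le[OF assms] by (rule mult_left_mono) simp
qed (rule S0_scale[OF assms])

text \<open>Supplies the existence of an orthonormal basis, which guarantees that the one chosen in
  \<open>char_series\<close> is orthonormal.\<close>

lemma g_powers_orthonormal_basis: "orthonormal_basis S0 M0_norm (\<lambda>i. g_q ^ Suc i)"
proof -
  have c: "g_coeff (g_q ^ Suc i) k = (if k = Suc i then 1 else 0)"
    and S: "g_q ^ Suc i \<in> S0" for i k
  proof -
    define \<delta> :: "nat \<Rightarrow> qtwo" where "\<delta> = (\<lambda>k. if k = Suc i then 1 else 0)"
    have "Abs_fps \<delta> = fps_X ^ Suc i"
      by (simp add: fps_eq_iff fps_X_power_nth \<delta>_def del: power_Suc)
    then have g: "g_q ^ Suc i = g_series \<delta>"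
      unfolding g_series_def by (simp add: fps_X_power_compose del: power_Suc)
    have "\<forall>\<^sub>F k in sequentially. \<delta> k = 0"
      using eventually_gt_at_top[of "Suc i"] by eventually_elim (simp add: \<delta>_def)
    then have "\<delta> \<longlonglongrightarrow> 0" by (rule tendsto_eventually)
    then show "g_q ^ Suc i \<in> S0" unfolding g by (rule g_series_in_S0) (simp add: \<delta>_def)
    show "g_coeff (g_q ^ Suc i) k = (if k = Suc i then 1 else 0)" unfolding g g_coeff_g_series \<delta>_def ..
  qed
  have rest: "g_coeff (x - (\<Sum>i<n. fps_const (a i) * g_q ^ Suc i)) k
      = g_coeff x k - (if 0 < k \<and> k \<le> n then a (k - 1) else 0)" for x n k a
  proof -
    have "(\<Sum>i<n. a i * (if k = Suc i then 1 else 0)) = (\<Sum>i\<in>(if 0 < k \<and> k \<le> n then {k - 1} else {}). a i)"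
      by (rule sum.mono_neutral_cong_right) (auto split: if_splits)
    then show ?thesis
      by (simp add: g_coeff_diff g_coeff_sum g_coeff_scale c del: power_Suc)
  qed
  have restS: "x - (\<Sum>i<n. fps_const (a i) * g_q ^ Suc i) \<in> S0" if "x \<in> S0" for x n a
    using that S by (intro S0_diff S0_sum S0_scale) auto
  have exp: "basis_expansion M0_norm (\<lambda>i. g_q ^ Suc i) x a \<longleftrightarrow> a = (\<lambda>i. g_coeff x (Suc i))" if x: "x \<in> S0" for x a
  proof
    assume "basis_expansion M0_norm (\<lambda>i. g_q ^ Suc i) x a"
    then have lim: "(\<lambda>n. M0_norm (x - (\<Sum>i<n. fps_const (a i) * g_q ^ Suc i))) \<longlonglongrightarrow> 0"
      by (simp add: basis_expansion_def)
    have "a k = g_coeff x (Suc k)" for k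
    proof -
      have "\<forall>\<^sub>F n in sequentially. qtwo_abs (g_coeff x (Suc k) - a k) \<le> M0_norm (x - (\<Sum>i<n. fps_const (a i) * g_q ^ Suc i))"
        using eventually_ge_at_top[of "Suc k"]
      proof eventually_elim
        case (elim n)
        then show ?case using qtwo_abs_g_coeff_le[OF restS[OF x, where n = n and a = a], of "Suc k"] by (simp only: rest) simp
      qed
      then have "qtwo_abs (g_coeff x (Suc k) - a k) \<le> 0"
        by (rule tendsto_lowerbound[OF lim]) simp
      then have "qtwo_abs (g_coeff x (Suc k) - a k) = 0" by (meson antisym qtwo_abs_nonneg)
      then show ?thesis by simp
    qed
    then show "a = (\<lambda>i. g_coeff x (Suc i))" by auto
  next
    assume a: "a = (\<lambda>i. g_coeff x (Suc i))"
    have c0: "g_coeff x \<longlonglongrightarrow> 0" "g_coeff x 0 = 0" using S0D[OF x] by blast+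
    have "(\<lambda>n. M0_norm (x - (\<Sum>i<n. fps_const (a i) * g_q ^ Suc i))) \<longlonglongrightarrow> 0"
    proof (rule tendstoI)
      fix e :: real assume e: "e > 0"
      obtain n0 where n0: "\<And>n. n \<ge> n0 \<Longrightarrow> qtwo_abs (g_coeff x n) < e / 2"
        using tendsto_zero_qtwoD[OF c0(1) half_gt_zero[OF e]] unfolding eventually_sequentially by blast
      have "dist (M0_norm (x - (\<Sum>i<n. fps_const (a i) * g_q ^ Suc i))) 0 < e" if "n \<ge> n0" for n
      proof -
        have "M0_norm (x - (\<Sum>i<n. fps_const (a i) * g_q ^ Suc i)) \<le> e / 2"
        proof (rule M0_norm_le[OF restS[OF x]])
          fix k
          show "qtwo_abs (g_coeff (x - (\<Sum>i<n. fps_const (a i) * g_q ^ Suc i)) k) \<le> e / 2"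
            unfolding rest using n0[of k] that e c0(2) by (cases "k = 0") (auto simp: a less_imp_le)
        qed
        then show ?thesis using M0_norm_nonneg[OF restS[OF x, where n = n and a = a]] e by (simp del: power_Suc)
      qed
      then show "\<forall>\<^sub>F n in sequentially. dist (M0_norm (x - (\<Sum>i<n. fps_const (a i) * g_q ^ Suc i))) 0 < e"
        unfolding eventually_sequentially by blast
    qed
    then show "basis_expansion M0_norm (\<lambda>i. g_q ^ Suc i) x a"
      using LIMSEQ_Suc[OF c0(1)] by (simp add: basis_expansion_def a)
  qed
  have "M0_norm x = (SUP i. qtwo_abs (g_coeff x (Suc i)))" if x: "x \<in> S0" for x
  proof (rule antisym)
    have c0: "g_coeff x \<longlonglongrightarrow> 0" "g_coeff x 0 = 0" using S0D[OF x] by blast+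
    have bdd: "bdd_above (range (\<lambda>i. qtwo_abs (g_coeff x (Suc i))))"
      by (rule bdd_above_qtwo_abs[OF LIMSEQ_Suc[OF c0(1)]])
    have up: "qtwo_abs (g_coeff x (Suc k)) \<le> (SUP i. qtwo_abs (g_coeff x (Suc i)))" for k
      by (rule cSUP_upper[OF UNIV_I bdd])
    show "M0_norm x \<le> (SUP i. qtwo_abs (g_coeff x (Suc i)))"
    proof (rule M0_norm_le[OF x])
      fix i
      show "qtwo_abs (g_coeff x i) \<le> (SUP i. qtwo_abs (g_coeff x (Suc i)))"
        using order_trans[OF qtwo_abs_nonneg up[of 0]] up[of "i - 1"] c0(2) by (cases i) auto
    qed
    show "(SUP i. qtwo_abs (g_coeff x (Suc i))) \<le> M0_norm x"
      using qtwo_abs_g_coeff_le[OF x] by (intro cSUP_least) auto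
  qed
  then show ?thesis
    unfolding orthonormal_basis_def using S exp by (auto simp del: power_Suc)
qed

section \<open>Expansions in an arbitrary orthonormal basis\<close>

lemma basis_expansion_add:
  assumes "range e \<subseteq> S0" "x \<in> S0" "y \<in> S0" "basis_expansion M0_norm e x a" "basis_expansion M0_norm e y b"
  shows "basis_expansion M0_norm e (x + y) (\<lambda>i. a i + b i)"
  unfolding basis_expansion_def
proof
  show "(\<lambda>i. a i + b i) \<longlonglongrightarrow> 0"
    using assms(4,5) tendsto_add[of a 0 sequentially b 0] by (simp add: basis_expansion_def)
  define u v where "u n = x - (\<Sum>i<n. fps_const (a i) * e i)" and "v n = y - (\<Sum>i<n. fps_const (b i) * e i)" for n
  have uv: "u n \<in> S0" "v n \<in> S0" for n
    using assms(1-3) by (auto simp: u_def v_def intro!: S0_diff S0_sum S0_scale)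
  have eq: "x + y - (\<Sum>i<n. fps_const (a i + b i) * e i) = u n + v n" for n
    by (simp add: u_def v_def algebra_simps sum.distrib flip: fps_const_add)
  have "(\<lambda>n. M0_norm (u n) + M0_norm (v n)) \<longlonglongrightarrow> 0 + 0"
    using assms(4,5) by (intro tendsto_add) (simp_all add: basis_expansion_def u_def v_def)
  then show "(\<lambda>n. M0_norm (x + y - (\<Sum>i<n. fps_const (a i + b i) * e i))) \<longlonglongrightarrow> 0"
    unfolding eq add_0_right
    by (rule Lim_null_comparison[rotated])
       (use uv in \<open>auto intro!: always_eventually simp: M0_norm_add M0_norm_nonneg S0_add\<close>)
qed

lemma basis_expansion_scale:
  assumes "range e \<subseteq> S0" "x \<in> S0" "basis_expansion M0_norm e x a"
  shows "basis_expansion M0_norm e (fps_const k * x) (\<lambda>i. k * a i)"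
  unfolding basis_expansion_def
proof
  show "(\<lambda>i. k * a i) \<longlonglongrightarrow> 0"
    using assms(3) by (simp add: basis_expansion_def tendsto_zero_qtwo_scale)
  define u where "u n = x - (\<Sum>i<n. fps_const (a i) * e i)" for n
  have u: "u n \<in> S0" for n
    using assms(1,2) by (auto simp: u_def intro!: S0_diff S0_sum S0_scale)
  have eq: "fps_const k * x - (\<Sum>i<n. fps_const (k * a i) * e i) = fps_const k * u n" for n
    by (simp add: u_def algebra_simps sum_distrib_left flip: fps_const_mult)
  have "(\<lambda>n. qtwo_abs k * M0_norm (u n)) \<longlonglongrightarrow> 0"
    using assms(3) by (intro tendsto_mult_right_zero) (simp add: basis_expansion_def u_def)
  then show "(\<lambda>n. M0_norm (fps_const k * x - (\<Sum>i<n. fps_const (k * a i) * e i))) \<longlonglongrightarrow> 0"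
    unfolding eq
    by (rule Lim_null_comparison[rotated])
       (use u in \<open>auto intro!: always_eventually simp: M0_norm_scale_le M0_norm_nonneg S0_scale\<close>)
qed

text \<open>Row t of the right triangular factor as a linear form on power series; the sum is finite
  because the row is supported in t <= j <= 2 t. With \<open>left_vector\<close> for the columns of
  the left factor, the factorisation no longer refers to a basis.\<close>

definition right_form :: "nat \<Rightarrow> qtwo fps \<Rightarrow> qtwo" where
  "right_form t x = (\<Sum>j\<le>2*t. ldu_right t j * g_coeff x j)"

definition left_vector :: "nat \<Rightarrow> qtwo fps" where
  "left_vector t = g_series (\<lambda>i. ldu_left i t)"

lemma right_form_add: "right_form t (x + y) = right_form t x + right_form t y"
  and right_form_diff: "right_form t (x - y) = right_form t x - right_form t y"
  by (simp_all add: right_form_def g_coeff_add g_coeff_diff g_coeff_scale algebra_simps sum.distrib sum_subtractf)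

lemma right_form_scale: "right_form t (fps_const k * x) = k * right_form t x"
  by (simp add: right_form_def g_coeff_scale sum_distrib_left mult.left_commute)

lemma right_form_sum: "right_form t (sum f A) = (\<Sum>i\<in>A. right_form t (f i))"
proof (induction A rule: infinite_finite_induct)
  case (insert x A)
  then show ?case by (simp add: right_form_add)
qed (simp_all add: right_form_def)

lemma qtwo_abs_right_form_le:
  assumes "x \<in> S0" "t \<ge> 1"
  shows "qtwo_abs (right_form t x) \<le> M0_norm x"
  unfolding right_form_def
proof (rule qtwo_abs_sum_le)
  fix j
  show "qtwo_abs (ldu_right t j * g_coeff x j) \<le> M0_norm x"
    using qtwo_abs_mult_le[OF qtwo_abs_ldu_right_le_1[OF assms(2)] qtwo_abs_g_coeff_le[OF assms(1)], of j j] by simp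
qed (rule M0_norm_nonneg[OF assms(1)])

lemma left_vector_in_S0:
  assumes "t \<ge> 1"
  shows "left_vector t \<in> S0"
  unfolding left_vector_def
proof (rule g_series_in_S0)
  have "\<forall>\<^sub>F i in sequentially. ldu_left i t = (0 :: qtwo)"
    using eventually_gt_at_top[of "2 * t"] by eventually_elim (simp add: ldu_left_eq_0)
  then show "(\<lambda>i. ldu_left i t) \<longlonglongrightarrow> (0 :: qtwo)" by (rule tendsto_eventually)
qed (use assms in \<open>simp add: ldu_left_eq_0\<close>)

lemma M0_norm_left_vector: "t \<ge> 1 \<Longrightarrow> M0_norm (left_vector t) \<le> 1"
  by (rule M0_norm_le[OF left_vector_in_S0]) (simp_all add: left_vector_def qtwo_abs_ldu_left_le_1)

text \<open>The (t, s) entry of B A. The summand j = t is an entry of A, and every other summand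
  contains an off-diagonal entry of B, hence a factor 2.\<close>

lemma right_form_left_vector:
  assumes "s \<ge> 1" "t \<ge> 1"
  shows "qtwo_abs (right_form t (left_vector s) - (if t = s then 1 else 0)) \<le> 1 / 2"
proof -
  have "right_form t (left_vector s) = ldu_right t t * ldu_left t s + (\<Sum>j\<in>{..2*t} - {t}. ldu_right t j * ldu_left j s)"
    unfolding right_form_def left_vector_def g_coeff_g_series by (rule sum.remove) auto
  then have "right_form t (left_vector s) - (if t = s then 1 else 0)
      = (ldu_left t s - (if t = s then 1 else 0)) + (\<Sum>j\<in>{..2*t} - {t}. ldu_right t j * ldu_left j s)"
    using assms by simp
  moreover have "qtwo_abs (ldu_left t s - (if t = s then 1 else 0)) \<le> 1 / 2"
    using qtwo_abs_ldu_left_off_diag[of t s] assms by auto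
  moreover have "qtwo_abs (\<Sum>j\<in>{..2*t} - {t}. ldu_right t j * ldu_left j s) \<le> 1 / 2"
  proof (rule qtwo_abs_sum_le)
    fix j assume "j \<in> {..2*t} - {t}"
    then show "qtwo_abs (ldu_right t j * ldu_left j s) \<le> 1 / 2"
      using qtwo_abs_mult_le[OF qtwo_abs_ldu_right_off_diag qtwo_abs_ldu_left_le_1, of j t j s] assms by simp
  qed simp
  ultimately show ?thesis
    using qtwo_abs_ultrametric[of "ldu_left t s - (if t = s then 1 else 0)" "\<Sum>j\<in>{..2*t} - {t}. ldu_right t j * ldu_left j s"]
    by (simp only:)
qed

lemma U2_S0:
  assumes "x \<in> S0"
  shows "U2 x \<in> S0"
    and "k \<le> L \<Longrightarrow> g_coeff (U2 x) k = (\<Sum>t<L. ldu_diag (Suc t) * right_form (Suc t) x * ldu_left k (Suc t))"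
proof -
  define b where "b k = (\<Sum>j\<le>2*k. U_entry k j * g_coeff x j)" for k
  have "U2 (g_series (g_coeff x)) = g_series b"
    unfolding b_def[abs_def] by (rule U2_g_series) (rule S0D[OF assms])
  then have U: "U2 x = g_series b" by (simp add: S0D[OF assms])
  have b: "b k = (\<Sum>t<L. ldu_diag (Suc t) * right_form (Suc t) x * ldu_left k (Suc t))" if "k \<le> L" for k L
  proof (cases "k = 0")
    case True
    then show ?thesis by (simp add: b_def ldu_left_eq_0)
  next
    case False
    have "b k = (\<Sum>j\<le>2*k. \<Sum>t\<le>k. ldu_left k t * ldu_diag t * ldu_right t j * g_coeff x j)"
      unfolding b_def
    proof (rule sum.cong[OF refl])
      fix j
      show "U_entry k j * g_coeff x j = (\<Sum>t\<le>k. ldu_left k t * ldu_diag t * ldu_right t j * g_coeff x j)"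
        using U_entry_ldu[of k j, where 'a = qtwo] False S0D(3)[OF assms]
        by (cases "j = 0") (simp_all add: sum_distrib_right)
    qed
    also have "\<dots> = (\<Sum>t\<le>k. \<Sum>j\<le>2*k. ldu_left k t * ldu_diag t * ldu_right t j * g_coeff x j)"
      by (rule sum.swap)
    also have "\<dots> = (\<Sum>t\<le>k. ldu_diag t * right_form t x * ldu_left k t)"
    proof (rule sum.cong[OF refl])
      fix t assume "t \<in> {..k}"
      then have "(\<Sum>j\<le>2*k. ldu_left k t * ldu_diag t * ldu_right t j * g_coeff x j)
          = (\<Sum>j\<le>2*t. ldu_left k t * ldu_diag t * ldu_right t j * g_coeff x j)"
        by (intro sum.mono_neutral_right) (auto simp: ldu_right_eq_0)
      then show "(\<Sum>j\<le>2*k. ldu_left k t * ldu_diag t * ldu_right t j * g_coeff x j) = ldu_diag t * right_form t x * ldu_left k t"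
        by (simp add: right_form_def sum_distrib_left sum_distrib_right mult_ac)
    qed
    also have "\<dots> = (\<Sum>t\<le>L. ldu_diag t * right_form t x * ldu_left k t)"
      using that by (intro sum.mono_neutral_left) (auto simp: ldu_left_eq_0)
    also have "\<dots> = (\<Sum>t<Suc L. ldu_diag t * right_form t x * ldu_left k t)"
      by (simp only: lessThan_Suc_atMost)
    also have "\<dots> = (\<Sum>t<L. ldu_diag (Suc t) * right_form (Suc t) x * ldu_left k (Suc t))"
      unfolding sum.lessThan_Suc_shift using False by (simp add: ldu_left_eq_0)
    finally show ?thesis .
  qed
  then show "g_coeff (U2 x) k = (\<Sum>t<L. ldu_diag (Suc t) * right_form (Suc t) x * ldu_left k (Suc t))" if "k \<le> L"
    using that by (simp add: U)
  \<comment> \<open>Only t with k <= 2 t reach the coefficient k, and their diagonal entries are at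
    most \<open>(1 / 4) ^ (k div 2)\<close>; this decay keeps U x in the space.\<close>
  have bound: "qtwo_abs (b k) \<le> (1 / 4) ^ (k div 2) * M0_norm x" for k
  proof -
    have "qtwo_abs (\<Sum>t<k. ldu_diag (Suc t) * right_form (Suc t) x * ldu_left k (Suc t)) \<le> (1 / 4) ^ (k div 2) * M0_norm x"
    proof (rule qtwo_abs_sum_le)
      fix t
      show "qtwo_abs (ldu_diag (Suc t) * right_form (Suc t) x * ldu_left k (Suc t)) \<le> (1 / 4) ^ (k div 2) * M0_norm x"
      proof (cases "k \<le> 2 * Suc t")
        case True
        then have "(1 / 4 :: real) ^ Suc t \<le> (1 / 4) ^ (k div 2)"
          by (intro power_decreasing) auto
        then have "qtwo_abs (ldu_diag (Suc t)) \<le> (1 / 4) ^ (k div 2)"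
          using qtwo_abs_ldu_diag_le[of "Suc t"] by linarith
        from qtwo_abs_mult_le[OF qtwo_abs_mult_le[OF this qtwo_abs_right_form_le[OF assms, of "Suc t"]] qtwo_abs_ldu_left_le_1[of k "Suc t"]]
        show ?thesis by simp
      qed (use M0_norm_nonneg[OF assms] in \<open>simp add: ldu_left_eq_0\<close>)
    qed (use M0_norm_nonneg[OF assms] in simp)
    then show ?thesis by (simp add: b[of k k])
  qed
  have "b \<longlonglongrightarrow> 0"
    unfolding tendsto_zero_qtwo_iff
  proof (rule Lim_null_comparison)
    show "\<forall>\<^sub>F k in sequentially. norm (qtwo_abs (b k)) \<le> (1 / 4) ^ (k div 2) * M0_norm x"
      using bound by simp
    have "filterlim (\<lambda>k::nat. k div 2) at_top sequentially"
      unfolding filterlim_at_top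
    proof
      fix Z :: nat
      show "\<forall>\<^sub>F k in sequentially. Z \<le> k div 2"
        using eventually_ge_at_top[of "2 * Z"] by eventually_elim auto
    qed
    moreover have "(\<lambda>k. (1 / 4 :: real) ^ k) \<longlonglongrightarrow> 0" by (rule LIMSEQ_realpow_zero) auto
    ultimately have "(\<lambda>k. (1 / 4 :: real) ^ (k div 2)) \<longlonglongrightarrow> 0" by (rule filterlim_compose[rotated])
    then show "(\<lambda>k. (1 / 4) ^ (k div 2) * M0_norm x) \<longlonglongrightarrow> 0" by (rule tendsto_mult_left_zero)
  qed
  then show "U2 x \<in> S0"
    unfolding U by (rule g_series_in_S0) (use b[of 0 0] in simp)
qed

text \<open>U is a limit of operators of finite rank: the linear forms and the vectors have norm at
  most 1, so the tail is bounded by its largest diagonal entry.\<close>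

lemma M0_norm_U2_truncation:
  assumes "x \<in> S0"
  shows "M0_norm (U2 x - (\<Sum>t<N. fps_const (ldu_diag (Suc t) * right_form (Suc t) x) * left_vector (Suc t)))
    \<le> qtwo_abs (ldu_diag (Suc N)) * M0_norm x"
proof (rule M0_norm_le)
  show "U2 x - (\<Sum>t<N. fps_const (ldu_diag (Suc t) * right_form (Suc t) x) * left_vector (Suc t)) \<in> S0"
    using U2_S0(1)[OF assms] by (intro S0_diff S0_sum S0_scale left_vector_in_S0) auto
  fix k
  define h where "h t = ldu_diag (Suc t) * right_form (Suc t) x * ldu_left k (Suc t)" for t
  \<comment> \<open>Any length at least k represents the coefficient k; k + N also covers the N
    terms to be subtracted.\<close>
  have "g_coeff (U2 x - (\<Sum>t<N. fps_const (ldu_diag (Suc t) * right_form (Suc t) x) * left_vector (Suc t))) k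
      = (\<Sum>t<k+N. h t) - (\<Sum>t<N. h t)"
    by (simp add: g_coeff_diff g_coeff_sum g_coeff_scale left_vector_def U2_S0(2)[OF assms, of k "k + N"] h_def)
  also have "\<dots> = (\<Sum>t\<in>{..<k+N} - {..<N}. h t)"
    by (rule sum_diff[symmetric]) auto
  also have "qtwo_abs \<dots> \<le> qtwo_abs (ldu_diag (Suc N)) * M0_norm x"
  proof (rule qtwo_abs_sum_le)
    fix t assume "t \<in> {..<k+N} - {..<N}"
    then have "qtwo_abs (ldu_diag (Suc t)) \<le> qtwo_abs (ldu_diag (Suc N))"
      by (intro qtwo_abs_ldu_diag_antimono) auto
    from qtwo_abs_mult_le[OF qtwo_abs_mult_le[OF this qtwo_abs_right_form_le[OF assms, of "Suc t"]] qtwo_abs_ldu_left_le_1[of k "Suc t"]]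
    show "qtwo_abs (h t) \<le> qtwo_abs (ldu_diag (Suc N)) * M0_norm x"
      by (simp add: h_def)
  qed (simp add: M0_norm_nonneg[OF assms])
  finally show "qtwo_abs (g_coeff (U2 x - (\<Sum>t<N. fps_const (ldu_diag (Suc t) * right_form (Suc t) x) * left_vector (Suc t))) k)
    \<le> qtwo_abs (ldu_diag (Suc N)) * M0_norm x" .
qed

text \<open>In the basis e the matrix of U is X D Y, where X consists of the coordinates of the
  vectors \<open>left_vector\<close> and Y of the values of the forms \<open>right_form\<close> on
  e.\<close>

lemma qtwo_abs_fredholm_U2:
  assumes ob: "orthonormal_basis S0 M0_norm e"
  shows "qtwo_abs (fps_nth (fredholm_series (matrix_entry M0_norm e U2)) n) = (\<Prod>t<n. qtwo_abs (ldu_diag (Suc t)))"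
proof -
  have eS: "range e \<subseteq> S0" and ex1: "\<And>x. x \<in> S0 \<Longrightarrow> \<exists>!a. basis_expansion M0_norm e x a"
    and nrm: "\<And>x a. x \<in> S0 \<Longrightarrow> basis_expansion M0_norm e x a \<Longrightarrow> M0_norm x = (SUP i. qtwo_abs (a i))"
    using ob by (auto simp: orthonormal_basis_def)
  have ej: "e j \<in> S0" for j using eS by auto
  define \<epsilon> where "\<epsilon> x = (THE a. basis_expansion M0_norm e x a)" for x
  have exp: "basis_expansion M0_norm e x (\<epsilon> x)" if "x \<in> S0" for x
    unfolding \<epsilon>_def by (rule theI'[OF ex1[OF that]])
  have eps_eq: "\<epsilon> x = a" if "x \<in> S0" "basis_expansion M0_norm e x a" for x a
    using ex1[OF that(1)] exp[OF that(1)] that(2) by blast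
  have eps_add: "\<epsilon> (x + y) = (\<lambda>i. \<epsilon> x i + \<epsilon> y i)" if "x \<in> S0" "y \<in> S0" for x y
    using that by (intro eps_eq S0_add basis_expansion_add eS exp)
  have eps_scale: "\<epsilon> (fps_const k * x) = (\<lambda>i. k * \<epsilon> x i)" if "x \<in> S0" for k x
    using that by (intro eps_eq S0_scale basis_expansion_scale eS exp)
  have eps_diff: "\<epsilon> (x - y) i = \<epsilon> x i - \<epsilon> y i" if "x \<in> S0" "y \<in> S0" for x y i
  proof -
    have "x - y = x + fps_const (- 1) * y" by (simp flip: fps_const_neg)
    then show ?thesis using that by (simp only: eps_add eps_scale S0_scale) simp
  qed
  have eps_0: "\<epsilon> 0 i = 0" for i
    using fun_cong[OF eps_scale[OF S0_0, of 0], of i] by simp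
  have eps_sum: "\<epsilon> (sum f A) i = (\<Sum>k\<in>A. \<epsilon> (f k) i)" if "\<And>k. k \<in> A \<Longrightarrow> f k \<in> S0" for f :: "nat \<Rightarrow> qtwo fps" and A i
    using that
  proof (induction A rule: infinite_finite_induct)
    case (insert a A)
    have "sum f A \<in> S0" using insert.prems by (intro S0_sum) auto
    moreover have "f a \<in> S0" using insert.prems by simp
    ultimately have "\<epsilon> (f a + sum f A) i = \<epsilon> (f a) i + \<epsilon> (sum f A) i" by (simp only: eps_add)
    then show ?case using insert by simp
  qed (simp_all add: eps_0)
  have eps_lim: "\<epsilon> x \<longlonglongrightarrow> 0" if "x \<in> S0" for x
    using exp[OF that] by (simp add: basis_expansion_def)
  have eps_le: "qtwo_abs (\<epsilon> x i) \<le> M0_norm x" if "x \<in> S0" for x i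
    unfolding nrm[OF that exp[OF that]] using bdd_above_qtwo_abs[OF eps_lim[OF that]] by (intro cSUP_upper) auto
  \<comment> \<open>The expansion of e j is the j-th unit sequence, so orthonormality bounds its
    norm by 1.\<close>
  have e_norm: "M0_norm (e j) \<le> 1" for j
  proof -
    define \<delta> :: "nat \<Rightarrow> qtwo" where "\<delta> i = (if i = j then 1 else 0)" for i
    have "\<forall>\<^sub>F i in sequentially. \<delta> i = 0"
      using eventually_gt_at_top[of j] by eventually_elim (simp add: \<delta>_def)
    then have lim: "\<delta> \<longlonglongrightarrow> 0" by (rule tendsto_eventually)
    have es: "(\<Sum>i<n. fps_const (\<delta> i) * e i) = e j" if "j < n" for n
    proof -
      have "(\<Sum>i<n. fps_const (\<delta> i) * e i) = (\<Sum>i\<in>{j}. e i)"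
        by (rule sum.mono_neutral_cong_right) (use that in \<open>auto simp: \<delta>_def\<close>)
      then show ?thesis by simp
    qed
    have "\<forall>\<^sub>F n in sequentially. M0_norm (e j - (\<Sum>i<n. fps_const (\<delta> i) * e i)) = 0"
      using eventually_gt_at_top[of j] by eventually_elim (simp add: es)
    then have "basis_expansion M0_norm e (e j) \<delta>"
      unfolding basis_expansion_def by (intro conjI lim) (rule tendsto_eventually)
    from nrm[OF ej this] have "M0_norm (e j) = (SUP i. qtwo_abs (\<delta> i))" .
    also have "\<dots> \<le> 1" by (rule cSUP_least) (auto simp: \<delta>_def)
    finally show ?thesis .
  qed
  show ?thesis
  proof (rule qtwo_abs_fredholm_series[where X = "\<lambda>i t. \<epsilon> (left_vector (Suc t)) i" and Y = "\<lambda>t j. right_form (Suc t) (e j)"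
      and d = "\<lambda>t. ldu_diag (Suc t)" and K = "\<lambda>t s. right_form (Suc t) (left_vector (Suc s))"])
    have wS: "left_vector (Suc t) \<in> S0" for t by (rule left_vector_in_S0) simp
    show "qtwo_abs (\<epsilon> (left_vector (Suc t)) i) \<le> 1" for i t
      by (rule order_trans[OF eps_le[OF wS] M0_norm_left_vector]) simp
    show "qtwo_abs (right_form (Suc t) (e j)) \<le> 1" for t j
      using qtwo_abs_right_form_le[OF ej, of "Suc t" j] e_norm[of j] by simp
    show "ldu_diag (Suc t) \<noteq> (0 :: qtwo)" for t by simp
    show "qtwo_abs (ldu_diag (Suc t)) \<le> 1" for t
      using qtwo_abs_ldu_diag_le[of "Suc t"] power_le_one[of "1 / 4 :: real" "Suc t"] by simp
    show "qtwo_abs (ldu_diag (Suc t)) < qtwo_abs (ldu_diag (Suc s))" if "s < t" for s t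
      using that by (intro qtwo_abs_ldu_diag_less) simp
    show "(\<lambda>t. ldu_diag (Suc t)) \<longlonglongrightarrow> (0 :: qtwo)"
      by (rule LIMSEQ_Suc[OF ldu_diag_tendsto_0])
    show "(\<lambda>i. \<epsilon> (left_vector (Suc t)) i) \<longlonglongrightarrow> 0" for t
      using eps_lim[OF wS] .
    show "qtwo_abs (right_form (Suc t) (left_vector (Suc s)) - (if t = s then 1 else 0)) \<le> 1 / 2" for t s
      using right_form_left_vector[of "Suc s" "Suc t"] by simp
    show "qtwo_abs (matrix_entry M0_norm e U2 i j
        - (\<Sum>t<N. ldu_diag (Suc t) * \<epsilon> (left_vector (Suc t)) i * right_form (Suc t) (e j))) \<le> qtwo_abs (ldu_diag (Suc N))" for i j N
    proof -
      define r where "r = U2 (e j) - (\<Sum>t<N. fps_const (ldu_diag (Suc t) * right_form (Suc t) (e j)) * left_vector (Suc t))"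
      have sS: "(\<Sum>t<N. fps_const (ldu_diag (Suc t) * right_form (Suc t) (e j)) * left_vector (Suc t)) \<in> S0"
        by (intro S0_sum S0_scale wS)
      have rS: "r \<in> S0" unfolding r_def by (intro S0_diff sS U2_S0(1) ej)
      have "\<epsilon> r i = \<epsilon> (U2 (e j)) i - (\<Sum>t<N. ldu_diag (Suc t) * right_form (Suc t) (e j) * \<epsilon> (left_vector (Suc t)) i)"
        unfolding r_def eps_diff[OF U2_S0(1)[OF ej] sS] by (simp add: eps_sum eps_scale wS S0_scale)
      then have "matrix_entry M0_norm e U2 i j
        - (\<Sum>t<N. ldu_diag (Suc t) * \<epsilon> (left_vector (Suc t)) i * right_form (Suc t) (e j)) = \<epsilon> r i"
        by (simp add: matrix_entry_def \<epsilon>_def mult_ac)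
      moreover have "M0_norm r \<le> qtwo_abs (ldu_diag (Suc N)) * 1"
        unfolding r_def using M0_norm_U2_truncation[OF ej, of j N] mult_left_mono[OF e_norm[of j] qtwo_abs_nonneg[of "ldu_diag (Suc N)"]]
        by linarith
      ultimately show ?thesis using eps_le[OF rS, of i] by simp
    qed
    \<comment> \<open>Y X converges to B A: apply the linear form, continuous by
      \<open>qtwo_abs_right_form_le\<close>, to the expansion of the vector in the basis e.\<close>
    show "(\<lambda>I. \<Sum>i<I. right_form (Suc t) (e i) * \<epsilon> (left_vector (Suc s)) i) \<longlonglongrightarrow> right_form (Suc t) (left_vector (Suc s))" for t s
    proof -
      let ?x = "left_vector (Suc s)"
      define v where "v I = ?x - (\<Sum>i<I. fps_const (\<epsilon> ?x i) * e i)" for I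
      have vS: "v I \<in> S0" for I unfolding v_def by (intro S0_diff S0_sum S0_scale wS ej)
      have v0: "(\<lambda>I. M0_norm (v I)) \<longlonglongrightarrow> 0"
        using exp[OF wS, of s] by (simp add: basis_expansion_def v_def)
      have "(\<lambda>I. right_form (Suc t) (v I)) \<longlonglongrightarrow> 0"
        unfolding tendsto_zero_qtwo_iff
        by (rule Lim_null_comparison[OF _ v0]) (simp add: qtwo_abs_right_form_le[OF vS])
      moreover have "right_form (Suc t) (v I) = right_form (Suc t) ?x - (\<Sum>i<I. right_form (Suc t) (e i) * \<epsilon> ?x i)" for I
        unfolding v_def right_form_diff right_form_sum right_form_scale by (simp only: mult.commute)
      ultimately have "(\<lambda>I. right_form (Suc t) ?x - (\<Sum>i<I. right_form (Suc t) (e i) * \<epsilon> ?x i)) \<longlonglongrightarrow> 0"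
        by simp
      then show ?thesis
        unfolding tendsto_zero_qtwo_iff tendsto_dist_iff[of _ "right_form (Suc t) ?x"] dist_qtwo_def
        by (simp add: qtwo_abs_diff_commute)
    qed
  qed
qed

section \<open>Comparison of the Newton polygons\<close>

lemma newton_polygon_cong_abs:
  assumes "\<And>n. qtwo_abs (fps_nth P n) = qtwo_abs (fps_nth Q n)"
  shows "newton_polygon P = newton_polygon Q"
proof -
  have "fps_nth P n = 0 \<longleftrightarrow> fps_nth Q n = 0" for n
    using assms[of n] qtwo_abs_eq_0_iff by metis
  then have "newton_points P = newton_points Q"
    by (auto simp: newton_points_def val2_def assms)
  then show ?thesis by (simp add: newton_polygon_def fun_eq_iff)
qed

theorem theorem1:
  "newton_polygon (char_series S0 M0_norm U2) =
   newton_polygon (Abs_fps (\<lambda>n. \<Prod>j=1..n.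
     (2 ^ (2 * j) * fact (12 * j + 2) * fact (6 * j)) /
     (fact (8 * j + 2) * fact (8 * j - 2) * (- (12 * of_nat j)))))"
proof (rule newton_polygon_cong_abs)
  fix n
  have "orthonormal_basis S0 M0_norm (SOME e. orthonormal_basis S0 M0_norm e)"
    using g_powers_orthonormal_basis by (rule someI[of "orthonormal_basis S0 M0_norm"])
  then have "qtwo_abs (fps_nth (char_series S0 M0_norm U2) n) = (\<Prod>t<n. qtwo_abs (ldu_diag (Suc t)))"
    unfolding char_series_def by (rule qtwo_abs_fredholm_U2)
  also have "\<dots> = (\<Prod>j=1..n. qtwo_abs (ldu_diag j))"
    by (rule prod.reindex_bij_witness[of _ "\<lambda>j. j - 1" Suc]) auto
  also have "\<dots> = (\<Prod>j=1..n. qtwo_abs ((2 ^ (2 * j) * fact (12 * j + 2) * fact (6 * j)) /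
     (fact (8 * j + 2) * fact (8 * j - 2) * (- (12 * of_nat j)))))"
    by (intro prod.cong refl qtwo_abs_theorem_factor[symmetric]) simp
  finally show "qtwo_abs (fps_nth (char_series S0 M0_norm U2) n) = qtwo_abs (fps_nth (Abs_fps (\<lambda>n. \<Prod>j=1..n.
     (2 ^ (2 * j) * fact (12 * j + 2) * fact (6 * j)) /
     (fact (8 * j + 2) * fact (8 * j - 2) * (- (12 * of_nat j))))) n)"
    by (simp only: fps_nth_Abs_fps qtwo_abs_prod)
qed

end
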